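(* For every digraph $G$, the canonical map $N_1G\to N_\infty G$ is anodyne, i.e. an acyclic cofibration in the model structure on cubical sets.
   Context: Digraphs: vertex set with arrows $E(G)\subseteq V(G)^2$ containing the diagonal; digraph maps preserve arrows. Box product $G\otimes H$: arrow $(g,h)\to(g',h')$ iff ($g\to g'$, $h=h'$) or ($g=g'$, $h\to h'$). $I_n$: vertices $\{0,\dots,n\}$, non-degenerate arrows $2i\to 2i+1$, $2j+2\to 2j+1$; $I_n^{\mathrm{op}}$ reversed; $I_n^{+1}=I_n$, $I_n^{-1}=I_n^{\mathrm{op}}$. For an interval $J$ with vertices $\{0,\dots,k\}$, $N_JG$ is the cubical set with connections with $n$-cubes $\mathrm{Hom}(J^{\otimes n},G)$ (faces insert coordinate $0$ or $k$, degeneracies delete a coordinate, connections take max/min of adjacent coordinates); $N_m=N_{I_m}$, $N_m^{\mathrm{op}}=N_{I_m^{\mathrm{op}}}$. $r:I^\varepsilon_{n+1}\to I^\varepsilon_n$, $r(x)=\min(x,n)$; $l:I^{-\varepsilon}_{n+1}\to I^\varepsilon_n$, $l(x)=\max(x-1,0)$. $N_\infty G=\mathrm{colim}\big(N_1G\xrightarrow{r^*}N_2G\xrightarrow{l^*}N_3^{\mathrm{op}}G\xrightarrow{r^*}N_4^{\mathrm{op}}G\xrightarrow{l^*}\cdots\big)$. The model structure on cubical sets with connections is the standard one: cofibrations are monomorphisms, generated acyclic cofibrations by $\sqcap^n_{i,\varepsilon}\hookrightarrow\Box^n$. *)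

theory Defs
  imports Main "HOL-Library.FuncSet"
begin

text \<open>Vertices of the standard cube [1]^n are boolean lists of length n.  A morphism
[1]^m -> [1]^n is represented by a function on boolean lists, restricted (extensional)
to lists of length m.  The category is generated by faces, degeneracies and
(max and min) connections.\<close>

definition bdom :: "nat \<Rightarrow> bool list set" where
  "bdom n = {xs. length xs = n}"

inductive boxhom :: "nat \<Rightarrow> nat \<Rightarrow> (bool list \<Rightarrow> bool list) \<Rightarrow> bool" where
  bh_id: "boxhom n n (restrict id (bdom n))"
| bh_face: "i \<le> n \<Longrightarrow> boxhom n (Suc n) (restrict (\<lambda>x. take i x @ e # drop i x) (bdom n))"
| bh_degen: "i < Suc n \<Longrightarrow> boxhom (Suc n) n (restrict (\<lambda>x. take i x @ drop (Suc i) x) (bdom (Suc n)))"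
| bh_conn_max: "i < n \<Longrightarrow>
     boxhom (Suc n) n (restrict (\<lambda>x. take i x @ (x ! i \<or> x ! Suc i) # drop (Suc (Suc i)) x) (bdom (Suc n)))"
| bh_conn_min: "i < n \<Longrightarrow>
     boxhom (Suc n) n (restrict (\<lambda>x. take i x @ (x ! i \<and> x ! Suc i) # drop (Suc (Suc i)) x) (bdom (Suc n)))"
| bh_comp: "boxhom l m g \<Longrightarrow> boxhom m n f \<Longrightarrow> boxhom l n (restrict (f \<circ> g) (bdom l))"

record 'a cset =
  cells :: "nat \<Rightarrow> 'a set"
  act :: "nat \<Rightarrow> nat \<Rightarrow> (bool list \<Rightarrow> bool list) \<Rightarrow> 'a \<Rightarrow> 'a"
    \<comment> \<open>act m n phi : X_n -> X_m for phi : [1]^m -> [1]^n\<close>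

definition cubical_set :: "'a cset \<Rightarrow> bool" where
  "cubical_set X \<longleftrightarrow>
     (\<forall>m n phi x. boxhom m n phi \<and> x \<in> cells X n \<longrightarrow> act X m n phi x \<in> cells X m) \<and>
     (\<forall>n x. x \<in> cells X n \<longrightarrow> act X n n (restrict id (bdom n)) x = x) \<and>
     (\<forall>l m n g f x. boxhom l m g \<and> boxhom m n f \<and> x \<in> cells X n \<longrightarrow>
        act X l m g (act X m n f x) = act X l n (restrict (f \<circ> g) (bdom l)) x)"

definition cmap :: "'a cset \<Rightarrow> 'b cset \<Rightarrow> (nat \<Rightarrow> 'a \<Rightarrow> 'b) \<Rightarrow> bool" where
  "cmap X Y F \<longleftrightarrow>
     (\<forall>n x. x \<in> cells X n \<longrightarrow> F n x \<in> cells Y n) \<and>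
     (\<forall>m n phi x. boxhom m n phi \<and> x \<in> cells X n \<longrightarrow> F m (act X m n phi x) = act Y m n phi (F n x))"

definition cmono :: "'a cset \<Rightarrow> 'b cset \<Rightarrow> (nat \<Rightarrow> 'a \<Rightarrow> 'b) \<Rightarrow> bool" where
  "cmono X Y F \<longleftrightarrow> cmap X Y F \<and> (\<forall>n. inj_on (F n) (cells X n))"

definition llp :: "'a cset \<Rightarrow> 'b cset \<Rightarrow> (nat \<Rightarrow> 'a \<Rightarrow> 'b) \<Rightarrow> 'e cset \<Rightarrow> 'c cset \<Rightarrow> (nat \<Rightarrow> 'e \<Rightarrow> 'c) \<Rightarrow> bool" where
  "llp X Y i E B p \<longleftrightarrow>
     (\<forall>u v. cmap X E u \<and> cmap Y B v \<and> (\<forall>n x. x \<in> cells X n \<longrightarrow> p n (u n x) = v n (i n x)) \<longrightarrow>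
        (\<exists>h. cmap Y E h \<and> (\<forall>n x. x \<in> cells X n \<longrightarrow> h n (i n x) = u n x) \<and>
             (\<forall>n y. y \<in> cells Y n \<longrightarrow> p n (h n y) = v n y)))"

definition cube :: "nat \<Rightarrow> (bool list \<Rightarrow> bool list) cset" where
  "cube n = \<lparr> cells = (\<lambda>k. {phi. boxhom k n phi}),
              act = (\<lambda>m k g phi. restrict (phi \<circ> g) (bdom m)) \<rparr>"

text \<open>Cubes of the open box: those factoring through a face (j,e) different from (i,eps),
  i.e. whose image lies in the face x_j = e.\<close>
definition openbox :: "nat \<Rightarrow> nat \<Rightarrow> bool \<Rightarrow> (bool list \<Rightarrow> bool list) cset" where
  "openbox n i eps = \<lparr> cells = (\<lambda>k. {phi. boxhom k n phi \<and>
        (\<exists>j e. j < n \<and> (j, e) \<noteq> (i, eps) \<and> (\<forall>x \<in> bdom k. phi x ! j = e))}),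
              act = (\<lambda>m k g phi. restrict (phi \<circ> g) (bdom m)) \<rparr>"

definition kan_fibration :: "'e cset \<Rightarrow> 'b cset \<Rightarrow> (nat \<Rightarrow> 'e \<Rightarrow> 'b) \<Rightarrow> bool" where
  "kan_fibration E B p \<longleftrightarrow> cubical_set E \<and> cubical_set B \<and> cmap E B p \<and>
     (\<forall>n i eps. i < n \<longrightarrow> llp (openbox n i eps) (cube n) (\<lambda>_ x. x) E B p)"

text \<open>A digraph is a reflexive relation on its vertex type.  The interval I_k^e has
  vertices 0..k; for e = True (I_k) the non-degenerate arrows go from even vertices to
  adjacent (odd) vertices, for e = False (I_k^op) they are reversed.\<close>
definition iarr :: "bool \<Rightarrow> nat \<Rightarrow> nat \<Rightarrow> nat \<Rightarrow> bool" where
  "iarr e k a b \<longleftrightarrow> a \<le> k \<and> b \<le> k \<and> (a = b \<or> ((b = Suc a \<or> a = Suc b) \<and> even a = e))"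

definition jdom :: "nat \<Rightarrow> nat \<Rightarrow> nat list set" where
  "jdom k n = {xs. length xs = n \<and> set xs \<subseteq> {0..k}}"

definition jarr :: "bool \<Rightarrow> nat \<Rightarrow> nat list \<Rightarrow> nat list \<Rightarrow> bool" where
  "jarr e k x y \<longleftrightarrow> length x = length y \<and>
     (x = y \<or> (\<exists>j < length x. (\<forall>i < length x. i \<noteq> j \<longrightarrow> x ! i = y ! i) \<and> iarr e k (x ! j) (y ! j)))"

text \<open>Extension of a box morphism phi : [1]^m -> [1]^n to J^m -> J^n, (0 |-> 0, 1 |-> k),
  via thresholds; on generators it inserts 0/k, deletes coordinates, takes max/min.\<close>
definition jext :: "nat \<Rightarrow> nat \<Rightarrow> (bool list \<Rightarrow> bool list) \<Rightarrow> nat list \<Rightarrow> nat list" where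
  "jext k n phi x = map (\<lambda>j. Max ({0} \<union> {t \<in> {1..k}. phi (map (\<lambda>xi. t \<le> xi) x) ! j})) [0..<n]"

definition NJ :: "nat \<Rightarrow> bool \<Rightarrow> ('v \<times> 'v) set \<Rightarrow> (nat list \<Rightarrow> 'v) cset" where
  "NJ k e G = \<lparr> cells = (\<lambda>n. {f. f \<in> extensional (jdom k n) \<and>
                   (\<forall>x \<in> jdom k n. \<forall>y \<in> jdom k n. jarr e k x y \<longrightarrow> (f x, f y) \<in> G)}),
                act = (\<lambda>m n phi f. restrict (\<lambda>x. f (jext k n phi x)) (jdom k m)) \<rparr>"

definition stage_eps :: "nat \<Rightarrow> bool" where
  "stage_eps s \<longleftrightarrow> s mod 4 = 1 \<or> s mod 4 = 2"

definition Nst :: "('v \<times> 'v) set \<Rightarrow> nat \<Rightarrow> (nat list \<Rightarrow> 'v) cset" where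
  "Nst G s = NJ s (stage_eps s) G"

text \<open>Transition stage s -> s+1: r^* for s odd (r(x) = min(x,s)), l^* for s even
  (l(x) = max(x-1,0)).\<close>
definition tmap :: "nat \<Rightarrow> nat \<Rightarrow> nat" where
  "tmap s x = (if odd s then min x s else x - 1)"

definition trans_st :: "nat \<Rightarrow> nat \<Rightarrow> (nat list \<Rightarrow> 'v) \<Rightarrow> (nat list \<Rightarrow> 'v)" where
  "trans_st s n f = restrict (\<lambda>x. f (map (tmap s) x)) (jdom (Suc s) n)"

fun push :: "nat \<Rightarrow> nat \<Rightarrow> nat \<Rightarrow> (nat list \<Rightarrow> 'v) \<Rightarrow> (nat list \<Rightarrow> 'v)" where
  "push s 0 n f = f"
| "push s (Suc d) n f = trans_st (s + d) n (push s d n f)"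

definition colim_rel :: "nat \<Rightarrow> nat \<times> (nat list \<Rightarrow> 'v) \<Rightarrow> nat \<times> (nat list \<Rightarrow> 'v) \<Rightarrow> bool" where
  "colim_rel n a b \<longleftrightarrow> (\<exists>t. fst a \<le> t \<and> fst b \<le> t \<and>
       push (fst a) (t - fst a) n (snd a) = push (fst b) (t - fst b) n (snd b))"

definition colim_cls :: "('v \<times> 'v) set \<Rightarrow> nat \<Rightarrow> nat \<times> (nat list \<Rightarrow> 'v) \<Rightarrow> (nat \<times> (nat list \<Rightarrow> 'v)) set" where
  "colim_cls G n a = {b. 1 \<le> fst b \<and> snd b \<in> cells (Nst G (fst b)) n \<and> colim_rel n a b}"

definition Ninf :: "('v \<times> 'v) set \<Rightarrow> (nat \<times> (nat list \<Rightarrow> 'v)) set cset" where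
  "Ninf G = \<lparr> cells = (\<lambda>n. {colim_cls G n (s, f) | s f. 1 \<le> s \<and> f \<in> cells (Nst G s) n}),
              act = (\<lambda>m n phi c. {b. 1 \<le> fst b \<and> snd b \<in> cells (Nst G (fst b)) m \<and>
                 (\<exists>a \<in> c. colim_rel m (fst a, act (Nst G (fst a)) m n phi (snd a)) b)}) \<rparr>"

definition canon :: "('v \<times> 'v) set \<Rightarrow> nat \<Rightarrow> (nat list \<Rightarrow> 'v) \<Rightarrow> (nat \<times> (nat list \<Rightarrow> 'v)) set" where
  "canon G n f = colim_cls G n (1, f)"

end

theory Submission
  imports Defs
begin

text \<open>Each transition map is an inclusion \<open>A \<subseteq> X\<close> of cubical sets, where \<open>A\<close> consists of the cubes
  that do not change when one end edge of the interval is collapsed in any coordinate. A coordinate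
  in which a cube does change is called bad. For a cube \<open>f\<close> take the longest final segment of
  coordinates along which successive collapses change each value of \<open>f\<close> at most once. By this
  condition \<open>f\<close> and its collapse along that segment are the two ends of a cube \<open>fill f\<close> of one
  dimension more, and the construction commutes with degeneracies and connections. The face of
  \<open>fill f\<close> opposite to \<open>f\<close> has fewer bad coordinates, and each of its other faces is the filling of
  a face of \<open>f\<close> or is smaller than \<open>f\<close> when cubes are ordered by the number of bad coordinates and
  then by the number of bad coordinates in front of the segment. Attaching the cubes \<open>fill f\<close> in this
  order builds \<open>X\<close> from \<open>A\<close> by filling open boxes. That every step is a pushout uses the
  Eilenberg--Zilber property: box morphisms are monotone, and distinct outputs depend on disjoint,
  increasing sets of inputs, so those without constant coordinates are determined by their sections.\<close>

section \<open>Morphisms of the cube category\<close>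

text \<open>Collapsing all coordinates at once commutes with degeneracies and connections, but a
  value of \<open>f\<close> and its collapsed value are then in general not joined by one arrow of
  \<open>G\<close>. Collapsing only the last coordinate always gives an arrow, but a connection may
  merge the last two coordinates, and collapsing one of two inputs need not collapse their maximum
  or minimum. The condition on the final segment resolves this conflict: if a cube is pulled back
  along such a connection, collapsing the two merged inputs in turn changes their maximum or minimum
  at most once. As the condition speaks about values only, it does not refer to how the cube arises.
  The claim is proved through lifting against an arbitrary Kan fibration. A stage therefore amounts
  to extending a partial lift by one filler at a time, and no transfinite composite of pushouts has
  to be formed.\<close>

definition dep :: "(bool list \<Rightarrow> bool list) \<Rightarrow> nat \<Rightarrow> nat \<Rightarrow> nat \<Rightarrow> bool" where
  "dep phi m i j \<longleftrightarrow> j < m \<and> (\<exists>x. length x = m \<and> phi x ! i \<noteq> phi (x[j := \<not> x ! j]) ! i)"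

definition ble :: "bool list \<Rightarrow> bool list \<Rightarrow> bool" where
  "ble x y \<longleftrightarrow> length x = length y \<and> (\<forall>i<length x. x ! i \<longrightarrow> y ! i)"

lemma bdom_iff [simp]: "x \<in> bdom n \<longleftrightarrow> length x = n"
  by (simp add: bdom_def)

lemma nth_insert: "i \<le> length x \<Longrightarrow> p \<le> length x \<Longrightarrow>
    (take i x @ e # drop i x) ! p = (if p < i then x ! p else if p = i then e else x ! (p - 1))"
  by (cases p i rule: linorder_cases) (auto simp: nth_append nth_Cons Suc_diff_le split: nat.splits
      dest!: less_imp_Suc_add)

lemma nth_delete: "i < length x \<Longrightarrow> p < length x - 1 \<Longrightarrow>
    (take i x @ drop (Suc i) x) ! p = (if p < i then x ! p else x ! Suc p)"
  by (auto simp: nth_append)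

lemma nth_merge: "Suc i < length x \<Longrightarrow> p < length x - 1 \<Longrightarrow>
    (take i x @ b # drop (Suc (Suc i)) x) ! p = (if p < i then x ! p else if p = i then b else x ! Suc p)"
  by (cases p i rule: linorder_cases) (auto simp: nth_append nth_Cons dest!: less_imp_Suc_add)

lemma boxhom_length: "boxhom m n phi \<Longrightarrow> length x = m \<Longrightarrow> length (phi x) = n"
  by (induction arbitrary: x rule: boxhom.induct) auto

lemma boxhom_extensional: "boxhom m n phi \<Longrightarrow> phi \<in> extensional (bdom m)"
  by (induction rule: boxhom.induct) (rule restrict_extensional)+

lemma boxhom_eqI:
  assumes "boxhom m n phi" "boxhom m n psi"
    and "\<And>x i. length x = m \<Longrightarrow> i < n \<Longrightarrow> phi x ! i = psi x ! i"
  shows "phi = psi"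
proof (rule extensionalityI[OF boxhom_extensional[OF assms(1)] boxhom_extensional[OF assms(2)]])
  fix x assume "x \<in> bdom m"
  then show "phi x = psi x"
    using assms boxhom_length[OF assms(1)] boxhom_length[OF assms(2)]
    by (intro nth_equalityI) auto
qed

lemma boxhom_mono: "boxhom m n phi \<Longrightarrow> length x = m \<Longrightarrow> ble x y \<Longrightarrow> ble (phi x) (phi y)"
proof (induction arbitrary: x y rule: boxhom.induct)
  case (bh_face i n e)
  then show ?case by (auto simp: ble_def nth_insert)
next
  case (bh_degen i n)
  then show ?case by (auto simp: ble_def nth_delete)
next
  case (bh_conn_max i n)
  then show ?case by (auto simp: ble_def nth_merge)
next
  case (bh_conn_min i n)
  then show ?case by (auto simp: ble_def nth_merge)
next
  case (bh_comp l m g n f)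
  have "ble (g x) (g y)" "length x = l" "length y = l" "length (g x) = m"
    using bh_comp by (auto simp: ble_def boxhom_length)
  then show ?case using bh_comp.IH(2) by simp
qed (auto simp: ble_def)

text \<open>By \<open>ord\<close>, distinct outputs of \<open>g\<close> share no input. Flipping
  input \<open>j\<close> therefore flips exactly one coordinate \<open>r\<close> of
  \<open>g x\<close>, and the change of \<open>f\<close> comes from this single flip.\<close>

lemma depD_comp:
  assumes "boxhom l m g" "boxhom m n f" "i < n"
    and ord: "\<forall>r<m. \<forall>r'<m. \<forall>j. dep g l r j \<longrightarrow> dep g l r' j \<longrightarrow> r = r'"
    and "dep (restrict (f \<circ> g) (bdom l)) l i j"
  shows "\<exists>r<m. dep f m i r \<and> dep g l r j"
proof -
  from assms(5) obtain x where j: "j < l" and x: "length x = l"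
    and "restrict (f \<circ> g) (bdom l) x ! i \<noteq> restrict (f \<circ> g) (bdom l) (x[j := \<not> x ! j]) ! i"
    unfolding dep_def by blast
  then have ne: "f (g x) ! i \<noteq> f (g (x[j := \<not> x ! j])) ! i" by simp
  define x' where "x' = x[j := \<not> x ! j]"
  have len: "length (g x) = m" "length (g x') = m"
    using boxhom_length[OF assms(1)] x by (auto simp: x'_def)
  have "g x \<noteq> g x'" using ne x'_def by metis
  then obtain r where r: "r < m" "g x ! r \<noteq> g x' ! r"
    using len by (auto simp: list_eq_iff_nth_eq)
  have dr: "dep g l r' j" if "r' < m" "g x ! r' \<noteq> g x' ! r'" for r'
    using that j x by (auto simp: dep_def x'_def)
  have "g x' = (g x)[r := \<not> g x ! r]"
  proof (rule nth_equalityI)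
    fix q assume q: "q < length (g x')"
    show "g x' ! q = (g x)[r := \<not> g x ! r] ! q"
    proof (cases "q = r")
      case True then show ?thesis using r len by auto
    next
      case False
      then have "g x ! q = g x' ! q" using ord dr r q len by metis
      then show ?thesis using False by simp
    qed
  qed (use len in auto)
  then have "dep f m i r"
    using ne r(1) len unfolding dep_def x'_def[symmetric] by (auto intro!: exI[of _ "g x"])
  then show ?thesis using r dr by blast
qed

text \<open>Expresses that the generators contain neither symmetries nor diagonals. With
  \<open>j = j'\<close> the conclusion is absurd, so distinct outputs share no input; this form is
  also what makes \<open>depD_comp\<close> applicable to composites.\<close>

lemma boxhom_dep_less:
  "boxhom m n phi \<Longrightarrow> i' < n \<Longrightarrow> dep phi m i j \<Longrightarrow> dep phi m i' j' \<Longrightarrow> i < i' \<Longrightarrow> j < j'"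
proof (induction arbitrary: i i' j j' rule: boxhom.induct)
  case (bh_face i0 n e)
  have *: "(p < i0 \<and> j = p) \<or> (i0 < p \<and> j = p - 1)"
    if "p < Suc n" "dep (restrict (\<lambda>x. take i0 x @ e # drop i0 x) (bdom n)) n p j" for p j
    using that bh_face(1)
    by (auto simp: dep_def nth_insert nth_list_update split: if_splits)
  from *[of i j] *[of i' j'] bh_face show ?case by auto
next
  case (bh_degen i0 n)
  have *: "(p < i0 \<and> j = p) \<or> (i0 \<le> p \<and> j = Suc p)"
    if "p < n" "dep (restrict (\<lambda>x. take i0 x @ drop (Suc i0) x) (bdom (Suc n))) (Suc n) p j" for p j
    using that bh_degen(1)
    by (auto simp: dep_def nth_delete nth_list_update split: if_splits)
  from *[of i j] *[of i' j'] bh_degen show ?case by auto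
next
  case (bh_conn_max i0 n)
  have *: "(p < i0 \<and> j = p) \<or> (p = i0 \<and> (j = p \<or> j = Suc p)) \<or> (i0 < p \<and> j = Suc p)"
    if "p < n" "dep (restrict (\<lambda>x. take i0 x @ (x ! i0 \<or> x ! Suc i0) # drop (Suc (Suc i0)) x)
       (bdom (Suc n))) (Suc n) p j" for p j
  proof (rule ccontr)
    assume n: "\<not> ?thesis"
    have "restrict (\<lambda>x. take i0 x @ (x ! i0 \<or> x ! Suc i0) # drop (Suc (Suc i0)) x) (bdom (Suc n)) x ! p
      = restrict (\<lambda>x. take i0 x @ (x ! i0 \<or> x ! Suc i0) # drop (Suc (Suc i0)) x) (bdom (Suc n))
         (x[j := \<not> x ! j]) ! p" if "length x = Suc n" for x
      using that n \<open>p < n\<close> bh_conn_max(1)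
      by (cases p i0 rule: linorder_cases) (simp_all add: nth_merge)
    then show False using \<open>dep _ _ p j\<close> unfolding dep_def by blast
  qed
  from *[of i j] *[of i' j'] bh_conn_max show ?case by auto
next
  case (bh_conn_min i0 n)
  have *: "(p < i0 \<and> j = p) \<or> (p = i0 \<and> (j = p \<or> j = Suc p)) \<or> (i0 < p \<and> j = Suc p)"
    if "p < n" "dep (restrict (\<lambda>x. take i0 x @ (x ! i0 \<and> x ! Suc i0) # drop (Suc (Suc i0)) x)
       (bdom (Suc n))) (Suc n) p j" for p j
  proof (rule ccontr)
    assume n: "\<not> ?thesis"
    have "restrict (\<lambda>x. take i0 x @ (x ! i0 \<and> x ! Suc i0) # drop (Suc (Suc i0)) x) (bdom (Suc n)) x ! p
      = restrict (\<lambda>x. take i0 x @ (x ! i0 \<and> x ! Suc i0) # drop (Suc (Suc i0)) x) (bdom (Suc n))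
         (x[j := \<not> x ! j]) ! p" if "length x = Suc n" for x
      using that n \<open>p < n\<close> bh_conn_min(1)
      by (cases p i0 rule: linorder_cases) (simp_all add: nth_merge)
    then show False using \<open>dep _ _ p j\<close> unfolding dep_def by blast
  qed
  from *[of i j] *[of i' j'] bh_conn_min show ?case by auto
next
  case (bh_comp l m g n f)
  have inj: "\<forall>r<m. \<forall>r'<m. \<forall>j. dep g l r j \<longrightarrow> dep g l r' j \<longrightarrow> r = r'"
    using bh_comp.IH(1) by (metis less_irrefl nat_neq_iff)
  obtain r where r: "r < m" "dep f m i r" "dep g l r j"
    using depD_comp[OF bh_comp.hyps _ inj bh_comp.prems(2)] bh_comp.prems(1,4) by auto
  obtain r' where r': "r' < m" "dep f m i' r'" "dep g l r' j'"
    using depD_comp[OF bh_comp.hyps bh_comp.prems(1) inj bh_comp.prems(3)] by auto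
  have "r < r'" using bh_comp.IH(2) r r' bh_comp.prems by blast
  then show ?case using bh_comp.IH(1) r r' by blast
qed (auto simp: dep_def nth_list_update split: if_splits)

text \<open>Exchange the coordinates one at a time: each exchange is either void or the flip of an
  input on which output \<open>i\<close> does not depend.\<close>

lemma boxhom_cong:
  assumes "boxhom m n phi" "length x = m" "length y = m"
    and "\<And>j. dep phi m i j \<Longrightarrow> x ! j = y ! j"
  shows "phi x ! i = phi y ! i"
proof -
  have "phi x ! i = phi (take q y @ drop q x) ! i" if "q \<le> m" for q
    using that
  proof (induction q)
    case (Suc q)
    let ?z = "take q y @ drop q x" and ?z' = "take (Suc q) y @ drop (Suc q) x"
    have z': "?z' = ?z[q := y ! q]"
      using Suc.prems assms(2,3) by (intro nth_equalityI) (auto simp: nth_append nth_list_update)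
    have zq: "?z ! q = x ! q" "length ?z = m" using Suc.prems assms(2,3) by (auto simp: nth_append)
    have "phi ?z ! i = phi ?z' ! i"
    proof (cases "y ! q = x ! q")
      case True
      then have "?z[q := y ! q] = ?z" using zq(1) list_update_id[of ?z q] by simp
      then show ?thesis unfolding z' by (rule arg_cong[OF sym])
    next
      case False
      then have eq: "?z' = ?z[q := \<not> ?z ! q]" unfolding z' using zq by auto
      have "\<not> dep phi m i q" using assms(4) False by metis
      then have "phi ?z ! i = phi (?z[q := \<not> ?z ! q]) ! i"
        using zq(2) Suc.prems unfolding dep_def Suc_le_eq by blast
      then show ?thesis unfolding eq .
    qed
    then show ?case using Suc by simp
  qed simp
  from this[of m] show ?thesis using assms by simp
qed

text \<open>Plays the role of the composites of degeneracies and connections: the condition can be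
  read off from the function, and it characterises the morphisms that have a section.\<close>

definition nconst :: "(bool list \<Rightarrow> bool list) \<Rightarrow> nat \<Rightarrow> nat \<Rightarrow> bool" where
  "nconst phi m n \<longleftrightarrow> (\<forall>i<n. \<exists>j. dep phi m i j)"

text \<open>By monotonicity an output is least at the all-\<open>False\<close> list and greatest at
  the all-\<open>True\<close> list; as it takes both values, it must equal \<open>b\<close> at the
  constant list \<open>b\<close>.\<close>

lemma nconst_replicate:
  assumes "boxhom m n phi" "nconst phi m n" "i < n"
  shows "phi (replicate m b) ! i = b"
proof -
  from assms obtain j x where j: "j < m" and x: "length x = m"
    and ne: "phi x ! i \<noteq> phi (x[j := \<not> x ! j]) ! i"
    unfolding nconst_def dep_def by blast
  let ?y = "x[j := \<not> x ! j]"
  have *: "ble (replicate m False) z" "ble z (replicate m True)" if "length z = m" for z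
    using that by (auto simp: ble_def)
  have **: "phi (replicate m False) ! i \<longrightarrow> phi z ! i" "phi z ! i \<longrightarrow> phi (replicate m True) ! i"
    if z: "length z = m" for z
    using boxhom_mono[OF assms(1) _ *(1)[OF z]] boxhom_mono[OF assms(1) z *(2)[OF z]]
      boxhom_length[OF assms(1)] z assms(3) by (auto simp: ble_def)
  show ?thesis using **[OF x] **[of ?y] ne x by (cases b) auto
qed

text \<open>The third equation describes \<open>psi\<close> as \<open>phi\<close> with output
  \<open>i\<close> deleted, so that the dependencies of \<open>psi\<close> can be read off from
  those of \<open>phi\<close>.\<close>

lemma boxhom_const_factor:
  assumes "boxhom m (Suc n) phi" "i \<le> n" "\<And>x. length x = m \<Longrightarrow> phi x ! i = e"
  obtains psi where "boxhom m n psi"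
    "phi = restrict (restrict (\<lambda>x. take i x @ e # drop i x) (bdom n) \<circ> psi) (bdom m)"
    "psi = restrict (restrict (\<lambda>x. take i x @ drop (Suc i) x) (bdom (Suc n)) \<circ> phi) (bdom m)"
proof -
  let ?d = "restrict (\<lambda>x. take i x @ drop (Suc i) x) (bdom (Suc n))"
  let ?psi = "restrict (?d \<circ> phi) (bdom m)"
  have b: "boxhom m n ?psi"
    using bh_comp[OF assms(1) bh_degen[of i n]] assms(2) by simp
  have "phi = restrict (restrict (\<lambda>x. take i x @ e # drop i x) (bdom n) \<circ> ?psi) (bdom m)"
  proof (rule extensionalityI[OF boxhom_extensional[OF assms(1)] restrict_extensional])
    fix x assume "x \<in> bdom m"
    then have x: "length x = m" by simp
    have l: "length (phi x) = Suc n" using boxhom_length[OF assms(1) x] .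
    have "take i (phi x) @ e # drop (Suc i) (phi x) = phi x"
      using assms(2) assms(3)[OF x] l id_take_nth_drop[of i "phi x"] by simp
    moreover have "?psi x = take i (phi x) @ drop (Suc i) (phi x)" using x l by simp
    moreover have "length (take i (phi x)) = i" using l assms(2) by simp
    ultimately show "phi x = restrict (restrict (\<lambda>x. take i x @ e # drop i x) (bdom n) \<circ> ?psi) (bdom m) x"
      using x l assms(2) by simp
  qed
  then show ?thesis using that b by blast
qed

lemma not_dep_const:
  assumes "boxhom m n phi" "\<And>j. \<not> dep phi m i j" "length x = m"
  shows "phi x ! i = phi (replicate m False) ! i"
  using boxhom_cong[OF assms(1), of x "replicate m False" i] assms by simp

text \<open>Choosing one input for each output is injective, because distinct outputs share no
  input.\<close>

lemma nconst_le:
  assumes "boxhom m n phi" "nconst phi m n"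
  shows "n \<le> m"
proof -
  obtain q where q: "\<And>i. i < n \<Longrightarrow> dep phi m i (q i)"
    using assms(2) unfolding nconst_def by metis
  have "inj_on q {..<n}"
    using boxhom_dep_less[OF assms(1)] q
    by (intro linorder_inj_onI') (metis lessThan_iff nat_neq_iff)
  moreover have "q ` {..<n} \<subseteq> {..<m}" using q by (auto simp: dep_def)
  ultimately show ?thesis using card_inj_on_le[of q "{..<n}" "{..<m}"] by simp
qed

lemma strict_mono_below_id:
  fixes q :: "nat \<Rightarrow> nat"
  assumes "\<And>i i'. i < i' \<Longrightarrow> i' < n \<Longrightarrow> q i < q i'" "\<And>i. i < n \<Longrightarrow> q i < n" "i < n"
  shows "q i = i"
proof -
  have ge: "i \<le> q i" if "i < n" for i using that
  proof (induction i)
    case (Suc i)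
    then show ?case using assms(1)[of i "Suc i"] by fastforce
  qed simp
  have le: "q (n - Suc d) \<le> n - Suc d" if "d < n" for d using that
  proof (induction d)
    case 0 then show ?case using assms(2)[of "n - 1"] by simp
  next
    case (Suc d)
    then show ?case using assms(1)[of "n - Suc (Suc d)" "n - Suc d"] by fastforce
  qed
  have "n - Suc (n - Suc i) = i" using assms(3) by simp
  then show ?thesis using ge[OF assms(3)] le[of "n - Suc i"] assms(3) by simp
qed

text \<open>A choice of one input per output is a strictly increasing self-map of
  \<open>{..<n}\<close>, hence the identity. Any other input of output \<open>i\<close> could have
  been chosen instead, so \<open>i\<close> is its only input.\<close>

lemma nconst_endo_id:
  assumes "boxhom n n phi" "nconst phi n n"
  shows "phi = restrict id (bdom n)"
proof (rule boxhom_eqI[OF assms(1) bh_id])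
  fix x :: "bool list" and i assume x: "length x = n" and i: "i < n"
  obtain q where q: "\<And>i. i < n \<Longrightarrow> dep phi n i (q i)"
    using assms(2) unfolding nconst_def by metis
  have only: "j = i" if "i < n" "dep phi n i j" for i j
  proof -
    define q' where "q' = q(i := j)"
    have q': "dep phi n r (q' r)" if "r < n" for r
      using q[OF that] \<open>dep phi n i j\<close> by (simp add: q'_def)
    have "q' i = i"
    proof (rule strict_mono_below_id[of n])
      show "q' r < q' r'" if "r < r'" "r' < n" for r r'
        using boxhom_dep_less[OF assms(1) that(2) q' q' that(1)] that by simp
      show "q' r < n" if "r < n" for r
        using q'[OF that] by (auto simp: dep_def)
    qed (rule that)
    then show ?thesis by (simp add: q'_def)
  qed
  have "phi x ! i = phi (replicate n (x ! i)) ! i"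
    using only[OF i] i x by (intro boxhom_cong[OF assms(1)]) (auto simp: dep_def)
  then show "phi x ! i = restrict id (bdom n) x ! i"
    using nconst_replicate[OF assms i] x by simp
qed

section \<open>Adding a last coordinate\<close>

lemma boxhom_append_const:
  assumes "boxhom m n phi"
  shows "boxhom m (Suc n) (restrict (\<lambda>x. phi x @ [c]) (bdom m))"
proof -
  have "restrict (\<lambda>x. phi x @ [c]) (bdom m) =
      restrict (restrict (\<lambda>x. take n x @ c # drop n x) (bdom n) \<circ> phi) (bdom m)"
    using boxhom_length[OF assms] by (intro restrict_ext) auto
  then show ?thesis using bh_comp[OF assms bh_face[of n n c]] by simp
qed

text \<open>The product of \<open>phi\<close> with the identity of the interval; it expresses
  naturality of a filling, whose new coordinate is the last one.\<close>

definition xid :: "nat \<Rightarrow> (bool list \<Rightarrow> bool list) \<Rightarrow> bool list \<Rightarrow> bool list" where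
  "xid m phi = restrict (\<lambda>x. phi (butlast x) @ [last x]) (bdom (Suc m))"

lemma take_butlast_snoc: "i \<le> length x - 1 \<Longrightarrow> take i (butlast x) = take i x"
  by (simp add: butlast_conv_take)

lemma drop_butlast_snoc: "i < length x \<Longrightarrow> drop i (butlast x) @ [last x] = drop i x"
  by (metis append_butlast_last_id butlast_snoc drop_append drop_butlast last_drop drop_eq_Nil
      leD)

text \<open>Taking the product with the identity sends each generator to the generator of the same
  index one dimension higher, and it respects composition.\<close>

lemma boxhom_xid: "boxhom m n phi \<Longrightarrow> boxhom (Suc m) (Suc n) (xid m phi)"
proof (induction rule: boxhom.induct)
  case (bh_id n)
  have "xid n (restrict id (bdom n)) = restrict id (bdom (Suc n))"
    unfolding xid_def by (intro restrict_ext) (auto, metis append_butlast_last_id list.size(3) nat.distinct(1))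
  then show ?case using boxhom.bh_id[of "Suc n"] by metis
next
  case (bh_face i n e)
  have "xid n (restrict (\<lambda>x. take i x @ e # drop i x) (bdom n))
     = restrict (\<lambda>x. take i x @ e # drop i x) (bdom (Suc n))"
    unfolding xid_def using bh_face
    by (intro restrict_ext) (simp add: take_butlast_snoc drop_butlast_snoc)
  with boxhom.bh_face[of i "Suc n"] bh_face show ?case by (simp only: Suc_less_eq less_SucI le_SucI)
next
  case (bh_degen i n)
  have "xid (Suc n) (restrict (\<lambda>x. take i x @ drop (Suc i) x) (bdom (Suc n)))
     = restrict (\<lambda>x. take i x @ drop (Suc i) x) (bdom (Suc (Suc n)))"
    unfolding xid_def using bh_degen
    by (intro restrict_ext) (simp add: take_butlast_snoc drop_butlast_snoc)
  with boxhom.bh_degen[of i "Suc n"] bh_degen show ?case by (simp only: Suc_less_eq less_SucI le_SucI)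
next
  case (bh_conn_max i n)
  have "xid (Suc n) (restrict (\<lambda>x. take i x @ (x ! i \<or> x ! Suc i) # drop (Suc (Suc i)) x) (bdom (Suc n)))
     = restrict (\<lambda>x. take i x @ (x ! i \<or> x ! Suc i) # drop (Suc (Suc i)) x) (bdom (Suc (Suc n)))"
    unfolding xid_def using bh_conn_max
    by (intro restrict_ext) (simp add: take_butlast_snoc drop_butlast_snoc nth_butlast)
  with boxhom.bh_conn_max[of i "Suc n"] bh_conn_max show ?case by (simp only: Suc_less_eq less_SucI le_SucI)
next
  case (bh_conn_min i n)
  have "xid (Suc n) (restrict (\<lambda>x. take i x @ (x ! i \<and> x ! Suc i) # drop (Suc (Suc i)) x) (bdom (Suc n)))
     = restrict (\<lambda>x. take i x @ (x ! i \<and> x ! Suc i) # drop (Suc (Suc i)) x) (bdom (Suc (Suc n)))"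
    unfolding xid_def using bh_conn_min
    by (intro restrict_ext) (simp add: take_butlast_snoc drop_butlast_snoc nth_butlast)
  with boxhom.bh_conn_min[of i "Suc n"] bh_conn_min show ?case by (simp only: Suc_less_eq less_SucI le_SucI)
next
  case (bh_comp l m g n f)
  have "xid l (restrict (f \<circ> g) (bdom l)) = restrict (xid m f \<circ> xid l g) (bdom (Suc l))"
    unfolding xid_def using boxhom_length[OF bh_comp(1)] by (intro restrict_ext) simp
  with boxhom.bh_comp[OF bh_comp.IH] show ?case by (simp only:)
qed

section \<open>Sections of morphisms without constant outputs\<close>

lemma boxhom_place:
  assumes "\<And>i i'. i < i' \<Longrightarrow> i' < n \<Longrightarrow> q i < q i'" "\<And>i. i < n \<Longrightarrow> q i < N"
  shows "\<exists>s. boxhom n N s \<and>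
    (\<forall>e. length e = n \<longrightarrow> (\<forall>i<n. s e ! q i = e ! i) \<and> (\<forall>p<N. p \<notin> q ` {..<n} \<longrightarrow> s e ! p = c p))"
  using assms
proof (induction N arbitrary: n)
  case 0
  then have "n = 0" by fastforce
  then show ?case using bh_id[of 0] by auto
next
  case (Suc N)
  show ?case
  \<comment> \<open>The last position of the target receives either an entry of the source, which
    must be the last entry because \<open>q\<close> is increasing, or the constant
    \<open>c N\<close>.\<close>
  proof (cases "\<exists>i<n. q i = N")
    case True
    then obtain i where i: "i < n" "q i = N" by blast
    have "Suc i = n" using Suc.prems(1)[of i "Suc i"] Suc.prems(2)[of "Suc i"] i by (cases "Suc i < n") auto
    then obtain n' where n: "n = Suc n'" "i = n'" by auto
    have lt: "q i' < N" if "i' < n'" for i' using Suc.prems(1)[of i' n'] that n i by simp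
    obtain s where s: "boxhom n' N s" "\<And>e i. length e = n' \<Longrightarrow> i < n' \<Longrightarrow> s e ! q i = e ! i"
      "\<And>e p. length e = n' \<Longrightarrow> p < N \<Longrightarrow> p \<notin> q ` {..<n'} \<Longrightarrow> s e ! p = c p"
      using Suc.IH[of n'] Suc.prems(1) lt n by fastforce
    have "(\<forall>i<n. xid n' s e ! q i = e ! i) \<and> (\<forall>p<Suc N. p \<notin> q ` {..<n} \<longrightarrow> xid n' s e ! p = c p)"
      if e: "length e = n" for e
    proof (intro conjI allI impI)
      have l: "length (s (butlast e)) = N" using boxhom_length[OF s(1)] e n by simp
      fix i' assume i': "i' < n"
      show "xid n' s e ! q i' = e ! i'"
      proof (cases "i' = n'")
        case True
        then show ?thesis using l e n i by (cases e rule: rev_cases) (auto simp: xid_def nth_append)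
      next
        case False
        then show ?thesis using l e n i' s(2)[of "butlast e" i'] lt[of i']
          by (simp add: xid_def nth_append nth_butlast)
      qed
    next
      have l: "length (s (butlast e)) = N" using boxhom_length[OF s(1)] e n by simp
      fix p assume p: "p < Suc N" "p \<notin> q ` {..<n}"
      have "p \<noteq> N" using p i by auto
      moreover have "p \<notin> q ` {..<n'}" using p n by auto
      ultimately show "xid n' s e ! p = c p" using l e n p s(3)[of "butlast e" p]
        by (simp add: xid_def nth_append)
    qed
    then show ?thesis using boxhom_xid[OF s(1)] n by blast
  next
    case False
    then have lt: "q i < N" if "i < n" for i using Suc.prems(2)[of i] that by fastforce
    obtain s where s: "boxhom n N s" "\<And>e i. length e = n \<Longrightarrow> i < n \<Longrightarrow> s e ! q i = e ! i"
      "\<And>e p. length e = n \<Longrightarrow> p < N \<Longrightarrow> p \<notin> q ` {..<n} \<Longrightarrow> s e ! p = c p"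
      using Suc.IH[of n] Suc.prems(1) lt by fastforce
    have "(\<forall>i<n. (s e @ [c N]) ! q i = e ! i) \<and> (\<forall>p<Suc N. p \<notin> q ` {..<n} \<longrightarrow> (s e @ [c N]) ! p = c p)"
      if e: "length e = n" for e
      using boxhom_length[OF s(1) e] s(2)[OF e] s(3)[OF e] lt
      by (auto simp: nth_append less_Suc_eq)
    then show ?thesis
      by (intro exI[of _ "restrict (\<lambda>x. s x @ [c N]) (bdom n)"] conjI boxhom_append_const s(1)) auto
  qed
qed

text \<open>The section feeds \<open>e ! r\<close> into one chosen input \<open>q r\<close> of each
  output \<open>r\<close> and freezes the other inputs of \<open>r\<close> at a point where flipping
  \<open>q r\<close> matters; by monotonicity the output then follows that input. For output
  \<open>i\<close> the input \<open>j\<close> and the point \<open>w\<close> are prescribed, so that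
  a section can be aimed at a given flip.\<close>

lemma boxhom_section:
  assumes phi: "boxhom m n phi" "nconst phi m n" and i: "i < n" and j: "j < m" and w: "length w = m"
    and ne: "phi w ! i \<noteq> phi (w[j := \<not> w ! j]) ! i"
  obtains s q where "boxhom n m s" "restrict (phi \<circ> s) (bdom n) = restrict id (bdom n)"
    "\<And>i. i < n \<Longrightarrow> dep phi m i (q i)" "q i = j"
    "\<And>e r. length e = n \<Longrightarrow> r < n \<Longrightarrow> s e ! q r = e ! r"
    "\<And>e p. length e = n \<Longrightarrow> dep phi m i p \<Longrightarrow> p \<noteq> j \<Longrightarrow> s e ! p = w ! p"
    "\<And>e e' p. length e = n \<Longrightarrow> length e' = n \<Longrightarrow> p < m \<Longrightarrow> p \<notin> q ` {..<n} \<Longrightarrow> s e ! p = s e' ! p"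
proof -
  have "\<forall>r. \<exists>p x. r < n \<longrightarrow> p < m \<and> length x = m \<and> phi x ! r \<noteq> phi (x[p := \<not> x ! p]) ! r"
    using phi(2) unfolding nconst_def dep_def by blast
  then obtain q0 x0 where 0: "\<And>r. r < n \<Longrightarrow> q0 r < m \<and> length (x0 r) = m \<and>
      phi (x0 r) ! r \<noteq> phi ((x0 r)[q0 r := \<not> x0 r ! q0 r]) ! r"
    by metis
  define q where "q = q0(i := j)"
  define xx where "xx = x0(i := w)"
  have q: "q r < m" "length (xx r) = m" "phi (xx r) ! r \<noteq> phi ((xx r)[q r := \<not> xx r ! q r]) ! r"
    if "r < n" for r using 0[OF that] i j w ne by (auto simp: q_def xx_def)
  have dq: "dep phi m r (q r)" if "r < n" for r using q[OF that] by (auto simp: dep_def)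
  have inj: "r = r'" if "r < n" "r' < n" "dep phi m r p" "dep phi m r' p" for r r' p
    using boxhom_dep_less[OF phi(1), of r' r p p] boxhom_dep_less[OF phi(1), of r r' p p] that
    by (cases r r' rule: linorder_cases) auto
  \<comment> \<open>At most one output depends on \<open>p\<close>, so the choice is unambiguous
    wherever it matters; an input of no output gets an arbitrary constant.\<close>
  define c where "c p = xx (SOME r. r < n \<and> dep phi m r p) ! p" for p
  have c: "c p = xx r ! p" if "r < n" "dep phi m r p" for r p
  proof -
    have "(SOME r. r < n \<and> dep phi m r p) = r"
      using that inj by (intro some_equality) auto
    then show ?thesis by (simp add: c_def)
  qed
  obtain s where s: "boxhom n m s" "\<And>e i. length e = n \<Longrightarrow> i < n \<Longrightarrow> s e ! q i = e ! i"
      "\<And>e p. length e = n \<Longrightarrow> p < m \<Longrightarrow> p \<notin> q ` {..<n} \<Longrightarrow> s e ! p = c p"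
    using boxhom_place[of n q m c, OF boxhom_dep_less[OF phi(1) _ dq dq] q(1)] by auto
  have sw: "s e ! p = xx r ! p" if "length e = n" "r < n" "dep phi m r p" "p \<noteq> q r" for e r p
  proof -
    have "p \<notin> q ` {..<n}" using inj dq that by (metis imageE lessThan_iff)
    then show ?thesis using s(3)[OF that(1)] c[OF that(2,3)] that(3) by (simp add: dep_def)
  qed
  have id: "phi (s e) ! r = e ! r" if e: "length e = n" and r: "r < n" for e r
  proof -
    have l: "length (s e) = m" using boxhom_length[OF s(1) e] .
    let ?x = "\<lambda>b. (xx r)[q r := b]"
    have agree: "phi (s e) ! r = phi (?x (e ! r)) ! r"
      using q[OF r] l s(2)[OF e r] sw[OF e r] 
      by (intro boxhom_cong[OF phi(1)]) (auto simp: nth_list_update)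
    have "ble (?x False) (?x True)" using q[OF r] by (auto simp: ble_def nth_list_update)
    then have mono: "phi (?x False) ! r \<longrightarrow> phi (?x True) ! r"
      using boxhom_mono[OF phi(1), of "?x False" "?x True"] boxhom_length[OF phi(1)] q[OF r] r by (auto simp: ble_def)
    have "phi (?x False) ! r \<noteq> phi (?x True) ! r"
      using q(3)[OF r] by (cases "xx r ! q r") (simp_all, (metis (full_types) list_update_id)+)
    then have "phi (?x b) ! r = b" for b using mono by (cases b) auto
    then show ?thesis using agree by simp
  qed
  have comp: "restrict (phi \<circ> s) (bdom n) = restrict id (bdom n)"
    using id boxhom_length[OF phi(1)] boxhom_length[OF s(1)]
    by (intro restrict_ext nth_equalityI) auto
  show ?thesis
  proof (rule that[OF s(1) comp dq _ s(2)])
    show "q i = j" by (simp add: q_def)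
    show "s e ! p = w ! p" if "length e = n" "dep phi m i p" "p \<noteq> j" for e p
      using sw[OF that(1) i that(2)] that by (simp add: q_def xx_def)
    show "s e ! p = s e' ! p" if "length e = n" "length e' = n" "p < m" "p \<notin> q ` {..<n}" for e e' p
      using s(3) that by simp
  qed auto
qed

lemma boxhom_section_exists:
  assumes "boxhom m n phi" "nconst phi m n"
  obtains s where "boxhom n m s" "restrict (phi \<circ> s) (bdom n) = restrict id (bdom n)"
proof (cases "n = 0")
  case True
  obtain s where s: "boxhom n m s" using boxhom_place[of n id m "\<lambda>_. False"] True by auto
  have "restrict (phi \<circ> s) (bdom n) = restrict id (bdom n)"
    using True boxhom_length[OF assms(1)] boxhom_length[OF s] by (intro restrict_ext) auto
  then show ?thesis using that s by blast
next
  case False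
  then obtain j x where "j < m" "length x = m" "phi x ! 0 \<noteq> phi (x[j := \<not> x ! j]) ! 0"
    using assms(2) unfolding nconst_def dep_def by blast
  then show ?thesis using boxhom_section[OF assms, of 0 j x] that False by (metis gr0I)
qed

text \<open>Aim a section of \<open>phi\<close> at input \<open>j\<close> of output
  \<open>i\<close>. Switching entry \<open>i\<close> of the all-\<open>False\<close> list flips only
  coordinate \<open>j\<close> of its image, and \<open>psi\<close> must notice this because it
  retracts the same section.\<close>

lemma sections_dep_subset:
  assumes "boxhom m n phi" "nconst phi m n" "boxhom m n psi"
    and sec: "\<And>s. boxhom n m s \<Longrightarrow> restrict (phi \<circ> s) (bdom n) = restrict id (bdom n) \<Longrightarrow>
               restrict (psi \<circ> s) (bdom n) = restrict id (bdom n)"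
    and "i < n" "dep phi m i j"
  shows "dep psi m i j"
proof -
  obtain w where w: "j < m" "length w = m" "phi w ! i \<noteq> phi (w[j := \<not> w ! j]) ! i"
    using assms(6) by (auto simp: dep_def)
  obtain s q where s: "boxhom n m s" "restrict (phi \<circ> s) (bdom n) = restrict id (bdom n)"
    "\<And>i. i < n \<Longrightarrow> dep phi m i (q i)" "q i = j"
    "\<And>e r. length e = n \<Longrightarrow> r < n \<Longrightarrow> s e ! q r = e ! r"
    "\<And>e e' p. length e = n \<Longrightarrow> length e' = n \<Longrightarrow> p < m \<Longrightarrow> p \<notin> q ` {..<n} \<Longrightarrow> s e ! p = s e' ! p"
    by (rule boxhom_section[OF assms(1,2,5) w(1,2,3)]) blast
  let ?e = "replicate n False" and ?e' = "(replicate n False)[i := True]"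
  have psi: "psi (s e) = e" if "length e = n" for e
    using fun_cong[OF sec[OF s(1,2)], of e] that by simp
  have "s ?e' = (s ?e)[j := \<not> s ?e ! j]"
  proof (rule nth_equalityI)
    show "length (s ?e') = length ((s ?e)[j := \<not> s ?e ! j])" using boxhom_length[OF s(1)] by simp
    fix p assume "p < length (s ?e')"
    then have p: "p < m" using boxhom_length[OF s(1)] by simp
    have l: "length (s ?e) = m" using boxhom_length[OF s(1)] by simp
    show "s ?e' ! p = (s ?e)[j := \<not> s ?e ! j] ! p"
    proof (cases "p \<in> q ` {..<n}")
      case True
      then obtain r where r: "r < n" "p = q r" by auto
      have "q r \<noteq> j" if "r \<noteq> i"
        using boxhom_dep_less[OF assms(1), of i r "q r" "q r"] boxhom_dep_less[OF assms(1), of r i "q r" "q r"]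
          s(3)[of r] s(3)[of i] s(4) that r assms(5) by (metis nat_neq_iff)
      then show ?thesis using r s(5)[of ?e r] s(5)[of ?e' r] s(4) p l assms(5)
        by (auto simp: nth_list_update)
    next
      case False
      then have "p \<noteq> j" using s(4) assms(5) by auto
      then show ?thesis using s(6)[OF _ _ p False, of ?e ?e'] by simp
    qed
  qed
  then have "psi (s ?e) ! i \<noteq> psi ((s ?e)[j := \<not> s ?e ! j]) ! i"
    using psi[of ?e] psi[of ?e'] assms(5) by simp
  then show ?thesis using w(1) boxhom_length[OF s(1)] unfolding dep_def
    by (metis length_replicate)
qed

text \<open>Shrink \<open>v\<close> to a \<open>w\<close> with as few true entries as possible and
  \<open>phi w ! i\<close>. Every true entry of \<open>w\<close> is then decisive, so a section can
  be frozen at \<open>w\<close> around one of them. At the all-\<open>True\<close> list it agrees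
  with \<open>w\<close> on all inputs of output \<open>i\<close>, and since \<open>psi\<close>
  retracts it, \<open>psi w ! i\<close> holds.\<close>

lemma sections_le:
  assumes "boxhom m n phi" "nconst phi m n" "boxhom m n psi"
    and sec: "\<And>s. boxhom n m s \<Longrightarrow> restrict (phi \<circ> s) (bdom n) = restrict id (bdom n) \<Longrightarrow>
               restrict (psi \<circ> s) (bdom n) = restrict id (bdom n)"
    and dep: "\<And>i j. i < n \<Longrightarrow> dep psi m i j \<Longrightarrow> dep phi m i j"
    and i: "i < n" and v: "length v = m" "phi v ! i"
  shows "psi v ! i"
proof -
  let ?P = "\<lambda>w. length w = m \<and> ble w v \<and> phi w ! i"
  have "?P v" using v by (simp add: ble_def)
  then obtain w where w: "?P w" and min: "\<And>y. ?P y \<Longrightarrow> length (filter id w) \<le> length (filter id y)"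
    using ex_has_least_nat[of ?P v "\<lambda>y. length (filter id y)"] by blast
  have "phi w \<noteq> phi (replicate m False)" using w nconst_replicate[OF assms(1,2) i, of False] by metis
  then have "w \<noteq> replicate m False" by auto
  then obtain j where j: "j < m" "w ! j" using w by (metis (full_types) length_replicate nth_equalityI nth_replicate)
  have less: "length (filter id (w[j := False])) < length (filter id w)"
  proof -
    have s: "w = take j w @ True # drop (Suc j) w"
      using j w id_take_nth_drop[of j w] by simp
    have "w[j := False] = take j w @ False # drop (Suc j) w"
      using j w upd_conv_take_nth_drop[of j w False] by simp
    then show ?thesis by (subst (2) s) simp
  qed
  have bl: "ble (w[j := False]) v" using w j(1)
    unfolding ble_def by (metis (no_types) length_list_update nth_list_update_eq nth_list_update_neq)
  have np: "\<not> phi (w[j := False]) ! i"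
  proof
    assume "phi (w[j := False]) ! i"
    then have "?P (w[j := False])" using w bl by simp
    from min[OF this] less show False by simp
  qed
  obtain s q where s: "boxhom n m s" "restrict (phi \<circ> s) (bdom n) = restrict id (bdom n)"
    "q i = j" "\<And>e r. length e = n \<Longrightarrow> r < n \<Longrightarrow> s e ! q r = e ! r"
    "\<And>e p. length e = n \<Longrightarrow> dep phi m i p \<Longrightarrow> p \<noteq> j \<Longrightarrow> s e ! p = w ! p"
    by (rule boxhom_section[OF assms(1,2) i j(1), of w]) (use w np j in auto)
  let ?e = "replicate n True"
  have "psi (s ?e) = ?e" using fun_cong[OF sec[OF s(1,2)], of ?e] by simp
  then have "psi (s ?e) ! i" using i by simp
  moreover have "psi (s ?e) ! i = psi w ! i"
  proof (rule boxhom_cong[OF assms(3)])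
    show "s ?e ! p = w ! p" if "dep psi m i p" for p
      using s(5)[OF _ dep[OF i that]] s(4)[of ?e i] s(3) j i by (cases "p = j") auto
  qed (use w boxhom_length[OF s(1)] in auto)
  ultimately have "psi w ! i" by simp
  then show ?thesis using boxhom_mono[OF assms(3), of w v] w boxhom_length[OF assms(3), of w] i
    by (auto simp: ble_def)
qed

lemma sections_determine:
  assumes "boxhom m n phi" "nconst phi m n" "boxhom m n psi" "nconst psi m n"
    and "\<And>s. boxhom n m s \<Longrightarrow> restrict (phi \<circ> s) (bdom n) = restrict id (bdom n) \<longleftrightarrow>
               restrict (psi \<circ> s) (bdom n) = restrict id (bdom n)"
  shows "phi = psi"
proof (rule boxhom_eqI[OF assms(1,3)])
  fix x :: "bool list" and i assume "length x = m" "i < n"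
  then show "phi x ! i = psi x ! i"
    using sections_le[OF assms(1,2,3), of i x] sections_le[OF assms(3,4,1), of i x]
      sections_dep_subset[OF assms(1,2,3)] sections_dep_subset[OF assms(3,4,1)] assms(5) by blast
qed

section \<open>Thresholds and the cubical nerve of a digraph\<close>

text \<open>A point with coordinates in \<open>{0..k}\<close> is coded by its thresholds
  \<open>t = 1, ..., k\<close>, a decreasing family of vertices of the cube. \<open>jext\<close>
  applies \<open>phi\<close> to each member, which reduces statements about \<open>jext\<close> to
  statements about box morphisms.\<close>

definition bits :: "nat \<Rightarrow> nat list \<Rightarrow> bool list" where
  "bits t x = map (\<lambda>z. t \<le> z) x"

lemma length_bits [simp]: "length (bits t x) = length x"
  by (simp add: bits_def)

lemma nth_bits [simp]: "i < length x \<Longrightarrow> bits t x ! i \<longleftrightarrow> t \<le> x ! i"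
  by (simp add: bits_def)

lemma jdom_iff: "x \<in> jdom k n \<longleftrightarrow> length x = n \<and> (\<forall>i<n. x ! i \<le> k)"
  by (auto simp: jdom_def set_conv_nth subset_iff)

lemma nat_eq_by_bits:
  fixes a b k :: nat
  assumes "a \<le> k" "b \<le> k" "\<And>t. 1 \<le> t \<Longrightarrow> t \<le> k \<Longrightarrow> t \<le> a \<longleftrightarrow> t \<le> b"
  shows "a = b"
  using assms(3)[of a] assms(3)[of b] assms(1,2) by (cases "a = 0"; cases "b = 0") auto

lemma eq_by_bits:
  assumes "x \<in> jdom k n" "y \<in> jdom k n" "\<And>t. 1 \<le> t \<Longrightarrow> t \<le> k \<Longrightarrow> bits t x = bits t y"
  shows "x = y"
proof (rule nth_equalityI)
  show "length x = length y" using assms by (simp add: jdom_iff)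
  fix i assume i: "i < length x"
  show "x ! i = y ! i"
  proof (rule nat_eq_by_bits)
    show "t \<le> x ! i \<longleftrightarrow> t \<le> y ! i" if "1 \<le> t" "t \<le> k" for t
      using assms(3)[OF that] i assms(1,2) by (metis jdom_iff nth_bits)
  qed (use assms i in \<open>auto simp: jdom_iff\<close>)
qed

lemma jext_jdom [simp]: "jext k n phi x \<in> jdom k n"
  by (auto simp: jdom_iff jext_def)

lemma length_jext [simp]: "length (jext k n phi x) = n"
  by (simp add: jext_def)

text \<open>Lowering \<open>t\<close> enlarges \<open>bits t x\<close>, and \<open>phi\<close> is
  monotone. The thresholds collected in \<open>jext\<close> thus form an initial segment, which is
  recovered from its maximum.\<close>

lemma bits_jext:
  assumes "boxhom m n phi" "length x = m" "1 \<le> t" "t \<le> k"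
  shows "bits t (jext k n phi x) = phi (bits t x)"
proof (rule nth_equalityI)
  show "length (bits t (jext k n phi x)) = length (phi (bits t x))"
    using boxhom_length[OF assms(1)] assms(2) by simp
  fix i assume "i < length (bits t (jext k n phi x))"
  then have i: "i < n" by simp
  let ?S = "{0} \<union> {t \<in> {1..k}. phi (bits t x) ! i}"
  have fin: "finite ?S" by simp
  have eq: "jext k n phi x ! i = Max ?S" using i by (simp add: jext_def bits_def)
  have down: "phi (bits t x) ! i" if "phi (bits t' x) ! i" "t \<le> t'" for t'
  proof -
    have "ble (bits t' x) (bits t x)" using that by (auto simp: ble_def)
    then have "ble (phi (bits t' x)) (phi (bits t x))" using boxhom_mono[OF assms(1)] assms(2) by simp
    then show ?thesis using that i boxhom_length[OF assms(1)] assms(2) by (simp add: ble_def)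
  qed
  have "t \<le> Max ?S \<longleftrightarrow> phi (bits t x) ! i"
  proof
    assume "t \<le> Max ?S"
    moreover have "Max ?S \<in> ?S" using fin by (intro Max_in) auto
    ultimately show "phi (bits t x) ! i" using assms(3) down by auto
  next
    assume "phi (bits t x) ! i"
    then show "t \<le> Max ?S" using fin assms by (intro Max_ge) auto
  qed
  then show "bits t (jext k n phi x) ! i = phi (bits t x) ! i" using eq i by simp
qed

lemma jext_eqI:
  assumes "boxhom m n phi" "x \<in> jdom k m" "y \<in> jdom k n"
    and "\<And>t. 1 \<le> t \<Longrightarrow> t \<le> k \<Longrightarrow> bits t y = phi (bits t x)"
  shows "jext k n phi x = y"
proof (rule eq_by_bits[OF jext_jdom assms(3)])
  show "bits t (jext k n phi x) = bits t y" if "1 \<le> t" "t \<le> k" for t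
    using assms(2,4) bits_jext[OF assms(1)] that by (simp add: jdom_iff)
qed

lemma jext_id: "x \<in> jdom k n \<Longrightarrow> jext k n (restrict id (bdom n)) x = x"
  by (rule jext_eqI[OF bh_id]) (auto simp: jdom_iff)

lemma jext_comp:
  assumes "boxhom l m g" "boxhom m n f" "x \<in> jdom k l"
  shows "jext k n f (jext k m g x) = jext k n (restrict (f \<circ> g) (bdom l)) x"
proof (rule sym, rule jext_eqI[OF bh_comp[OF assms(1,2)] assms(3)])
  fix t assume t: "1 \<le> t" "t \<le> k"
  have "length x = l" using assms(3) by (simp add: jdom_iff)
  then show "bits t (jext k n f (jext k m g x)) = restrict (f \<circ> g) (bdom l) (bits t x)"
    using bits_jext[OF assms(2) _ t] bits_jext[OF assms(1) _ t] by simp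
qed simp

section \<open>Arrows between points of a power of the interval\<close>

lemma jarr_cases:
  assumes "jarr e k x y"
  obtains "x = y" | j where "j < length x" "y = x[j := y ! j]" "x ! j \<noteq> y ! j" "iarr e k (x ! j) (y ! j)"
proof -
  have len: "length x = length y" using assms by (simp add: jarr_def)
  consider "x = y" | j where "j < length x" "\<forall>i<length x. i \<noteq> j \<longrightarrow> x ! i = y ! i" "iarr e k (x ! j) (y ! j)"
    using assms unfolding jarr_def by blast
  then show ?thesis
  proof cases
    case 1 then show ?thesis using that by blast
  next
    case (2 j)
    have "y = x[j := y ! j]" using 2 len by (intro nth_equalityI) (auto simp: nth_list_update)
    then show ?thesis using 2 that by (cases "x ! j = y ! j") (metis list_update_id, blast)
  qed
qed

lemma jarr_updateI:
  assumes "j < length x" "iarr e k (x ! j) b"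
  shows "jarr e k x (x[j := b])"
  unfolding jarr_def using assms by (auto intro!: exI[of _ j])

lemma jarr_updateI':
  assumes "j < length x" "iarr e k b (x ! j)"
  shows "jarr e k (x[j := b]) x"
  unfolding jarr_def using assms by (auto intro!: exI[of _ j])

text \<open>Disjointness of inputs lets at most one output change, and monotonicity makes it change
  in the direction of the input.\<close>

lemma boxhom_flip:
  assumes phi: "boxhom m n phi" and x: "length x = m" and j: "j < m"
  shows "phi x = phi (x[j := \<not> x ! j]) \<or>
    (\<exists>i<n. phi (x[j := \<not> x ! j]) = (phi x)[i := \<not> x ! j] \<and> (phi x ! i \<longleftrightarrow> x ! j))"
proof -
  let ?x = "x[j := \<not> x ! j]"
  have len: "length (phi x) = n" "length (phi ?x) = n" using boxhom_length[OF phi] x by auto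
  show ?thesis
  proof (cases "phi x = phi ?x")
    case False
    then obtain i where i: "i < n" "phi x ! i \<noteq> phi ?x ! i"
      using len by (auto simp: list_eq_iff_nth_eq)
    have dp: "dep phi m i' j" if "i' < n" "phi x ! i' \<noteq> phi ?x ! i'" for i'
      using that x j unfolding dep_def by blast
    have uniq: "phi ?x ! i' = phi x ! i'" if "i' < n" "i' \<noteq> i" for i'
      using boxhom_dep_less[OF phi, of i i' j j] boxhom_dep_less[OF phi, of i' i j j] dp i that
      by (metis less_irrefl nat_neq_iff)
    have bl: "ble (x[j := False]) (x[j := True])" using x j by (simp add: ble_def nth_list_update)
    have mono: "phi (x[j := False]) ! i \<longrightarrow> phi (x[j := True]) ! i"
      using boxhom_mono[OF phi _ bl] boxhom_length[OF phi, of "x[j := False]"] x i(1) by (simp add: ble_def)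
    have self: "x[j := x ! j] = x" by simp
    have "phi x ! i \<longleftrightarrow> x ! j"
    proof (cases "x ! j")
      case True
      then have "x[j := True] = x" "?x = x[j := False]" using self by auto
      then show ?thesis using True mono i(2) by metis
    next
      case False
      then have "x[j := False] = x" "?x = x[j := True]" using self by auto
      then show ?thesis using False mono i(2) by metis
    qed
    moreover have "phi ?x = (phi x)[i := \<not> phi x ! i]"
      using uniq i len by (intro nth_equalityI) (auto simp: nth_list_update)
    ultimately show ?thesis using i by auto
  qed simp
qed

text \<open>A nontrivial arrow crosses one threshold \<open>M\<close> in one coordinate, so only
  \<open>bits M\<close> changes, by a single flip. The image is then either constant or crosses the
  same threshold in the same direction, hence between the same vertices \<open>M - 1\<close> and
  \<open>M\<close>; this preserves the orientation.\<close>

lemma jext_jarr: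
  assumes phi: "boxhom m n phi" and x: "x \<in> jdom k m" and y: "y \<in> jdom k m" and a: "jarr e k x y"
  shows "jarr e k (jext k n phi x) (jext k n phi y)"
  using a
proof (cases rule: jarr_cases)
  case 1 then show ?thesis by (simp add: jarr_def)
next
  case (2 j)
  let ?X = "jext k n phi x" and ?Y = "jext k n phi y"
  define M where "M = max (x ! j) (y ! j)"
  have len: "length x = m" "length y = m" and j: "j < m" using x y 2 by (auto simp: jdom_iff)
  have adj: "y ! j = Suc (x ! j) \<or> x ! j = Suc (y ! j)" and ar: "even (x ! j) = e" and
    M: "1 \<le> M" "M \<le> k" using 2 by (auto simp: iarr_def M_def)
  have yi: "y ! i = x ! i" if "i \<noteq> j" for i using 2(2) that by (metis nth_list_update_neq)
  have same: "bits t x = bits t y" if "t \<noteq> M" for t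
  proof (rule nth_equalityI)
    fix i assume "i < length (bits t x)"
    then show "bits t x ! i = bits t y ! i"
      using that adj yi[of i] len by (cases "i = j") (auto simp: M_def)
  qed (use len in simp)
  have flip: "bits M y = (bits M x)[j := \<not> bits M x ! j]"
  proof (rule nth_equalityI)
    fix i assume "i < length (bits M y)"
    then show "bits M y ! i = (bits M x)[j := \<not> bits M x ! j] ! i"
      using adj yi[of i] len j by (cases "i = j") (auto simp: M_def)
  qed (use len in simp)
  have bX: "bits t ?X = phi (bits t x)" "bits t ?Y = phi (bits t y)" if "1 \<le> t" "t \<le> k" for t
    using bits_jext[OF phi _ that] len by auto
  have L: "length ?X = n" "length ?Y = n" by simp_all
  have "phi (bits M x) = phi (bits M y) \<or>
    (\<exists>i<n. phi (bits M y) = (phi (bits M x))[i := \<not> bits M x ! j] \<and> (phi (bits M x) ! i \<longleftrightarrow> bits M x ! j))"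
    using boxhom_flip[OF phi _ j, of "bits M x"] len flip by auto
  then consider "phi (bits M x) = phi (bits M y)" | i where "i < n"
      "phi (bits M y) = (phi (bits M x))[i := \<not> bits M x ! j]" "phi (bits M x) ! i \<longleftrightarrow> bits M x ! j"
    by blast
  then show ?thesis
  proof cases
    case 1
    then have "bits t ?X = bits t ?Y" if "1 \<le> t" "t \<le> k" for t
      using bX[OF that] same[of t] by (cases "t = M") auto
    then have "?X = ?Y" by (intro eq_by_bits[of _ k n]) auto
    then show ?thesis by (simp add: jarr_def)
  next
    case (2 i)
    have other: "?X ! i' = ?Y ! i'" if i': "i' < n" "i' \<noteq> i" for i'
    proof (rule nat_eq_by_bits)
      show "?X ! i' \<le> k" "?Y ! i' \<le> k" using i' jext_jdom[of k n phi] by (auto simp: jdom_iff)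
      fix t assume t: "1 \<le> t" "t \<le> k"
      have "bits t ?X ! i' = bits t ?Y ! i'"
        using bX[OF t] same[of t] 2 i' by (cases "t = M") auto
      then show "t \<le> ?X ! i' \<longleftrightarrow> t \<le> ?Y ! i'" using i' by simp
    qed
    have tX: "t \<le> ?X ! i \<longleftrightarrow> t \<le> ?Y ! i" if "1 \<le> t" "t \<le> k" "t \<noteq> M" for t
      using bX[OF that(1,2)] same[OF that(3)] nth_bits[of i ?X t] nth_bits[of i ?Y t] 2(1) by simp
    have "length (phi (bits M x)) = n" using boxhom_length[OF phi] len by simp
    then have MX: "M \<le> ?X ! i \<longleftrightarrow> M \<le> x ! j" "M \<le> ?Y ! i \<longleftrightarrow> \<not> M \<le> x ! j"
      using bX[OF M] nth_bits[of i ?X M] nth_bits[of i ?Y M] 2 len j by auto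
    have le: "?X ! i \<le> k" "?Y ! i \<le> k" using 2(1) jext_jdom[of k n phi] by (auto simp: jdom_iff)
    have low: "M - 1 \<le> ?X ! i" "M - 1 \<le> ?Y ! i"
      using tX[of "M - 1"] MX M by (cases "M = 1"; linarith)+
    have high: "?X ! i \<le> M" "?Y ! i \<le> M"
      using tX[of "Suc M"] MX M le by (cases "Suc M \<le> k"; linarith)+
    have "?X ! i = x ! j" "?Y ! i = y ! j"
      using low high MX adj M by (auto simp: M_def max_def split: if_splits)
    then have "iarr e k (?X ! i) (?Y ! i)" using \<open>iarr e k (x ! j) (y ! j)\<close> by simp
    then show ?thesis using other 2(1) unfolding jarr_def by (auto intro!: exI[of _ i])
  qed
qed

section \<open>The nerve as a cubical set\<close>

lemma NJ_cells: "f \<in> cells (NJ k e G) n \<longleftrightarrow> f \<in> extensional (jdom k n) \<and>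
    (\<forall>x\<in>jdom k n. \<forall>y\<in>jdom k n. jarr e k x y \<longrightarrow> (f x, f y) \<in> G)"
  by (simp add: NJ_def)

lemma NJ_act: "act (NJ k e G) m n phi f = restrict (\<lambda>x. f (jext k n phi x)) (jdom k m)"
  by (simp add: NJ_def)

lemma cubical_set_NJ: "cubical_set (NJ k e G)"
  unfolding cubical_set_def
proof (intro conjI allI impI; (elim conjE)?)
  fix m n phi f assume "boxhom m n phi" "f \<in> cells (NJ k e G) n"
  then show "act (NJ k e G) m n phi f \<in> cells (NJ k e G) m"
    using jext_jarr[of m n phi _ k _ e] unfolding NJ_cells NJ_act by simp
next
  fix n f assume "f \<in> cells (NJ k e G) n"
  then show "act (NJ k e G) n n (restrict id (bdom n)) f = f"
    unfolding NJ_cells NJ_act by (intro extensionalityI[of _ "jdom k n"]) (auto simp: jext_id)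
next
  fix l m n g f x assume "boxhom l m g" "boxhom m n f" "x \<in> cells (NJ k e G) n"
  then show "act (NJ k e G) l m g (act (NJ k e G) m n f x) =
      act (NJ k e G) l n (restrict (f \<circ> g) (bdom l)) x"
    unfolding NJ_act by (intro restrict_ext) (simp only: jext_comp jext_jdom restrict_apply' simp_thms)
qed

lemma jext_face:
  assumes "i \<le> n" "x \<in> jdom k n"
  shows "jext k (Suc n) (restrict (\<lambda>x. take i x @ e # drop i x) (bdom n)) x
    = take i x @ (if e then k else 0) # drop i x"
proof (rule jext_eqI[OF bh_face[OF assms(1)] assms(2)])
  show "take i x @ (if e then k else 0) # drop i x \<in> jdom k (Suc n)"
    using assms by (auto simp: jdom_def dest: in_set_takeD in_set_dropD)
  fix t assume "1 \<le> t" "t \<le> k"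
  then show "bits t (take i x @ (if e then k else 0) # drop i x) =
      restrict (\<lambda>x. take i x @ e # drop i x) (bdom n) (bits t x)"
    using assms by (simp add: jdom_iff bits_def take_map drop_map)
qed

lemma jext_conn_last:
  assumes "x \<in> jdom k (Suc (Suc n))"
  shows "jext k (Suc n) (restrict (\<lambda>x. take n x @ (x ! n \<or> x ! Suc n) # drop (Suc (Suc n)) x) (bdom (Suc (Suc n)))) x
    = take n x @ [max (x ! n) (x ! Suc n)]"
proof (rule jext_eqI[OF bh_conn_max assms])
  show "take n x @ [max (x ! n) (x ! Suc n)] \<in> jdom k (Suc n)"
    using assms by (auto simp: jdom_iff nth_append)
  fix t assume "1 \<le> t" "t \<le> k"
  then show "bits t (take n x @ [max (x ! n) (x ! Suc n)]) =
     restrict (\<lambda>x. take n x @ (x ! n \<or> x ! Suc n) # drop (Suc (Suc n)) x) (bdom (Suc (Suc n))) (bits t x)"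
    using assms by (simp add: jdom_iff bits_def take_map le_max_iff_disj)
qed simp

lemma jext_xid:
  assumes "boxhom m n phi" "x \<in> jdom k (Suc m)"
  shows "jext k (Suc n) (xid m phi) x = jext k n phi (butlast x) @ [last x]"
proof (rule jext_eqI[OF boxhom_xid[OF assms(1)] assms(2)])
  have ne: "x \<noteq> []" using assms by (auto simp: jdom_iff)
  then have "last x \<le> k" using assms(2) by (auto simp: jdom_def dest: last_in_set)
  then show "jext k n phi (butlast x) @ [last x] \<in> jdom k (Suc n)"
    using jext_jdom[of k n phi "butlast x"] by (auto simp: jdom_def)
  fix t assume t: "1 \<le> t" "t \<le> k"
  have "bits t (jext k n phi (butlast x)) = phi (bits t (butlast x))"
    using bits_jext[OF assms(1) _ t] assms(2) by (simp add: jdom_iff)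
  then show "bits t (jext k n phi (butlast x) @ [last x]) = xid m phi (bits t x)"
    using ne assms(2) by (simp add: xid_def bits_def map_butlast last_map jdom_iff)
qed

section \<open>Nondegenerate cubes and lifting along a filling operation\<close>

abbreviation bface :: "nat \<Rightarrow> nat \<Rightarrow> bool \<Rightarrow> bool list \<Rightarrow> bool list" where
  "bface n i e \<equiv> restrict (\<lambda>x. take i x @ e # drop i x) (bdom n)"

abbreviation bdegen :: "nat \<Rightarrow> nat \<Rightarrow> bool list \<Rightarrow> bool list" where
  "bdegen n i \<equiv> restrict (\<lambda>x. take i x @ drop (Suc i) x) (bdom (Suc n))"

abbreviation bconn :: "nat \<Rightarrow> nat \<Rightarrow> bool list \<Rightarrow> bool list" where
  "bconn n i \<equiv> restrict (\<lambda>x. take i x @ (x ! i \<or> x ! Suc i) # drop (Suc (Suc i)) x) (bdom (Suc n))"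

lemma cubical_set_act: "cubical_set X \<Longrightarrow> boxhom m n phi \<Longrightarrow> x \<in> cells X n \<Longrightarrow> act X m n phi x \<in> cells X m"
  unfolding cubical_set_def by blast

lemma cubical_set_id: "cubical_set X \<Longrightarrow> x \<in> cells X n \<Longrightarrow> act X n n (restrict id (bdom n)) x = x"
  unfolding cubical_set_def by blast

lemma cubical_set_comp: "cubical_set X \<Longrightarrow> boxhom l m g \<Longrightarrow> boxhom m n f \<Longrightarrow> x \<in> cells X n \<Longrightarrow>
    act X l m g (act X m n f x) = act X l n (restrict (f \<circ> g) (bdom l)) x"
  unfolding cubical_set_def by blast

lemma openbox_cells: "phi \<in> cells (openbox n i eps) k \<longleftrightarrow> boxhom k n phi \<and>
    (\<exists>j e. j < n \<and> (j, e) \<noteq> (i, eps) \<and> (\<forall>x. length x = k \<longrightarrow> phi x ! j = e))"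
  unfolding openbox_def Ball_def bdom_iff by simp

lemma cubical_set_factor:
  assumes "cubical_set X" "boxhom l m g" "boxhom m n f" "x \<in> cells X n" "phi = restrict (f \<circ> g) (bdom l)"
  shows "act X l n phi x = act X l m g (act X m n f x)"
  using cubical_set_comp[OF assms(1-4)] assms(5) by (simp only:)

lemma cubical_set_section:
  assumes "cubical_set X" "boxhom n m s" "boxhom m n phi" "x \<in> cells X n"
    and "restrict (phi \<circ> s) (bdom n) = restrict id (bdom n)"
  shows "act X n m s (act X m n phi x) = x"
  using cubical_set_comp[OF assms(1-4)] cubical_set_id[OF assms(1,4)] assms(5) by (simp only:)

lemma boxhom_not_nconst:
  assumes "boxhom m n phi" "\<not> nconst phi m n"
  obtains i e n' psi where "n = Suc n'" "i \<le> n'" "boxhom m n' psi"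
    "phi = restrict (bface n' i e \<circ> psi) (bdom m)"
proof -
  from assms(2) obtain i where i: "i < n" "\<And>j. \<not> dep phi m i j" by (auto simp: nconst_def)
  then obtain n' where n: "n = Suc n'" by (cases n) auto
  obtain psi where "boxhom m n' psi"
    "phi = restrict (bface n' i (phi (replicate m False) ! i) \<circ> psi) (bdom m)"
    using boxhom_const_factor[of m n' phi i "phi (replicate m False) ! i"] not_dep_const[OF assms(1) i(2)]
      assms(1) i n by (metis less_Suc_eq_le)
  then show ?thesis using that n i by (metis less_Suc_eq_le)
qed

section \<open>Nondegenerate cubes and the Eilenberg--Zilber property\<close>

definition nondeg :: "'a cset \<Rightarrow> nat \<Rightarrow> 'a \<Rightarrow> bool" where
  "nondeg X n x \<longleftrightarrow> x \<in> cells X n \<and>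
     \<not> (\<exists>m phi y. m < n \<and> boxhom n m phi \<and> y \<in> cells X m \<and> x = act X n m phi y)"

text \<open>A constant output of \<open>phi\<close> would make \<open>x\<close> factor through a
  face of \<open>y\<close>, which has smaller dimension; an endomorphism without constant outputs is
  the identity.\<close>

lemma nondeg_act_id:
  assumes "cubical_set X" "nondeg X n x" "boxhom n m phi" "y \<in> cells X m" "x = act X n m phi y" "m \<le> n"
  shows "m = n \<and> phi = restrict id (bdom n) \<and> x = y"
proof -
  have m: "m = n" using assms unfolding nondeg_def by (metis le_neq_implies_less)
  have "nconst phi n m"
  proof (rule ccontr)
    assume "\<not> nconst phi n m"
    then obtain i e n' psi where *: "m = Suc n'" "i \<le> n'" "boxhom n n' psi"
      "phi = restrict (bface n' i e \<circ> psi) (bdom n)"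
      by (rule boxhom_not_nconst[OF assms(3)])
    have y: "y \<in> cells X (Suc n')" using assms(4) *(1) by simp
    have "x = act X n n' psi (act X n' (Suc n') (bface n' i e) y)"
      using assms(5) cubical_set_factor[OF assms(1) *(3) bh_face[OF *(2)] y *(4)] *(1) by (simp only:)
    moreover have "act X n' (Suc n') (bface n' i e) y \<in> cells X n'"
      using cubical_set_act[OF assms(1) bh_face[OF *(2)] y] .
    ultimately show False using assms(2) * m unfolding nondeg_def by (metis lessI)
  qed
  then have "phi = restrict id (bdom n)" using nconst_endo_id assms(3) m by blast
  then show ?thesis using m assms cubical_set_id by metis
qed

text \<open>A section \<open>s\<close> of \<open>phi\<close> gives
  \<open>x = act X n n (psi o s) x\<close>, and nondegeneracy forces the composite of
  \<open>psi\<close> and \<open>s\<close> to be the identity. Hence \<open>phi\<close> and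
  \<open>psi\<close> have the same sections.\<close>

lemma Eilenberg_Zilber_unique:
  assumes X: "cubical_set X" and x: "nondeg X n x"
    and phi: "boxhom m n phi" "nconst phi m n" and psi: "boxhom m n psi" "nconst psi m n"
    and eq: "act X m n phi x = act X m n psi x"
  shows "phi = psi"
proof (rule sections_determine[OF phi psi])
  have xc: "x \<in> cells X n" using x by (simp add: nondeg_def)
  have half: "restrict (b \<circ> s) (bdom n) = restrict id (bdom n)"
    if s: "boxhom n m s" and ab: "boxhom m n a" "boxhom m n b" "act X m n a x = act X m n b x"
      and a: "restrict (a \<circ> s) (bdom n) = restrict id (bdom n)" for a b s
  proof -
    have "x = act X n m s (act X m n a x)"
      using cubical_set_section[OF X s ab(1) xc a] by simp
    also have "\<dots> = act X n n (restrict (b \<circ> s) (bdom n)) x"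
      using cubical_set_comp[OF X s ab(2) xc] ab(3) by (simp only:)
    finally show ?thesis using nondeg_act_id[OF X x bh_comp[OF s ab(2)] xc] by simp
  qed
  show "restrict (phi \<circ> s) (bdom n) = restrict id (bdom n) \<longleftrightarrow>
        restrict (psi \<circ> s) (bdom n) = restrict id (bdom n)" if "boxhom n m s" for s
    using half[OF that phi(1) psi(1) eq] half[OF that psi(1) phi(1) eq[symmetric]] by blast
qed

text \<open>Every output \<open>i\<close> depends on input \<open>i\<close>, so by the order of
  inputs only the last output can depend on the additional input as well. If it does,
  \<open>pi\<close> is the maximum connection of the last two coordinates and retracts the
  neighbouring \<open>False\<close> face too. This is used to show that a filler is
  nondegenerate.\<close>

lemma retraction_of_last_face:
  assumes pi: "boxhom (Suc n) n pi" and id: "\<And>z. length z = n \<Longrightarrow> pi (z @ [False]) = z"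
  shows "pi = bdegen n n \<or>
    (\<exists>n'. n = Suc n' \<and> restrict (pi \<circ> bface n n' False) (bdom n) = restrict id (bdom n))"
proof -
  have dii: "dep pi (Suc n) i i" if "i < n" for i
  proof -
    let ?z = "replicate n False @ [False]"
    have u: "?z[i := True] = (replicate n False)[i := True] @ [False]"
      using that by (simp add: list_update_append)
    have "pi ?z ! i \<noteq> pi (?z[i := True]) ! i"
      unfolding u using id[of "replicate n False"] id[of "(replicate n False)[i := True]"] that by simp
    moreover have "?z ! i = False" using that by (simp add: nth_append)
    ultimately show ?thesis using that unfolding dep_def
      by (intro conjI exI[of _ ?z]) auto
  qed
  have last: "Suc i = n" if "i < n" "dep pi (Suc n) i n" for i
    using boxhom_dep_less[OF pi, of "Suc i" i n "Suc i"] dii[of "Suc i"] that by (cases "Suc i < n") auto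
  have below: "j = i \<or> j = n" if "i < n" "dep pi (Suc n) i j" for i j
    using boxhom_dep_less[OF pi, of i j j j] boxhom_dep_less[OF pi, of j i j j] dii[of j] that
    by (metis dep_def less_SucE less_irrefl nat_neq_iff)
  have val: "pi z ! i = z ! i" if "i < n" "\<not> dep pi (Suc n) i n" "length z = Suc n" for i z
  proof -
    have "pi z ! i = pi (butlast z @ [False]) ! i"
    proof (rule boxhom_cong[OF pi])
      fix j assume j: "dep pi (Suc n) i j"
      then have "j < n" using that below[OF that(1) j] by auto
      then show "z ! j = (butlast z @ [False]) ! j" using that by (simp add: nth_append nth_butlast)
    qed (use that in auto)
    then show ?thesis using id[of "butlast z"] that by (simp add: nth_butlast)
  qed
  show ?thesis
  proof (cases "\<exists>i<n. dep pi (Suc n) i n")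
    case False
    have "pi = bdegen n n"
      using False val by (intro boxhom_eqI[OF pi bh_degen]) auto
    then show ?thesis by blast
  next
    case True
    then obtain n' where n: "n = Suc n'" and d: "dep pi (Suc n) n' n" using last by blast
    have "restrict (pi \<circ> bface n n' False) (bdom n) = restrict id (bdom n)"
    proof (rule boxhom_eqI[OF bh_comp[OF bh_face pi] bh_id])
      show "n' \<le> n" using n by simp
      fix w :: "bool list" and i assume w: "length w = n" and i: "i < n"
      let ?u = "take n' w @ False # drop n' w"
      have u: "length ?u = Suc n" using w n by simp
      have un: "?u ! p = (if p < n' then w ! p else if p = n' then False else w ! (p - 1))" if "p \<le> n" for p
        using nth_insert[of n' w p False] w n that by simp
      have "pi ?u ! i = w ! i"
      proof (cases "i = n'")
        case False
        then have "\<not> dep pi (Suc n) i n" using last[OF i] n by auto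
        then show ?thesis using val[OF i _ u] un[of i] False i n by simp
      next
        case True
        obtain z where z: "length z = Suc n" "pi z ! n' \<noteq> pi (z[n := \<not> z ! n]) ! n'"
          using d by (auto simp: dep_def)
        define zb where "zb b = z[n := b]" for b
        have zb: "length (zb b) = Suc n" for b using z by (simp add: zb_def)
        have zself: "zb (z ! n) = z" by (simp add: zb_def)
        have ne: "pi (zb False) ! n' \<noteq> pi (zb True) ! n'"
          using z(2) zself unfolding zb_def[symmetric] by (cases "z ! n") auto
        have bl: "ble (zb False) (zb True)" using z by (auto simp: ble_def zb_def nth_list_update)
        have "\<not> pi (zb False) ! n'" "pi (zb True) ! n'"
          using ne boxhom_mono[OF pi zb bl] boxhom_length[OF pi zb] n by (auto simp: ble_def)
        moreover have "zb False = butlast (zb False) @ [False]"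
          using zb[of False] by (intro nth_equalityI) (auto simp: nth_append nth_butlast zb_def z less_Suc_eq)
        then have "pi (zb False) ! n' = zb False ! n'"
          using id[of "butlast (zb False)"] zb[of False] n by (metis length_butlast diff_Suc_1 lessI nth_butlast)
        ultimately have zn: "\<not> z ! n'" and T: "pi (zb True) ! n'" using n by (auto simp: zb_def)
        have agree: "pi ?u ! n' = pi (zb (w ! n')) ! n'"
        proof (rule boxhom_cong[OF pi u zb])
          fix p assume "dep pi (Suc n) n' p"
          then have "p = n' \<or> p = n" using below n by blast
          then show "?u ! p = zb (w ! n') ! p" using un[of p] zn n z by (auto simp: zb_def)
        qed
        show ?thesis using agree T \<open>\<not> pi (zb False) ! n'\<close> True by (cases "w ! n'") auto
      qed
      then show "restrict (pi \<circ> bface n n' False) (bdom n) w ! i = restrict id (bdom n) w ! i"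
        using w by simp
    qed
    then show ?thesis using n by blast
  qed
qed

text \<open>Partial lifts are graphs rather than functions, so that extension is inclusion and the
  union of a chain is an upper bound.\<close>

definition partial_lift where
  "partial_lift X E p v fil L \<longleftrightarrow>
     (\<forall>n x e. (n, x, e) \<in> L \<longrightarrow> x \<in> cells X n \<and> e \<in> cells E n \<and> p n e = v n x \<and>
        (\<exists>e'. (Suc n, fil n x, e') \<in> L)) \<and>
     (\<forall>m n phi x e. boxhom m n phi \<and> (n, x, e) \<in> L \<longrightarrow> (m, act X m n phi x, act E m n phi e) \<in> L) \<and>
     (\<forall>n x e e'. (n, x, e) \<in> L \<and> (n, x, e') \<in> L \<longrightarrow> e = e')"

text \<open>The assumptions make it possible to attach \<open>fil n x\<close> to the smaller cubes along the open box
  whose missing face is \<open>x\<close>; connections enter through \<open>fil_fil\<close>, which keeps the subcomplex built so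
  far closed under \<open>fil\<close>.\<close>

locale filling =
  fixes X :: "'a cset" and A :: "nat \<Rightarrow> 'a set" and fil :: "nat \<Rightarrow> 'a \<Rightarrow> 'a"
    and mu :: "nat \<Rightarrow> 'a \<Rightarrow> 'w" and R :: "('w \<times> 'w) set"
  assumes X: "cubical_set X" and wfR: "wf R"
    and fil_cell: "x \<in> cells X n \<Longrightarrow> fil n x \<in> cells X (Suc n)"
    and fil_face0: "x \<in> cells X n \<Longrightarrow> act X n (Suc n) (bface n n False) (fil n x) = x"
    and fil_epi: "boxhom m n phi \<Longrightarrow> nconst phi m n \<Longrightarrow> x \<in> cells X n \<Longrightarrow>
       fil m (act X m n phi x) = act X (Suc m) (Suc n) (xid m phi) (fil n x)"
    and fil_fil: "x \<in> cells X n \<Longrightarrow>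
       fil (Suc n) (fil n x) = act X (Suc (Suc n)) (Suc n) (bconn (Suc n) n) (fil n x)"
    and face_less: "x \<in> cells X (Suc n) \<Longrightarrow> x \<notin> A (Suc n) \<Longrightarrow> i \<le> n \<Longrightarrow>
       (mu n (act X n (Suc n) (bface n i e) x), mu (Suc n) x) \<in> R"
    and fil_face: "x \<in> cells X (Suc n) \<Longrightarrow> x \<notin> A (Suc n) \<Longrightarrow> i \<le> n \<Longrightarrow>
       act X (Suc n) (Suc (Suc n)) (bface (Suc n) i e) (fil (Suc n) x) = fil n (act X n (Suc n) (bface n i e) x)
       \<or> (mu (Suc n) (act X (Suc n) (Suc (Suc n)) (bface (Suc n) i e) (fil (Suc n) x)), mu (Suc n) x) \<in> R"
    and fil_face1: "x \<in> cells X n \<Longrightarrow> x \<notin> A n \<Longrightarrow>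
       (mu n (act X n (Suc n) (bface n n True) (fil n x)), mu n x) \<in> R"
    and fil_not_degen: "x \<in> cells X n \<Longrightarrow> x \<notin> A n \<Longrightarrow> fil n x \<noteq> act X (Suc n) n (bdegen n n) x"
begin

text \<open>For \<open>f\<close> minimal outside the domain, the filler \<open>F\<close> meets the
  domain exactly in the open box whose missing face is \<open>f\<close>. The Kan condition then
  yields values on the cubes of \<open>F\<close> that agree with the old ones, and nondegeneracy of
  \<open>f\<close> and \<open>F\<close> makes them independent of the chosen presentation.\<close>

lemma extend_partial_lift:
  fixes E :: "'e cset" and B :: "'b cset" and p :: "nat \<Rightarrow> 'e \<Rightarrow> 'b" and v :: "nat \<Rightarrow> 'a \<Rightarrow> 'b"
  assumes kan: "kan_fibration E B p" and v: "cmap X B v" and L: "partial_lift X E p v fil L"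
    and AL: "\<And>n x. x \<in> A n \<Longrightarrow> \<exists>e. (n, x, e) \<in> L"
    and x0: "x0 \<in> cells X n0" "\<nexists>e. (n0, x0, e) \<in> L"
  shows "\<exists>L'. partial_lift X E p v fil L' \<and> L \<subset> L'"
proof -
  define Y where "Y n x \<longleftrightarrow> (\<exists>e. (n, x, e) \<in> L)" for n x
  have L_cell: "x \<in> cells X n" "e \<in> cells E n" "p n e = v n x" if "(n, x, e) \<in> L" for n x e
    using L that unfolding partial_lift_def by blast+
  have Y_fil: "Y (Suc n) (fil n x)" if "Y n x" for n x
    using L that unfolding partial_lift_def Y_def by blast
  have L_act: "(m, act X m n phi x, act E m n phi e) \<in> L" if "boxhom m n phi" "(n, x, e) \<in> L" for m n phi x e
    using L that unfolding partial_lift_def by blast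
  have L_fun: "e = e'" if "(n, x, e) \<in> L" "(n, x, e') \<in> L" for n x e e'
    using L that unfolding partial_lift_def by blast
  have Y_act: "Y m (act X m n phi x)" if "boxhom m n phi" "Y n x" for m n phi x
    using L_act that unfolding Y_def by blast

  let ?S = "{w. \<exists>n x. x \<in> cells X n \<and> \<not> Y n x \<and> w = mu n x}"
  have "mu n0 x0 \<in> ?S" using x0 by (auto simp: Y_def)
  then obtain w where "w \<in> ?S" "\<And>w'. (w', w) \<in> R \<Longrightarrow> w' \<notin> ?S" 
    using wfR[unfolded wf_eq_minimal, rule_format, of _ ?S] by blast
  then obtain n f where f: "f \<in> cells X n" "\<not> Y n f"
    and min: "\<And>m y. y \<in> cells X m \<Longrightarrow> (mu m y, mu n f) \<in> R \<Longrightarrow> Y m y"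
    by blast
  have fA: "f \<notin> A n" using f AL by (auto simp: Y_def)
  define F where "F = fil n f"
  have F: "F \<in> cells X (Suc n)" using fil_cell f by (simp add: F_def)
  have F0: "act X n (Suc n) (bface n n False) F = f" using fil_face0 f by (simp add: F_def)
  have FY: "\<not> Y (Suc n) F" using F0 Y_act[OF bh_face[of n n False], of F] f by auto

  have f_face: "Y n' (act X n' n (bface n' i e) f)" if "n = Suc n'" "i \<le> n'" for n' i e
    using min face_less[of f n' i e] f fA that cubical_set_act[OF X bh_face] by blast

  \<comment> \<open>Factor \<open>f\<close> through a cube \<open>y\<close> of least dimension; the
    factoring map then has no constant output and so has a section \<open>s\<close>. For reasons of
    dimension \<open>s\<close> passes through a face of \<open>f\<close>, so
    \<open>y = act X m n s f\<close> is in the domain, and with it \<open>f\<close>.\<close>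
  have f_nondeg: "nondeg X n f"
  proof (rule ccontr)
    assume "\<not> nondeg X n f"
    then have ex: "\<exists>m. m < n \<and> (\<exists>phi y. boxhom n m phi \<and> y \<in> cells X m \<and> f = act X n m phi y)"
      using f by (auto simp: nondeg_def)
    define m where "m = (LEAST m. m < n \<and> (\<exists>phi y. boxhom n m phi \<and> y \<in> cells X m \<and> f = act X n m phi y))"
    have m: "m < n" "\<exists>phi y. boxhom n m phi \<and> y \<in> cells X m \<and> f = act X n m phi y"
      using LeastI_ex[OF ex] unfolding m_def by blast+
    then obtain phi y where phi: "boxhom n m phi" "y \<in> cells X m" "f = act X n m phi y" by blast
    have nc: "nconst phi n m"
    proof (rule ccontr)
      assume "\<not> nconst phi n m"
      then obtain i e m' psi where *: "m = Suc m'" "i \<le> m'" "boxhom n m' psi"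
        "phi = restrict (bface m' i e \<circ> psi) (bdom n)"
        by (rule boxhom_not_nconst[OF phi(1)])
      have y: "y \<in> cells X (Suc m')" using phi(2) *(1) by simp
      have "f = act X n m' psi (act X m' (Suc m') (bface m' i e) y)"
        using phi(3) cubical_set_factor[OF X *(3) bh_face[OF *(2)] y *(4)] *(1) by (simp only:)
      moreover have "act X m' (Suc m') (bface m' i e) y \<in> cells X m'"
        using cubical_set_act[OF X bh_face[OF *(2)] y] .
      ultimately have "m \<le> m'" using * m(1) unfolding m_def by (intro Least_le) auto
      then show False using * by simp
    qed
    obtain s where s: "boxhom m n s" "restrict (phi \<circ> s) (bdom m) = restrict id (bdom m)"
      by (rule boxhom_section_exists[OF phi(1) nc])
    have ys: "y = act X m n s f"
      using cubical_set_section[OF X s(1) phi(1,2) s(2)] phi(3) by simp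
    have "\<not> nconst s m n" using nconst_le[OF s(1)] m(1) by auto
    then obtain i e n' psi where *: "n = Suc n'" "i \<le> n'" "boxhom m n' psi"
        "s = restrict (bface n' i e \<circ> psi) (bdom m)"
      by (rule boxhom_not_nconst[OF s(1)])
    have f': "f \<in> cells X (Suc n')" using f *(1) by simp
    have "y = act X m n' psi (act X n' (Suc n') (bface n' i e) f)"
      using ys cubical_set_factor[OF X *(3) bh_face[OF *(2)] f' *(4)] *(1) by (simp only:)
    then have "Y m y" using f_face[OF *(1,2)] Y_act[OF *(3)] *(1) by metis
    then show False using f phi Y_act by metis
  qed

  have F_face: "Y n (act X n (Suc n) (bface n i e) F)" if ie: "i \<le> n" "(i, e) \<noteq> (n, False)" for i e
  proof (cases "i = n")
    case True
    then show ?thesis using ie fil_face1[OF f(1) fA] min[of _ n] cubical_set_act[OF X bh_face F]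
      unfolding F_def by auto
  next
    case False
    then obtain n' where n: "n = Suc n'" "i \<le> n'" using ie by (cases n) auto
    have c: "act X n (Suc n) (bface n i e) F \<in> cells X n" using cubical_set_act[OF X bh_face[OF ie(1)] F] .
    from fil_face[of f n' i e] f fA n
    show ?thesis using min[OF c] Y_fil[OF f_face[OF n]] unfolding F_def by metis
  qed

  have box_Y: "Y k (act X k (Suc n) phi F)" if "phi \<in> cells (openbox (Suc n) n False) k" for k phi
  proof -
    from that obtain j e where phi: "boxhom k (Suc n) phi" and j: "j \<le> n" "(j, e) \<noteq> (n, False)"
      "\<And>x. length x = k \<Longrightarrow> phi x ! j = e"
      unfolding openbox_cells less_Suc_eq_le by blast
    obtain psi where psi: "boxhom k n psi" "phi = restrict (bface n j e \<circ> psi) (bdom k)"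
      by (rule boxhom_const_factor[OF phi j(1,3)])
    have "act X k (Suc n) phi F = act X k n psi (act X n (Suc n) (bface n j e) F)"
      by (rule cubical_set_factor[OF X psi(1) bh_face[OF j(1)] F psi(2)])
    then show ?thesis using F_face[OF j(1,2)] Y_act[OF psi(1)] by metis
  qed
  \<comment> \<open>Outside the open box only output \<open>n\<close> can be constant, and only with
    value \<open>False\<close>; then \<open>phi\<close> passes through the missing face.\<close>
  have not_box: "nconst phi k (Suc n) \<or>
     (\<exists>psi. boxhom k n psi \<and> nconst psi k n \<and> phi = restrict (bface n n False \<circ> psi) (bdom k))"
    if phi: "boxhom k (Suc n) phi" and nb: "phi \<notin> cells (openbox (Suc n) n False) k" for k phi
  proof (rule disj_imp[THEN iffD2], rule impI)
    have nc: "\<exists>j. dep phi k i j" if "i \<le> n" "(i, phi (replicate k False) ! i) \<noteq> (n, False)" for i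
    proof (rule ccontr)
      assume "\<nexists>j. dep phi k i j"
      then have "\<And>x. length x = k \<Longrightarrow> phi x ! i = phi (replicate k False) ! i"
        using not_dep_const[OF phi] by blast
      then show False using nb phi that unfolding openbox_cells less_Suc_eq_le by blast
    qed
    assume "\<not> nconst phi k (Suc n)"
    then obtain i where i: "i \<le> n" "\<nexists>j. dep phi k i j" by (auto simp: nconst_def less_Suc_eq_le)
    then have "(i, phi (replicate k False) ! i) = (n, False)" using nc by blast
    then have cF: "phi x ! n = False" if "length x = k" for x
      using not_dep_const[OF phi, of n x] i that by auto
    obtain psi where psi: "boxhom k n psi" "phi = restrict (bface n n False \<circ> psi) (bdom k)"
      "psi = restrict (bdegen n n \<circ> phi) (bdom k)"
      by (rule boxhom_const_factor[OF phi order.refl cF])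
    have "psi x ! i = phi x ! i" if "i < n" "length x = k" for i x
      unfolding psi(3) using that boxhom_length[OF phi] by simp
    then have "dep psi k i j" if "i < n" "dep phi k i j" for i j
      using that unfolding dep_def by (metis length_list_update)
    moreover have "\<exists>j. dep phi k i j" if "i < n" for i using nc[of i] that by simp
    ultimately have "nconst psi k n" unfolding nconst_def by blast
    then show "\<exists>psi. boxhom k n psi \<and> nconst psi k n \<and> phi = restrict (bface n n False \<circ> psi) (bdom k)"
      using psi by blast
  qed
  \<comment> \<open>Applying a section recovers \<open>y\<close>, so the domain contains a cube as
    soon as it contains one of its degeneracies.\<close>
  have epi_Y: "Y m y" if phi: "boxhom k m phi" "nconst phi k m" and y: "y \<in> cells X m" "Y k (act X k m phi y)"
    for k m phi y
  proof -
    obtain s where s: "boxhom m k s" "restrict (phi \<circ> s) (bdom m) = restrict id (bdom m)"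
      by (rule boxhom_section_exists[OF phi])
    then show ?thesis
      using Y_act[OF s(1) y(2)] cubical_set_section[OF X s(1) phi(1) y(1) s(2)] by simp
  qed
  have act_face0: "act X k (Suc n) (restrict (bface n n False \<circ> psi) (bdom k)) F = act X k n psi f"
    if "boxhom k n psi" for k psi
    using cubical_set_comp[OF X that bh_face[of n n False, OF order.refl] F] F0 by (simp only:)
  have box_iff: "Y k (act X k (Suc n) phi F) \<longleftrightarrow> phi \<in> cells (openbox (Suc n) n False) k"
    if phi: "boxhom k (Suc n) phi" for k phi
  proof
    assume Yp: "Y k (act X k (Suc n) phi F)"
    show "phi \<in> cells (openbox (Suc n) n False) k"
    proof (rule ccontr)
      assume "phi \<notin> cells (openbox (Suc n) n False) k"
      from not_box[OF phi this] show False
      proof (elim disjE exE conjE)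
        assume "nconst phi k (Suc n)"
        then show False using epi_Y[OF phi _ F Yp] FY by simp
      next
        fix psi assume psi: "boxhom k n psi" "nconst psi k n" "phi = restrict (bface n n False \<circ> psi) (bdom k)"
        then have "Y k (act X k n psi f)" using act_face0[OF psi(1)] Yp by (simp only:)
        then show False using epi_Y[OF psi(1,2) f(1)] f(2) by simp
      qed
    qed
  qed (rule box_Y)

  \<comment> \<open>Restricting a factorisation of \<open>F\<close> to the missing face gives one of
    the nondegenerate \<open>f\<close>, so the factoring map retracts that face. The degeneracy is
    excluded by \<open>fil_not_degen\<close>, while a connection would make \<open>f\<close> equal
    to a face of \<open>F\<close> in the open box.\<close>
  have F_nondeg: "nondeg X (Suc n) F"
  proof (rule ccontr)
    assume "\<not> nondeg X (Suc n) F"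
    then obtain m pi y where pi: "m \<le> n" "boxhom (Suc n) m pi" "y \<in> cells X m" "F = act X (Suc n) m pi y"
      using F by (auto simp: nondeg_def less_Suc_eq_le)
    have "f = act X n m (restrict (pi \<circ> bface n n False) (bdom n)) y"
      using cubical_set_comp[OF X bh_face[of n n False, OF order.refl] pi(2,3)] F0 pi(4) by (simp only:)
    from nondeg_act_id[OF X f_nondeg bh_comp[OF bh_face[of n n False, OF order.refl] pi(2)] pi(3) this pi(1)]
    have m: "m = n" and id: "restrict (pi \<circ> bface n n False) (bdom n) = restrict id (bdom n)" and y: "f = y"
      by auto
    have pin: "boxhom (Suc n) n pi" using pi(2) m by simp
    have "pi (z @ [False]) = z" if "length z = n" for z
      using fun_cong[OF id, of z] that by simp
    from retraction_of_last_face[OF pin this]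
    consider "pi = bdegen n n" | n' where "n = Suc n'"
      "restrict (pi \<circ> bface n n' False) (bdom n) = restrict id (bdom n)" by blast
    then show False
    proof cases
      case 1
      then show ?thesis using fil_not_degen[OF f(1) fA] pi(4) m y by (simp add: F_def)
    next
      case 2
      have "act X n (Suc n) (bface n n' False) F = f"
        using cubical_set_section[OF X bh_face[of n' n False] pin f(1) 2(2)] 2(1) pi(4) m y by simp
      then show ?thesis using F_face[of n' False] f(2) 2 by simp
    qed
  qed
  \<comment> \<open>A cube of \<open>F\<close> outside the domain arises from \<open>F\<close> or
    from \<open>f\<close> along a morphism without constant outputs. Within each kind that morphism
    is unique; a cube of both kinds would make \<open>F\<close> degenerate.\<close>
  have inj: "phi = psi" if phi: "boxhom k (Suc n) phi" and psi: "boxhom k (Suc n) psi"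
    and eq: "act X k (Suc n) phi F = act X k (Suc n) psi F" and nY: "\<not> Y k (act X k (Suc n) phi F)" for k phi psi
  proof -
    have nb: "phi \<notin> cells (openbox (Suc n) n False) k" "psi \<notin> cells (openbox (Suc n) n False) k"
      using nY eq box_iff[OF phi] box_iff[OF psi] by auto
    have mixed: False if a: "boxhom k (Suc n) a" "nconst a k (Suc n)" and b: "boxhom k n b"
      and e: "act X k (Suc n) a F = act X k n b f" for a b
    proof -
      obtain s where s: "boxhom (Suc n) k s" "restrict (a \<circ> s) (bdom (Suc n)) = restrict id (bdom (Suc n))"
        by (rule boxhom_section_exists[OF a])
      have "F = act X (Suc n) n (restrict (b \<circ> s) (bdom (Suc n))) f"
        using cubical_set_section[OF X s(1) a(1) F s(2)] cubical_set_comp[OF X s(1) b f(1)] e by simp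
      then show False using F_nondeg bh_comp[OF s(1) b] f(1) unfolding nondeg_def by (metis lessI)
    qed
    consider "nconst phi k (Suc n)" "nconst psi k (Suc n)"
      | b where "nconst phi k (Suc n)" "boxhom k n b" "psi = restrict (bface n n False \<circ> b) (bdom k)"
      | b where "nconst psi k (Suc n)" "boxhom k n b" "phi = restrict (bface n n False \<circ> b) (bdom k)"
      | a b where "boxhom k n a" "nconst a k n" "phi = restrict (bface n n False \<circ> a) (bdom k)"
          "boxhom k n b" "nconst b k n" "psi = restrict (bface n n False \<circ> b) (bdom k)"
      using not_box[OF phi nb(1)] not_box[OF psi nb(2)] by blast
    then show ?thesis
    proof cases
      case 1 then show ?thesis using Eilenberg_Zilber_unique[OF X F_nondeg phi _ psi] eq by blast
    next
      case 2 then show ?thesis using mixed[OF phi] eq act_face0 by metis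
    next
      case 3 then show ?thesis using mixed[OF psi] eq act_face0 by metis
    next
      case 4
      then have "act X k n a f = act X k n b f" using eq act_face0 by metis
      then show ?thesis using Eilenberg_Zilber_unique[OF X f_nondeg 4(1,2,4,5)] 4 by simp
    qed
  qed

  define u0 where "u0 k phi = (THE e. (k, act X k (Suc n) phi F, e) \<in> L)" for k phi
  have u0: "(k, act X k (Suc n) phi F, u0 k phi) \<in> L" if "phi \<in> cells (openbox (Suc n) n False) k" for k phi
    using box_Y[OF that] L_fun unfolding Y_def u0_def by (metis theI)
  define v0 where "v0 k phi = v k (act X k (Suc n) phi F)" for k phi
  have box_hom: "boxhom k (Suc n) phi" if "phi \<in> cells (openbox (Suc n) n False) k" for k phi
    using that by (simp add: openbox_cells)
  have box_act: "act (openbox (Suc n) n False) m k g phi \<in> cells (openbox (Suc n) n False) m"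
    if g: "boxhom m k g" and phi: "phi \<in> cells (openbox (Suc n) n False) k" for m k g phi
  proof -
    have "boxhom m (Suc n) (restrict (phi \<circ> g) (bdom m))" using bh_comp[OF g box_hom[OF phi]] .
    moreover obtain j e where "j < Suc n" "(j, e) \<noteq> (n, False)" "\<And>x. length x = k \<Longrightarrow> phi x ! j = e"
      using phi unfolding openbox_cells by blast
    moreover have "act (openbox (Suc n) n False) m k g phi = restrict (phi \<circ> g) (bdom m)"
      by (simp add: openbox_def)
    ultimately show ?thesis using boxhom_length[OF g] unfolding openbox_cells
      by (intro conjI exI[of _ j] exI[of _ e]) auto
  qed
  have "cmap (openbox (Suc n) n False) E u0"
    unfolding cmap_def
  proof (intro conjI allI impI; (elim conjE)?)
    fix k phi assume "phi \<in> cells (openbox (Suc n) n False) k"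
    then show "u0 k phi \<in> cells E k" using u0 L_cell by blast
  next
    fix m k g phi assume g: "boxhom m k g" and phi: "phi \<in> cells (openbox (Suc n) n False) k"
    have "act X m k g (act X k (Suc n) phi F) = act X m (Suc n) (act (openbox (Suc n) n False) m k g phi) F"
      using cubical_set_comp[OF X g box_hom[OF phi] F] by (simp add: openbox_def)
    then have "(m, act X m (Suc n) (act (openbox (Suc n) n False) m k g phi) F, act E m k g (u0 k phi)) \<in> L"
      using L_act[OF g u0[OF phi]] by simp
    then show "u0 m (act (openbox (Suc n) n False) m k g phi) = act E m k g (u0 k phi)"
      using u0[OF box_act[OF g phi]] L_fun by blast
  qed
  moreover have "cmap (cube (Suc n)) B v0"
    unfolding cmap_def
  proof (intro conjI allI impI; (elim conjE)?)
    fix k phi assume "phi \<in> cells (cube (Suc n)) k"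
    then show "v0 k phi \<in> cells B k"
      using v cubical_set_act[OF X _ F] unfolding v0_def cmap_def cube_def by auto
  next
    fix m k g phi assume g: "boxhom m k g" and "phi \<in> cells (cube (Suc n)) k"
    then have phi: "boxhom k (Suc n) phi" by (simp add: cube_def)
    have "v m (act X m k g (act X k (Suc n) phi F)) = act B m k g (v k (act X k (Suc n) phi F))"
      using v g cubical_set_act[OF X phi F] unfolding cmap_def by blast
    then show "v0 m (act (cube (Suc n)) m k g phi) = act B m k g (v0 k phi)"
      using cubical_set_comp[OF X g phi F] by (simp add: v0_def cube_def)
  qed
  moreover have "p k (u0 k phi) = v0 k phi" if "phi \<in> cells (openbox (Suc n) n False) k" for k phi
    using u0[OF that] L_cell v0_def by metis
  moreover have "llp (openbox (Suc n) n False) (cube (Suc n)) (\<lambda>_ x. x) E B p"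
    using kan unfolding kan_fibration_def by blast
  ultimately obtain h where h: "cmap (cube (Suc n)) E h"
    and hu: "\<And>k phi. phi \<in> cells (openbox (Suc n) n False) k \<Longrightarrow> h k phi = u0 k phi"
    and hp: "\<And>k phi. phi \<in> cells (cube (Suc n)) k \<Longrightarrow> p k (h k phi) = v0 k phi"
    unfolding llp_def by blast
  have hE: "h k phi \<in> cells E k" if "boxhom k (Suc n) phi" for k phi
    using h that unfolding cmap_def cube_def by auto
  have hact: "h m (restrict (phi \<circ> g) (bdom m)) = act E m k g (h k phi)"
    if "boxhom m k g" "boxhom k (Suc n) phi" for m k g phi
    using h that unfolding cmap_def cube_def by auto

  define N where "N = {(k, act X k (Suc n) phi F, h k phi) | k phi. boxhom k (Suc n) phi}"
  have NY: "(k, act X k (Suc n) phi F, h k phi) \<in> L"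
    if "boxhom k (Suc n) phi" "Y k (act X k (Suc n) phi F)" for k phi
    using that box_iff u0 hu by metis
  have in_N: "(k, act X k (Suc n) phi F, h k phi) \<in> N" if "boxhom k (Suc n) phi" for k phi
    using that N_def by blast
  have "partial_lift X E p v fil (L \<union> N)"
    unfolding partial_lift_def
  proof (intro conjI allI impI; (elim conjE)?)
    fix k x e assume xe: "(k, x, e) \<in> L \<union> N"
    have *: "x \<in> cells X k \<and> e \<in> cells E k \<and> p k e = v k x \<and> (\<exists>e'. (Suc k, fil k x, e') \<in> L \<union> N)"
    proof (cases "(k, x, e) \<in> L")
      case True
      then show ?thesis using L_cell Y_fil unfolding Y_def by blast
    next
      case False
      then obtain phi where phi: "boxhom k (Suc n) phi" "x = act X k (Suc n) phi F" "e = h k phi"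
        using xe N_def by auto
      have "\<exists>e'. (Suc k, fil k x, e') \<in> L \<union> N"
      proof (cases "Y k x")
        case True then show ?thesis using Y_fil unfolding Y_def by blast
      next
        case nY: False
        then have "phi \<notin> cells (openbox (Suc n) n False) k" using box_iff phi by blast
        from not_box[OF phi(1) this] show ?thesis
        proof (elim disjE exE conjE)
          assume nc: "nconst phi k (Suc n)"
          \<comment> \<open>The filling of a cube of \<open>F\<close> must not leave the cubes of
            \<open>F\<close>: the iterated filler of \<open>f\<close> is a connection of
            \<open>F\<close>.\<close>
          have "fil k x = act X (Suc k) (Suc (Suc n)) (xid k phi) (fil (Suc n) F)"
            using fil_epi[OF phi(1) nc F] phi by simp
          also have "\<dots> = act X (Suc k) (Suc (Suc n)) (xid k phi)
              (act X (Suc (Suc n)) (Suc n) (bconn (Suc n) n) F)"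
            using fil_fil[OF f(1)] by (simp add: F_def)
          also have "\<dots> = act X (Suc k) (Suc n) (restrict (bconn (Suc n) n \<circ> xid k phi) (bdom (Suc k))) F"
            using cubical_set_comp[OF X boxhom_xid[OF phi(1)] bh_conn_max[of n "Suc n"] F] by simp
          finally show ?thesis
            using in_N[OF bh_comp[OF boxhom_xid[OF phi(1)] bh_conn_max[of n "Suc n"]]] by auto
        next
          fix psi assume psi: "boxhom k n psi" "nconst psi k n" "phi = restrict (bface n n False \<circ> psi) (bdom k)"
          then have "x = act X k n psi f" using act_face0 phi by metis
          then have "fil k x = act X (Suc k) (Suc n) (xid k psi) F"
            using fil_epi[OF psi(1,2) f(1)] by (simp add: F_def)
          then show ?thesis using in_N[OF boxhom_xid[OF psi(1)]] by auto
        qed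
      qed
      then show ?thesis using phi cubical_set_act[OF X phi(1) F] hE[OF phi(1)] hp[of phi k]
        by (simp add: cube_def v0_def)
    qed
    show "x \<in> cells X k" "e \<in> cells E k" "p k e = v k x" "\<exists>e'. (Suc k, fil k x, e') \<in> L \<union> N"
      using * by blast+
  next
    fix m k g x e assume g: "boxhom m k g" and xe: "(k, x, e) \<in> L \<union> N"
    show "(m, act X m k g x, act E m k g e) \<in> L \<union> N"
    proof (cases "(k, x, e) \<in> L")
      case True then show ?thesis using L_act[OF g] by blast
    next
      case False
      then obtain phi where phi: "boxhom k (Suc n) phi" "x = act X k (Suc n) phi F" "e = h k phi"
        using xe N_def by auto
      then show ?thesis
        using in_N[OF bh_comp[OF g phi(1)]] cubical_set_comp[OF X g phi(1) F] hact[OF g phi(1)] by simp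
    qed
  next
    fix k x e e' assume "(k, x, e) \<in> L \<union> N" "(k, x, e') \<in> L \<union> N"
    then consider "(k, x, e) \<in> L" "(k, x, e') \<in> L" | "Y k x" "(k, x, e) \<in> L \<union> N" "(k, x, e') \<in> L \<union> N"
      | "\<not> Y k x" "(k, x, e) \<in> N" "(k, x, e') \<in> N"
      unfolding Y_def by blast
    then show "e = e'"
    proof cases
      case 1 then show ?thesis using L_fun by blast
    next
      case 2
      have "(k, x, d) \<in> L" if "(k, x, d) \<in> L \<union> N" for d
        using that NY 2(1) unfolding N_def by blast
      then show ?thesis using 2 L_fun by blast
    next
      case 3
      then obtain phi psi where "boxhom k (Suc n) phi" "x = act X k (Suc n) phi F" "e = h k phi"
        "boxhom k (Suc n) psi" "x = act X k (Suc n) psi F" "e' = h k psi" unfolding N_def by blast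
      then show ?thesis using inj[of k phi psi] 3 by metis
    qed
  qed
  moreover have "L \<subset> L \<union> N"
  proof -
    have "act X (Suc n) (Suc n) (restrict id (bdom (Suc n))) F = F" using cubical_set_id[OF X F] .
    then have "\<exists>e. (Suc n, F, e) \<in> N" using in_N[OF bh_id[of "Suc n"]] by auto
    then show ?thesis using FY unfolding Y_def by blast
  qed
  ultimately show ?thesis by blast
qed

text \<open>Zorn's lemma gives a maximal partial lift above the given one, and
  \<open>extend_partial_lift\<close> shows that its domain is all of \<open>X\<close>.\<close>

theorem lift_extends:
  fixes E :: "'e cset" and B :: "'b cset" and p :: "nat \<Rightarrow> 'e \<Rightarrow> 'b" and v :: "nat \<Rightarrow> 'a \<Rightarrow> 'b"
  assumes kan: "kan_fibration E B p" and v: "cmap X B v"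
    and A: "\<And>n x. x \<in> A n \<Longrightarrow> x \<in> cells X n" "\<And>n x. x \<in> A n \<Longrightarrow> fil n x \<in> A (Suc n)"
      "\<And>m n phi x. boxhom m n phi \<Longrightarrow> x \<in> A n \<Longrightarrow> act X m n phi x \<in> A m"
    and u: "\<And>n x. x \<in> A n \<Longrightarrow> u n x \<in> cells E n" "\<And>n x. x \<in> A n \<Longrightarrow> p n (u n x) = v n x"
      "\<And>m n phi x. boxhom m n phi \<Longrightarrow> x \<in> A n \<Longrightarrow> u m (act X m n phi x) = act E m n phi (u n x)"
  shows "\<exists>h. cmap X E h \<and> (\<forall>n. \<forall>x\<in>A n. h n x = u n x) \<and> (\<forall>n. \<forall>x\<in>cells X n. p n (h n x) = v n x)"
proof -
  define L0 where "L0 = {(n, x, u n x) | n x. x \<in> A n}"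
  have L0: "partial_lift X E p v fil L0"
    unfolding partial_lift_def L0_def using A u by auto
  define LL where "LL = {L. L0 \<subseteq> L \<and> partial_lift X E p v fil L}"
  have "\<exists>M\<in>LL. \<forall>L\<in>LL. M \<subseteq> L \<longrightarrow> L = M"
  proof (rule subset_Zorn_nonempty)
    show "LL \<noteq> {}" using L0 LL_def by auto
    fix C assume C: "C \<noteq> {}" "subset.chain LL C"
    have CL: "L0 \<subseteq> L" "partial_lift X E p v fil L" if "L \<in> C" for L
      using C(2) that unfolding subset.chain_def LL_def by auto
    have dir: "\<exists>L\<in>C. a \<in> L \<and> b \<in> L" if "a \<in> \<Union> C" "b \<in> \<Union> C" for a b
    proof -
      from that obtain K L where "K \<in> C" "a \<in> K" "L \<in> C" "b \<in> L" by blast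
      moreover have "K \<subseteq> L \<or> L \<subseteq> K" using C(2) calculation(1,3) unfolding subset_chain_def by blast
      ultimately show ?thesis by blast
    qed
    have "partial_lift X E p v fil (\<Union> C)"
      unfolding partial_lift_def
    proof (intro conjI allI impI; (elim conjE)?)
      fix n x e assume "(n, x, e) \<in> \<Union> C"
      then obtain L where "L \<in> C" "(n, x, e) \<in> L" by blast
      then show "x \<in> cells X n" "e \<in> cells E n" "p n e = v n x" "\<exists>e'. (Suc n, fil n x, e') \<in> \<Union> C"
        using CL(2)[of L] unfolding partial_lift_def by blast+
    next
      fix m n phi x e assume "boxhom m n phi" "(n, x, e) \<in> \<Union> C"
      then show "(m, act X m n phi x, act E m n phi e) \<in> \<Union> C"
        using CL(2) unfolding partial_lift_def by blast
    next
      fix n x e e' assume "(n, x, e) \<in> \<Union> C" "(n, x, e') \<in> \<Union> C"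
      then obtain L where "L \<in> C" "(n, x, e) \<in> L" "(n, x, e') \<in> L" using dir by blast
      then show "e = e'" using CL(2)[of L] unfolding partial_lift_def by blast
    qed
    then show "\<Union> C \<in> LL" using CL(1) C(1) unfolding LL_def by blast
  qed
  then obtain M where M: "L0 \<subseteq> M" "partial_lift X E p v fil M"
    and max: "\<And>L. partial_lift X E p v fil L \<Longrightarrow> M \<subseteq> L \<Longrightarrow> L = M"
    unfolding LL_def by auto
  have AM: "(n, x, u n x) \<in> M" if "x \<in> A n" for n x using M(1) that unfolding L0_def by blast
  have total: "\<exists>e. (n, x, e) \<in> M" if "x \<in> cells X n" for n x
    using extend_partial_lift[OF kan v M(2) _ that] AM max by blast
  define h where "h n x = (THE e. (n, x, e) \<in> M)" for n x
  have M_fun: "e = e'" if "(n, x, e) \<in> M" "(n, x, e') \<in> M" for n x e e'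
    using M(2) that unfolding partial_lift_def by blast
  have h: "(n, x, h n x) \<in> M" if "x \<in> cells X n" for n x
    using total[OF that] M_fun unfolding h_def by (metis theI)
  have "cmap X E h"
    unfolding cmap_def
  proof (intro conjI allI impI; (elim conjE)?)
    fix n x assume "x \<in> cells X n"
    then show "h n x \<in> cells E n" using h M(2) unfolding partial_lift_def by blast
  next
    fix m n phi x assume phi: "boxhom m n phi" and x: "x \<in> cells X n"
    have "(m, act X m n phi x, act E m n phi (h n x)) \<in> M"
      using h[OF x] phi M(2) unfolding partial_lift_def by blast
    then show "h m (act X m n phi x) = act E m n phi (h n x)"
      using h[OF cubical_set_act[OF X phi x]] M_fun by blast
  qed
  moreover have "h n x = u n x" if "x \<in> A n" for n x
    using M_fun h[OF A(1)[OF that]] AM[OF that] by blast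
  moreover have "p n (h n x) = v n x" if "x \<in> cells X n" for n x
    using h[OF that] M(2) unfolding partial_lift_def by blast
  ultimately show ?thesis by blast
qed

end

section \<open>Collapsing an end of the interval\<close>

text \<open>The transition into stage \<open>k\<close> collapses the last edge of the interval if \<open>k\<close> is even and the
  first edge if \<open>k\<close> is odd. In terms of thresholds, the collapse forces the bit \<open>cbit k\<close> to be
  \<open>odd k\<close>. The bit \<open>hbit k\<close> is a different one whose edge has the same orientation as the collapsed
  edge; in the extra coordinate of \<open>mix\<close> it triggers the collapse.\<close>

definition rho :: "nat \<Rightarrow> nat \<Rightarrow> nat" where
  "rho k z = (if even k then min z (k - 1) else max z 1)"

definition cbit :: "nat \<Rightarrow> nat" where
  "cbit k = (if even k then k else 1)"

definition hbit :: "nat \<Rightarrow> nat" where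
  "hbit k = (if even k then 1 else k)"

definition coll :: "nat \<Rightarrow> nat set \<Rightarrow> nat list \<Rightarrow> nat list" where
  "coll k T x = map (\<lambda>i. if i \<in> T then rho k (x ! i) else x ! i) [0..<length x]"

definition setb :: "nat set \<Rightarrow> bool \<Rightarrow> bool list \<Rightarrow> bool list" where
  "setb T b x = map (\<lambda>i. if i \<in> T then b else x ! i) [0..<length x]"

text \<open>\<open>single k n a f\<close>: along the coordinates from \<open>a\<close> on, collapsing step by step changes the
  value of \<open>f\<close> at most once.\<close>

definition single :: "nat \<Rightarrow> nat \<Rightarrow> nat \<Rightarrow> (nat list \<Rightarrow> 'v) \<Rightarrow> bool" where
  "single k n a f \<longleftrightarrow> (\<forall>x\<in>jdom k n. \<forall>T\<subseteq>{a..}. f (coll k T x) = f x \<or> f (coll k T x) = f (coll k {a..} x))"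

definition start :: "nat \<Rightarrow> nat \<Rightarrow> (nat list \<Rightarrow> 'v) \<Rightarrow> nat" where
  "start k n f = (LEAST a. single k n a f)"

definition bad :: "nat \<Rightarrow> nat \<Rightarrow> (nat list \<Rightarrow> 'v) \<Rightarrow> nat set" where
  "bad k n f = {j. j < n \<and> (\<exists>x\<in>jdom k n. f (coll k {j} x) \<noteq> f x)}"

text \<open>The start \<open>a\<close> is a parameter because a face of a filler can be a
  \<open>mix\<close> whose start is not that of the corresponding face of the cube.\<close>

definition mix :: "nat \<Rightarrow> nat \<Rightarrow> nat \<Rightarrow> (nat list \<Rightarrow> 'v) \<Rightarrow> nat list \<Rightarrow> 'v" where
  "mix k n a f = restrict (\<lambda>x. if hbit k \<le> last x then f (coll k {a..} (butlast x)) else f (butlast x)) (jdom k (Suc n))"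

definition fill :: "nat \<Rightarrow> nat \<Rightarrow> (nat list \<Rightarrow> 'v) \<Rightarrow> nat list \<Rightarrow> 'v" where
  "fill k n f = mix k n (start k n f) f"

text \<open>The dimension is the last component because a face at a coordinate that is not bad may
  have the same two counts as the cube itself.\<close>

definition cmeas :: "nat \<Rightarrow> nat \<Rightarrow> (nat list \<Rightarrow> 'v) \<Rightarrow> nat \<times> nat \<times> nat" where
  "cmeas k n f = (card (bad k n f), card (bad k n f \<inter> {..<start k n f}), n)"

abbreviation lex3 :: "((nat \<times> nat \<times> nat) \<times> (nat \<times> nat \<times> nat)) set" where
  "lex3 \<equiv> less_than <*lex*> (less_than <*lex*> less_than)"

section \<open>Elementary properties of collapses\<close>

lemma rho_le: "2 \<le> k \<Longrightarrow> z \<le> k \<Longrightarrow> rho k z \<le> k"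
  by (auto simp: rho_def)

lemma rho_rho [simp]: "rho k (rho k z) = rho k z"
  by (auto simp: rho_def)

lemma bit_rho: "2 \<le> k \<Longrightarrow> 1 \<le> t \<Longrightarrow> t \<le> k \<Longrightarrow> z \<le> k \<Longrightarrow>
    t \<le> rho k z \<longleftrightarrow> (if t = cbit k then odd k else t \<le> z)"
  by (auto simp: rho_def cbit_def)

text \<open>The trigger is placed at a bit other than the collapsed one so that the new coordinate
  of a filler is never bad.\<close>

lemma hbit_rho: "2 \<le> k \<Longrightarrow> hbit k \<le> rho k z \<longleftrightarrow> hbit k \<le> z"
  by (auto simp: rho_def hbit_def)

lemma hbit_bounds: "2 \<le> k \<Longrightarrow> 1 \<le> hbit k" "2 \<le> k \<Longrightarrow> hbit k \<le> k"
  by (auto simp: hbit_def)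

lemma length_coll [simp]: "length (coll k T x) = length x"
  by (simp add: coll_def)

lemma nth_coll [simp]: "i < length x \<Longrightarrow> coll k T x ! i = (if i \<in> T then rho k (x ! i) else x ! i)"
  by (simp add: coll_def)

lemma coll_jdom: "2 \<le> k \<Longrightarrow> x \<in> jdom k n \<Longrightarrow> coll k T x \<in> jdom k n"
  by (auto simp: jdom_iff rho_le)

lemma coll_coll: "coll k T (coll k U x) = coll k (T \<union> U) x"
  by (rule nth_equalityI) auto

lemma coll_cong: "(\<And>i. i < length x \<Longrightarrow> i \<in> T \<longleftrightarrow> i \<in> U) \<Longrightarrow> coll k T x = coll k U x"
  by (rule nth_equalityI) auto

lemma coll_empty [simp]: "coll k {} x = x"
  by (rule nth_equalityI) auto

lemma coll_snoc: "coll k T (x @ [y]) = coll k T x @ [if length x \<in> T then rho k y else y]"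
  by (rule nth_equalityI) (auto simp: nth_append less_Suc_eq)

lemma length_setb [simp]: "length (setb T b x) = length x"
  by (simp add: setb_def)

lemma nth_setb [simp]: "i < length x \<Longrightarrow> setb T b x ! i = (if i \<in> T then b else x ! i)"
  by (simp add: setb_def)

lemma bits_coll:
  assumes "2 \<le> k" "x \<in> jdom k n" "1 \<le> t" "t \<le> k"
  shows "bits t (coll k T x) = (if t = cbit k then setb T (odd k) (bits t x) else bits t x)"
  using assms by (intro nth_equalityI) (auto simp: jdom_iff bit_rho)

section \<open>The final segment and the bad coordinates\<close>

lemma singleD: "single k n a f \<Longrightarrow> x \<in> jdom k n \<Longrightarrow> T \<subseteq> {a..} \<Longrightarrow>
    f (coll k T x) = f x \<or> f (coll k T x) = f (coll k {a..} x)"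
  by (simp add: single_def)

text \<open>If collapsing \<open>T\<close> already gives the value of the long segment, then
  collapsing the rest of the short segment must lead to one of two values, and these
  coincide.\<close>

lemma single_mono:
  assumes k: "2 \<le> k" and s: "single k n a f" and le: "a \<le> a'"
  shows "single k n a' f"
  unfolding single_def
proof (intro ballI allI impI)
  fix x T assume x: "x \<in> jdom k n" and T: "T \<subseteq> {a'..}"
  let ?y = "coll k T x"
  have Ta: "T \<subseteq> {a..}" using T le by auto
  have "f ?y = f x \<or> f ?y = f (coll k {a..} x)" using singleD[OF s x Ta] .
  moreover have "f ?y = f (coll k {a'..} x)" if "f ?y = f (coll k {a..} x)"
  proof -
    have "coll k {a'..} ?y = coll k {a'..} x" "coll k {a..} ?y = coll k {a..} x"
      unfolding coll_coll using T le by (auto intro!: arg_cong[where f = "\<lambda>U. coll k U x"])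
    then show ?thesis using singleD[OF s coll_jdom[OF k x], of "{a'..}" T] le that by auto
  qed
  ultimately show "f ?y = f x \<or> f ?y = f (coll k {a'..} x)" by blast
qed

lemma single_dim: "single k n n f"
proof -
  have "coll k T x = x" if "x \<in> jdom k n" "T \<subseteq> {n..}" for x T
  proof -
    have "coll k T x = coll k {} x" using that by (intro coll_cong) (auto simp: jdom_iff)
    then show ?thesis by simp
  qed
  then show ?thesis by (simp add: single_def)
qed

lemma single_start: "single k n (start k n f) f"
  unfolding start_def by (rule LeastI, rule single_dim)

lemma start_le: "single k n a f \<Longrightarrow> start k n f \<le> a"
  unfolding start_def by (rule Least_le)

lemma bad_less: "j \<in> bad k n f \<Longrightarrow> j < n"
  by (simp add: bad_def)

lemma finite_bad [simp]: "finite (bad k n f)"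
  by (rule finite_subset[of _ "{..<n}"]) (auto dest: bad_less)

lemma coll_good:
  assumes k: "2 \<le> k" and x: "x \<in> jdom k n" and T: "T \<inter> bad k n f = {}"
  shows "f (coll k T x) = f x"
proof -
  have "f (coll k F x) = f x" if "finite F" "F \<subseteq> T \<inter> {..<n}" for F
    using that
  proof (induction F)
    case (insert j F)
    have "f (coll k {j} (coll k F x)) = f (coll k F x)"
      using insert.prems T coll_jdom[OF k x] unfolding bad_def by blast
    then show ?case using insert by (simp add: coll_coll)
  qed simp
  from this[of "T \<inter> {..<n}"] show ?thesis
    using coll_cong[of x T "T \<inter> {..<n}" k] x by (simp add: jdom_iff)
qed

lemma coll_good_diff:
  assumes k: "2 \<le> k" and x: "x \<in> jdom k n" and TU: "(T - U) \<inter> bad k n f = {}" "(U - T) \<inter> bad k n f = {}"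
  shows "f (coll k T x) = f (coll k U x)"
proof -
  have "f (coll k (T \<inter> U) x) = f (coll k (T - U) (coll k (T \<inter> U) x))"
    "f (coll k (T \<inter> U) x) = f (coll k (U - T) (coll k (T \<inter> U) x))"
    using coll_good[OF k coll_jdom[OF k x]] TU by metis+
  moreover have "T - U \<union> T \<inter> U = T" "U - T \<union> T \<inter> U = U" by auto
  ultimately show ?thesis by (simp add: coll_coll)
qed

text \<open>From the last bad coordinate \<open>c\<close> on, only \<open>c\<close> can affect the
  value, so the condition holds there. The final segment therefore contains a bad coordinate, and
  collapsing it reduces their number.\<close>

lemma bad_ge_start:
  assumes k: "2 \<le> k" and ne: "bad k n f \<noteq> {}"
  shows "\<exists>c\<in>bad k n f. start k n f \<le> c"
proof -
  define c where "c = Max (bad k n f)"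
  have c: "c \<in> bad k n f" using ne by (simp add: c_def)
  have max: "j \<le> c" if "j \<in> bad k n f" for j using that by (simp add: c_def)
  have "single k n c f"
    unfolding single_def
  proof (intro ballI allI impI)
    fix x T assume x: "x \<in> jdom k n" and T: "T \<subseteq> {c..}"
    show "f (coll k T x) = f x \<or> f (coll k T x) = f (coll k {c..} x)"
    proof (cases "c \<in> T")
      case True
      have "(T - {c..}) \<inter> bad k n f = {}" "({c..} - T) \<inter> bad k n f = {}"
        using T True max by fastforce+
      then show ?thesis using coll_good_diff[OF k x] by blast
    next
      case False
      have "T \<inter> bad k n f = {}" using T False max by fastforce
      then show ?thesis using coll_good[OF k x] by blast
    qed
  qed
  then show ?thesis using start_le c by blast
qed

section \<open>The filling of a cube\<close>

lemma snoc_jdom: "x @ [y] \<in> jdom k (Suc n) \<longleftrightarrow> x \<in> jdom k n \<and> y \<le> k"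
  by (auto simp: jdom_def)

lemma jdom_SucE:
  assumes "x \<in> jdom k (Suc n)"
  obtains x' y where "x = x' @ [y]" "x' \<in> jdom k n" "y \<le> k"
  using assms by (cases x rule: rev_cases) (auto simp: snoc_jdom jdom_def)

lemma mix_snoc: "x \<in> jdom k n \<Longrightarrow> y \<le> k \<Longrightarrow>
    mix k n a f (x @ [y]) = (if hbit k \<le> y then f (coll k {a..} x) else f x)"
  by (simp add: mix_def snoc_jdom)

lemma mix_extensional [simp]: "mix k n a f \<in> extensional (jdom k (Suc n))"
  unfolding mix_def by (rule restrict_extensional)

lemma ext_snocI:
  assumes "f \<in> extensional (jdom k (Suc n))" "g \<in> extensional (jdom k (Suc n))"
    and "\<And>x y. x \<in> jdom k n \<Longrightarrow> y \<le> k \<Longrightarrow> f (x @ [y]) = g (x @ [y])"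
  shows "f = g"
  using assms by (intro extensionalityI[OF assms(1,2)]) (metis jdom_SucE)

lemma mix_coll_snoc:
  assumes "2 \<le> k" "x \<in> jdom k n" "y \<le> k"
  shows "mix k n a f (coll k T (x @ [y])) = (if hbit k \<le> y then f (coll k (T \<union> {a..}) x) else f (coll k T x))"
  using assms by (simp add: coll_snoc mix_snoc coll_jdom rho_le hbit_rho coll_coll Un_commute)

text \<open>Collapsing the last coordinate does not move it across \<open>hbit k\<close>. A change
  in any other coordinate is a change of \<open>f\<close>, at \<open>x\<close> or at the collapsed
  point.\<close>

lemma bad_mix:
  assumes k: "2 \<le> k"
  shows "bad k (Suc n) (mix k n a f) \<subseteq> bad k n f"
proof
  fix j assume "j \<in> bad k (Suc n) (mix k n a f)"
  then obtain z where z: "j < Suc n" "z \<in> jdom k (Suc n)" "mix k n a f (coll k {j} z) \<noteq> mix k n a f z"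
    by (auto simp: bad_def)
  obtain x y where xy: "z = x @ [y]" "x \<in> jdom k n" "y \<le> k" using jdom_SucE[OF z(2)] by blast
  have "\<exists>w\<in>jdom k n. f (coll k {j} w) \<noteq> f w"
  proof (cases "hbit k \<le> y")
    case True
    then have "f (coll k {j} (coll k {a..} x)) \<noteq> f (coll k {a..} x)"
      using z(3) xy k by (simp add: mix_coll_snoc mix_snoc coll_coll)
    then show ?thesis using coll_jdom[OF k xy(2)] by blast
  next
    case False
    then have "f (coll k {j} x) \<noteq> f x"
      using z(3) xy k by (simp add: mix_coll_snoc mix_snoc)
    then show ?thesis using xy by blast
  qed
  moreover have "j < n"
  proof (rule ccontr)
    assume "\<not> j < n"
    then have "coll k {j} w = w" if "w \<in> jdom k n" for w
      using that coll_cong[of w "{j}" "{}" k] by (auto simp: jdom_iff)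
    then show False using calculation by auto
  qed
  ultimately show "j \<in> bad k n f" by (simp add: bad_def)
qed

lemma single_mix:
  assumes k: "2 \<le> k" and s: "single k n a' f" and le: "a' \<le> a"
  shows "single k (Suc n) a' (mix k n a f)"
  unfolding single_def
proof (intro ballI allI impI)
  fix z T assume z: "z \<in> jdom k (Suc n)" and T: "T \<subseteq> {a'..}"
  obtain x y where xy: "z = x @ [y]" "x \<in> jdom k n" "y \<le> k" using jdom_SucE[OF z] by blast
  have U: "T \<union> {a..} \<subseteq> {a'..}" "{a'..} \<union> {a..} = {a'..}" using T le by auto
  show "mix k n a f (coll k T z) = mix k n a f z \<or> mix k n a f (coll k T z) = mix k n a f (coll k {a'..} z)"
  proof (cases "hbit k \<le> y")
    case False
    then show ?thesis using singleD[OF s xy(2) T] xy k by (simp add: mix_coll_snoc mix_snoc)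
  next
    case True
    have "f (coll k T (coll k {a..} x)) = f (coll k {a..} x) \<or>
        f (coll k T (coll k {a..} x)) = f (coll k {a'..} (coll k {a..} x))"
      using singleD[OF s coll_jdom[OF k xy(2)] T] .
    then show ?thesis using True xy k U by (simp add: mix_coll_snoc mix_snoc coll_coll)
  qed
qed

lemma single_of_mix:
  assumes k: "2 \<le> k" and s: "single k (Suc n) a' (mix k n a f)"
  shows "single k n a' f"
  unfolding single_def
proof (intro ballI allI impI)
  fix x T assume x: "x \<in> jdom k n" and T: "T \<subseteq> {a'..}"
  have h: "\<not> hbit k \<le> 0" using hbit_bounds[OF k] by simp
  have "x @ [0] \<in> jdom k (Suc n)" using x by (simp add: snoc_jdom)
  from singleD[OF s this T]
  show "f (coll k T x) = f x \<or> f (coll k T x) = f (coll k {a'..} x)"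
    using x k h by (simp add: mix_coll_snoc mix_snoc)
qed

text \<open>Filling a filler hence collapses the same segment again. The collapse takes place as
  soon as one of the two last coordinates reaches \<open>hbit k\<close>, that is, as soon as their
  maximum does; this yields \<open>fil_fil\<close>.\<close>

lemma start_fill:
  assumes "2 \<le> k"
  shows "start k (Suc n) (fill k n f) = start k n f"
  unfolding fill_def
  using start_le[OF single_mix[OF assms single_start order.refl]]
    start_le[OF single_of_mix[OF assms single_start]] by (rule antisym)

lemma coll_update: "i < length x \<Longrightarrow> coll k {i} x = x[i := rho k (x ! i)]"
  by (rule nth_equalityI) (auto simp: nth_list_update)

lemma rho_iarr: "2 \<le> k \<Longrightarrow> z \<le> k \<Longrightarrow> if e then iarr e k z (rho k z) else iarr e k (rho k z) z"
  by (cases "z = 0"; cases "z = k") (auto simp: rho_def iarr_def min_def max_def)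

lemma iarr_rho: "2 \<le> k \<Longrightarrow> iarr e k a b \<Longrightarrow> iarr e k (rho k a) (rho k b)"
  by (auto simp: rho_def iarr_def min_def max_def)

lemma coll_jarr:
  assumes k: "2 \<le> k" and a: "jarr e k x y"
  shows "jarr e k (coll k T x) (coll k T y)"
  using a
proof (cases rule: jarr_cases)
  case 1 then show ?thesis by (simp add: jarr_def)
next
  case (2 j)
  have len: "length x = length y" using a by (simp add: jarr_def)
  have "x ! i = y ! i" if "i \<noteq> j" for i using 2(2) that by (metis nth_list_update_neq)
  then show ?thesis unfolding jarr_def using len 2 iarr_rho[OF k 2(4)]
    by (auto intro!: exI[of _ j])
qed

text \<open>Collapse the coordinates from \<open>a\<close> on one by one. By \<open>single\<close>
  the first step that changes the value reaches the final value at once, and this step is an arrow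
  of the power of the interval.\<close>

lemma single_arrow:
  assumes k: "2 \<le> k" and G: "refl G" and f: "f \<in> cells (NJ k e G) n" and s: "single k n a f" and x: "x \<in> jdom k n"
  shows "if e then (f x, f (coll k {a..} x)) \<in> G else (f (coll k {a..} x), f x) \<in> G"
proof (cases "f x = f (coll k {a..} x)")
  case True
  then show ?thesis using G by (simp add: refl_onD)
next
  case False
  define P where "P i \<longleftrightarrow> f (coll k {a..<i} x) = f x" for i
  have "coll k {a..<n} x = coll k {a..} x" using x by (intro coll_cong) (auto simp: jdom_iff)
  then have nP: "\<not> P n" using False by (auto simp: P_def)
  have P0: "P 0" by (simp add: P_def)
  obtain i where i: "i < n" "P i" "\<not> P (Suc i)"
    using ex_least_nat_less[of "\<lambda>i. \<not> P i" n] nP P0 by auto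
  define w where "w = coll k {a..<i} x"
  have w: "w \<in> jdom k n" using coll_jdom[OF k x] by (simp add: w_def)
  have ai: "a \<le> i"
  proof (rule ccontr)
    assume "\<not> a \<le> i"
    then have "{a..<Suc i} = {}" by auto
    then show False using i(3) by (simp add: P_def)
  qed
  have "{a..<Suc i} = {i} \<union> {a..<i}" using ai by auto
  then have wi: "coll k {a..<Suc i} x = coll k {i} w" by (simp add: w_def coll_coll)
  have fw: "f w = f x" using i by (simp add: P_def w_def)
  have "f (coll k {i} w) = f x \<or> f (coll k {i} w) = f (coll k {a..} x)"
    using singleD[OF s x, of "{a..<Suc i}"] unfolding wi by (meson atLeastLessThan_iff atLeast_iff subsetI)
  then have fi: "f (coll k {i} w) = f (coll k {a..} x)" using i(3) wi by (auto simp: P_def)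
  have len: "i < length w" and wk: "w ! i \<le> k" using w i by (auto simp: jdom_iff)
  have arr: "if e then jarr e k w (coll k {i} w) else jarr e k (coll k {i} w) w"
    unfolding coll_update[OF len] using rho_iarr[OF k wk, of e] len by (auto intro: jarr_updateI jarr_updateI')
  have "coll k {i} w \<in> jdom k n" using coll_jdom[OF k w] .
  then have "if e then (f w, f (coll k {i} w)) \<in> G else (f (coll k {i} w), f w) \<in> G"
    using arr f w unfolding NJ_cells by (cases e) auto
  then show ?thesis unfolding fw fi .
qed

lemma mix_cell:
  assumes k: "2 \<le> k" and G: "refl G" and f: "f \<in> cells (NJ k e G) n" and s: "single k n a f"
  shows "mix k n a f \<in> cells (NJ k e G) (Suc n)"
  unfolding NJ_cells
proof (intro conjI ballI impI)
  fix z z' assume z: "z \<in> jdom k (Suc n)" and z': "z' \<in> jdom k (Suc n)" and arr: "jarr e k z z'"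
  obtain x y where xy: "z = x @ [y]" "x \<in> jdom k n" "y \<le> k" using jdom_SucE[OF z] by blast
  obtain x' y' where xy': "z' = x' @ [y']" "x' \<in> jdom k n" "y' \<le> k" using jdom_SucE[OF z'] by blast
  have lx: "length x = n" "length x' = n" using xy xy' by (auto simp: jdom_iff)
  have fG: "(f u, f u') \<in> G" if "u \<in> jdom k n" "u' \<in> jdom k n" "jarr e k u u'" for u u'
    using f that unfolding NJ_cells by blast
  from arr have "(x = x' \<and> iarr e k y y') \<or> (jarr e k x x' \<and> y = y')"
  proof (cases rule: jarr_cases)
    case 1
    then show ?thesis using xy xy' by (auto simp: jarr_def)
  next
    case (2 j)
    show ?thesis
    proof (cases "j = n")
      case True
      then show ?thesis using 2 xy xy' lx by (auto simp: nth_append list_update_append)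
    next
      case False
      then have j: "j < n" using 2 xy lx by auto
      have "x' @ [y'] = x[j := x' ! j] @ [y]"
        using 2(2) xy xy' lx j by (simp add: nth_append list_update_append)
      then have "x' = x[j := x' ! j]" "y = y'" by simp_all
      moreover have "iarr e k (x ! j) (x' ! j)" using 2(4) xy xy' lx j by (simp add: nth_append)
      ultimately show ?thesis using jarr_updateI[of j x e k "x' ! j"] j lx by simp
    qed
  qed
  then show "(mix k n a f z, mix k n a f z') \<in> G"
  proof
    assume "jarr e k x x' \<and> y = y'"
    then show ?thesis using xy xy' fG[of x x']
        fG[of "coll k {a..} x" "coll k {a..} x'"] coll_jdom[OF k] coll_jarr[OF k]
      by (simp add: mix_snoc)
  next
    assume *: "x = x' \<and> iarr e k y y'"
    \<comment> \<open>Crossing \<open>hbit k\<close> upwards leads from an even to an odd vertex,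
      just as the collapse moves \<open>k\<close> to \<open>k - 1\<close> for even \<open>k\<close>
      and \<open>0\<close> to \<open>1\<close> for odd \<open>k\<close>.\<close>
    have parity: "odd (hbit k)" using k by (simp add: hbit_def)
    show ?thesis
    proof (cases "hbit k \<le> y \<longleftrightarrow> hbit k \<le> y'")
      case True
      then show ?thesis using xy xy' * G by (simp add: mix_snoc refl_onD)
    next
      case False
      then have "(y' = Suc y \<and> hbit k = Suc y \<and> even y = e) \<or> (y = Suc y' \<and> hbit k = y \<and> even y = e)"
        using * by (auto simp: iarr_def)
      then show ?thesis
        using single_arrow[OF k G f s xy(2)] xy xy' * parity by (cases e) (auto simp: mix_snoc)
    qed
  qed
qed simp

section \<open>Faces of the filling\<close>

definition ins :: "nat \<Rightarrow> nat \<Rightarrow> nat list \<Rightarrow> nat list" where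
  "ins i c x = take i x @ c # drop i x"

text \<open>The coface map on coordinate indices: coordinate \<open>j\<close> of face
  \<open>i\<close> is coordinate \<open>sk i j\<close> of the cube.\<close>

definition sk :: "nat \<Rightarrow> nat \<Rightarrow> nat" where
  "sk i j = (if j < i then j else Suc j)"

lemma inj_sk: "inj (sk i)"
  by (auto simp: inj_def sk_def split: if_splits)

lemma sk_neq: "sk i j \<noteq> i"
  by (simp add: sk_def)

lemma length_ins [simp]: "length (ins i c x) = Suc (length x)"
  by (simp add: ins_def)

lemma nth_ins: "i \<le> length x \<Longrightarrow> p \<le> length x \<Longrightarrow>
    ins i c x ! p = (if p < i then x ! p else if p = i then c else x ! (p - 1))"
  unfolding ins_def by (rule nth_insert)

lemma ins_jdom: "c \<le> k \<Longrightarrow> x \<in> jdom k n \<Longrightarrow> ins i c x \<in> jdom k (Suc n)"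
  by (auto simp: jdom_def ins_def dest: in_set_takeD in_set_dropD)

lemma ins_snoc: "i \<le> length x \<Longrightarrow> ins i c (x @ [y]) = ins i c x @ [y]"
  by (simp add: ins_def)

lemma coll_ins:
  assumes "i \<le> length x" "\<And>j. sk i j \<in> T \<longleftrightarrow> j \<in> U" "i \<notin> T"
  shows "coll k T (ins i c x) = ins i c (coll k U x)"
proof (rule nth_equalityI)
  fix p assume "p < length (coll k T (ins i c x))"
  then have p: "p \<le> length x" by simp
  consider "p < i" | "p = i" | j where "p = Suc j" "i \<le> j" by (metis Suc_lessE less_imp_Suc_add not_less_eq less_SucE less_antisym linorder_cases less_Suc_eq_le)
  then show "coll k T (ins i c x) ! p = ins i c (coll k U x) ! p"
  proof cases
    case 1 then show ?thesis using p assms assms(2)[of p] by (simp add: nth_ins sk_def)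
  next
    case 2 then show ?thesis using p assms by (simp add: nth_ins)
  next
    case (3 j) then show ?thesis using p assms assms(2)[of j] by (simp add: nth_ins sk_def)
  qed
qed (simp)

lemma NJ_face:
  assumes "i \<le> n"
  shows "act (NJ k e G) n (Suc n) (bface n i eps) f = restrict (\<lambda>x. f (ins i (if eps then k else 0) x)) (jdom k n)"
  unfolding NJ_act ins_def using jext_face[OF assms] by (intro restrict_ext) (simp only:)

text \<open>Here \<open>d\<close> is the face of \<open>f\<close> on which coordinate
  \<open>i\<close> has the value \<open>c\<close>.\<close>

context
  fixes k n i c :: nat and f d :: "nat list \<Rightarrow> 'v"
  assumes k: "2 \<le> k" and i: "i \<le> n" and c: "c \<le> k"
    and d: "\<And>x. x \<in> jdom k n \<Longrightarrow> d x = f (ins i c x)"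
begin

lemma bad_face: "sk i ` bad k n d \<subseteq> bad k (Suc n) f - {i}"
proof
  fix j' assume "j' \<in> sk i ` bad k n d"
  then obtain j x where j: "j' = sk i j" "j < n" "x \<in> jdom k n" "d (coll k {j} x) \<noteq> d x" by (auto simp: bad_def)
  have "coll k {sk i j} (ins i c x) = ins i c (coll k {j} x)"
    using i j(3) sk_neq[of i j] sk_neq[of i j, symmetric] inj_sk[of i] by (intro coll_ins) (auto simp: jdom_iff inj_def)
  then have "f (coll k {sk i j} (ins i c x)) \<noteq> f (ins i c x)"
    using j(4) d[OF j(3)] d[OF coll_jdom[OF k j(3)]] by simp
  moreover have "sk i j < Suc n" using j(2) by (simp add: sk_def)
  ultimately show "j' \<in> bad k (Suc n) f - {i}"
    using j(1) sk_neq[of i j] ins_jdom[OF c j(3), of i] unfolding bad_def by auto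
qed

lemma card_bad_face: "card (bad k n d) \<le> card (bad k (Suc n) f - {i})"
  using bad_face card_inj_on_le[of "sk i" "bad k n d" "bad k (Suc n) f - {i}"] inj_on_subset[OF inj_sk] by auto

lemma card_bad_face_less: "i \<in> bad k (Suc n) f \<Longrightarrow> card (bad k n d) < card (bad k (Suc n) f)"
  using card_bad_face card_Diff1_less[OF finite_bad, of i k "Suc n" f] by linarith

lemma card_bad_face_le: "card (bad k n d) \<le> card (bad k (Suc n) f)"
  using card_bad_face card_Diff1_le[of "bad k (Suc n) f" i] by linarith

context
  fixes a :: nat
  assumes good: "i \<notin> bad k (Suc n) f"
begin

text \<open>Since coordinate \<open>i\<close> is not bad, it makes no difference whether
  \<open>T\<close> contains it.\<close>

lemma coll_face:
  assumes x: "x \<in> jdom k n" and T: "\<And>j. sk i j \<in> T \<longleftrightarrow> j \<in> U"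
  shows "f (coll k T (ins i c x)) = d (coll k U x)"
proof -
  have "f (coll k T (ins i c x)) = f (coll k (T - {i}) (ins i c x))"
    using good by (intro coll_good_diff[OF k ins_jdom[OF c x]]) auto
  also have "coll k (T - {i}) (ins i c x) = ins i c (coll k U x)"
    using i x T sk_neq by (intro coll_ins) (auto simp: jdom_iff)
  finally show ?thesis using d[OF coll_jdom[OF k x]] by simp
qed

lemma single_face:
  assumes s: "single k (Suc n) a f"
  shows "single k n (if i < a then a - 1 else a) d"
  unfolding single_def
proof (intro ballI allI impI)
  fix x T assume x: "x \<in> jdom k n" and T: "T \<subseteq> {(if i < a then a - 1 else a)..}"
  have "sk i ` T \<subseteq> {a..}" using T by (fastforce simp: sk_def split: if_splits)
  from singleD[OF s ins_jdom[OF c x] this]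
  have "f (coll k (sk i ` T) (ins i c x)) = f (ins i c x) \<or>
      f (coll k (sk i ` T) (ins i c x)) = f (coll k {a..} (ins i c x))" .
  moreover have "f (coll k (sk i ` T) (ins i c x)) = d (coll k T x)"
    using inj_sk by (intro coll_face[OF x]) (auto simp: inj_def)
  moreover have "f (coll k {a..} (ins i c x)) = d (coll k {(if i < a then a - 1 else a)..} x)"
    by (intro coll_face[OF x]) (auto simp: sk_def)
  ultimately show "d (coll k T x) = d x \<or>
      d (coll k T x) = d (coll k {(if i < a then a - 1 else a)..} x)" using d[OF x] by simp
qed

lemma card_bad_below:
  "card (bad k n d \<inter> {..<(if i < a then a - 1 else a)}) \<le> card (bad k (Suc n) f \<inter> {..<a})"
proof (rule card_inj_on_le[of "sk i"])
  show "inj_on (sk i) (bad k n d \<inter> {..<(if i < a then a - 1 else a)})"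
    using inj_on_subset[OF inj_sk] by blast
  have "sk i j < a" if "j < (if i < a then a - 1 else a)" for j
    using that by (auto simp: sk_def split: if_splits)
  then show "sk i ` (bad k n d \<inter> {..<(if i < a then a - 1 else a)}) \<subseteq> bad k (Suc n) f \<inter> {..<a}"
    using bad_face by auto
qed simp

end

text \<open>At a bad coordinate the first count drops. Otherwise neither count grows and the
  dimension drops.\<close>

lemma cmeas_face: "(cmeas k n d, cmeas k (Suc n) f) \<in> lex3"
proof (cases "i \<in> bad k (Suc n) f")
  case True
  then show ?thesis using card_bad_face_less by (simp add: cmeas_def)
next
  case False
  let ?a = "start k (Suc n) f"
  have "start k n d \<le> (if ?a > i then ?a - 1 else ?a)"
    using start_le[OF single_face[OF False single_start]] .
  then have "card (bad k n d \<inter> {..<start k n d}) \<le> card (bad k n d \<inter> {..<(if i < ?a then ?a - 1 else ?a)})"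
    by (intro card_mono) auto
  also note card_bad_below[OF False, of ?a]
  finally show ?thesis using card_bad_face_le by (auto simp: cmeas_def)
qed

end

text \<open>If \<open>i\<close> is bad, the number of bad coordinates drops. Otherwise the face is
  the \<open>mix\<close> of \<open>d\<close> from the shifted start \<open>a2\<close>, which may lie
  behind the start of \<open>d\<close>. It equals the filling of \<open>d\<close> when no bad
  coordinate of \<open>d\<close> lies in between. If one does, the start of the face is still at
  most that of \<open>d\<close>, so fewer bad coordinates remain in front.\<close>

lemma fill_face:
  assumes k: "2 \<le> k" and i: "i \<le> n" and c: "c \<le> k" 
    and d: "\<And>x. x \<in> jdom k n \<Longrightarrow> d x = f (ins i c x)"
    and g: "g \<in> extensional (jdom k (Suc n))" "\<And>x. x \<in> jdom k (Suc n) \<Longrightarrow> g x = fill k (Suc n) f (ins i c x)"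
  shows "g = fill k n d \<or> (cmeas k (Suc n) g, cmeas k (Suc n) f) \<in> lex3"
proof (cases "i \<in> bad k (Suc n) f")
  case True
  show ?thesis
  proof (cases "i \<in> bad k (Suc (Suc n)) (fill k (Suc n) f)")
    case True': True
    have "card (bad k (Suc n) g) < card (bad k (Suc (Suc n)) (fill k (Suc n) f))"
      using card_bad_face_less[where n = "Suc n" and d = g and f = "fill k (Suc n) f", OF k _ c g(2) True'] i by simp
    also have "\<dots> \<le> card (bad k (Suc n) f)"
      unfolding fill_def by (intro card_mono finite_bad bad_mix[OF k])
    finally show ?thesis by (simp add: cmeas_def)
  next
    case False
    have "card (bad k (Suc n) g) \<le> card (bad k (Suc (Suc n)) (fill k (Suc n) f))"
      using card_bad_face_le[where n = "Suc n" and d = g and f = "fill k (Suc n) f" and i = i, OF k _ c g(2)] i by simp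
    also have "\<dots> < card (bad k (Suc n) f)"
      using True False bad_mix[OF k] unfolding fill_def by (intro psubset_card_mono) auto
    finally show ?thesis by (simp add: cmeas_def)
  qed
next
  case good: False
  define a where "a = start k (Suc n) f"
  define a2 where "a2 = (if i < a then a - 1 else a)"
  have gm: "g = mix k n a2 d"
  proof (rule ext_snocI[OF g(1) mix_extensional])
    fix x y assume x: "x \<in> jdom k n" and y: "y \<le> k"
    have "f (coll k {a..} (ins i c x)) = d (coll k {a2..} x)"
      by (intro coll_face[OF k i c d good x]) (auto simp: sk_def a2_def)
    then show "g (x @ [y]) = mix k n a2 d (x @ [y])"
      using g(2)[of "x @ [y]"] x y i ins_jdom[OF c x, of i] d[OF x]
      by (simp add: snoc_jdom ins_snoc fill_def mix_snoc jdom_iff[of x] flip: a_def)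
  qed
  have s2: "single k n a2 d" using single_face[OF k i c d good single_start] unfolding a2_def a_def .
  then have le: "start k n d \<le> a2" by (rule start_le)
  show ?thesis
  proof (cases "bad k n d \<inter> {start k n d..<a2} = {}")
    case True
    have "d (coll k {a2..} x) = d (coll k {start k n d..} x)" if "x \<in> jdom k n" for x
      using True le by (intro coll_good_diff[OF k that]) auto
    then have "g = fill k n d"
      unfolding gm fill_def by (intro ext_snocI[OF mix_extensional mix_extensional]) (simp add: mix_snoc)
    then show ?thesis by blast
  next
    case False
    have sg: "start k (Suc n) g \<le> start k n d"
      unfolding gm by (intro start_le single_mix[OF k single_start le])
    have bg: "bad k (Suc n) g \<subseteq> bad k n d" unfolding gm by (rule bad_mix[OF k])
    have "bad k (Suc n) g \<inter> {..<start k (Suc n) g} \<subset> bad k n d \<inter> {..<a2}"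
    proof (rule psubsetI)
      show "bad k (Suc n) g \<inter> {..<start k (Suc n) g} \<subseteq> bad k n d \<inter> {..<a2}"
        using sg bg le by fastforce
      obtain j where "j \<in> bad k n d" "start k n d \<le> j" "j < a2" using False by auto
      then have "j \<in> bad k n d \<inter> {..<a2}" "j \<notin> bad k (Suc n) g \<inter> {..<start k (Suc n) g}"
        using sg by simp_all
      then show "bad k (Suc n) g \<inter> {..<start k (Suc n) g} \<noteq> bad k n d \<inter> {..<a2}" by blast
    qed
    then have "card (bad k (Suc n) g \<inter> {..<start k (Suc n) g}) < card (bad k n d \<inter> {..<a2})"
      by (intro psubset_card_mono) auto
    also have "\<dots> \<le> card (bad k (Suc n) f \<inter> {..<a})"
      unfolding a2_def by (rule card_bad_below[OF k i c d good])
    finally have "card (bad k (Suc n) g \<inter> {..<start k (Suc n) g}) < card (bad k (Suc n) f \<inter> {..<a})" .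
    moreover have "card (bad k (Suc n) g) \<le> card (bad k (Suc n) f)"
      using card_mono[OF finite_bad bg] card_bad_face_le[where d = d and f = f, OF k i c d] by linarith
    ultimately show ?thesis by (auto simp: cmeas_def a_def)
  qed
qed

text \<open>Collapsing is idempotent, so the coordinates from \<open>a\<close> on are no longer bad;
  a change of \<open>d\<close> elsewhere is a change of \<open>f\<close> at the collapsed
  point.\<close>

lemma bad_collapsed:
  assumes k: "2 \<le> k" and d: "\<And>x. x \<in> jdom k n \<Longrightarrow> d x = f (coll k {a..} x)"
  shows "bad k n d \<subseteq> bad k n f \<inter> {..<a}"
proof
  fix j assume "j \<in> bad k n d"
  then obtain x where j: "j < n" "x \<in> jdom k n" "d (coll k {j} x) \<noteq> d x" by (auto simp: bad_def)
  have x': "coll k {a..} x \<in> jdom k n" using coll_jdom[OF k j(2)] .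
  have ne: "f (coll k ({a..} \<union> {j}) x) \<noteq> f (coll k {a..} x)"
    using j(3) d[OF j(2)] d[OF coll_jdom[OF k j(2)]] by (simp add: coll_coll)
  have "j < a"
  proof (rule ccontr)
    assume "\<not> j < a"
    then have "{a..} \<union> {j} = {a..}" by auto
    then show False using ne by simp
  qed
  moreover have "f (coll k {j} (coll k {a..} x)) \<noteq> f (coll k {a..} x)"
    using ne by (simp add: coll_coll Un_commute)
  ultimately show "j \<in> bad k n f \<inter> {..<a}" using j(1) x' by (auto simp: bad_def)
qed

section \<open>Naturality of the filling under degeneracies\<close>

text \<open>Overwriting inputs by \<open>True\<close> can only raise outputs, overwriting by
  \<open>False\<close> can only lower them; an output that does not end at \<open>v\<close> was
  therefore left alone.\<close>

lemma boxhom_setb_good: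
  assumes phi: "boxhom m n phi" and b: "length b = m" and i: "i < n" and ne: "phi (setb T v b) ! i \<noteq> v"
  shows "phi (setb T v b) ! i = phi b ! i"
proof (cases v)
  case True
  have "ble b (setb T v b)" using True by (auto simp: ble_def)
  then have "ble (phi b) (phi (setb T v b))" using boxhom_mono[OF phi b] by simp
  then show ?thesis using ne True i boxhom_length[OF phi b] by (auto simp: ble_def)
next
  case False
  have "ble (setb T v b) b" using False by (auto simp: ble_def)
  then have "ble (phi (setb T v b)) (phi b)" using boxhom_mono[OF phi, of "setb T v b"] b by simp
  then show ?thesis using ne False i boxhom_length[OF phi, of "setb T v b"] b by (auto simp: ble_def)
qed

lemma jext_collI:
  assumes k: "2 \<le> k" and phi: "boxhom m n phi" and x: "x \<in> jdom k m" and y: "y \<in> jdom k n"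
    and xy: "\<And>t. 1 \<le> t \<Longrightarrow> t \<le> k \<Longrightarrow> phi (bits t x) = bits t y"
    and eq: "phi (setb T (odd k) (bits (cbit k) x)) = setb U (odd k) (bits (cbit k) y)"
  shows "jext k n phi (coll k T x) = coll k U y"
  using eq xy by (intro jext_eqI[OF phi coll_jdom[OF k x] coll_jdom[OF k y]])
    (simp add: bits_coll[OF k x] bits_coll[OF k y])

text \<open>An output either takes the collapsed bit or keeps its own. Which of the two happens
  depends on \<open>x\<close>, and this is the reason why \<open>single\<close> admits arbitrary
  subsets \<open>T\<close> of the segment at each point.\<close>

lemma jext_coll:
  assumes k: "2 \<le> k" and phi: "boxhom m n phi" and x: "x \<in> jdom k m"
  shows "\<exists>U\<subseteq>{i. i < n \<and> (\<exists>j\<in>T. dep phi m i j)}. jext k n phi (coll k T x) = coll k U (jext k n phi x)"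
proof -
  define b where "b = bits (cbit k) x"
  have b: "length b = m" using x by (simp add: b_def jdom_iff)
  have lx: "length x = m" using x by (simp add: jdom_iff)
  have ck: "1 \<le> cbit k" "cbit k \<le> k" using k by (auto simp: cbit_def)
  define U where "U = {i. i < n \<and> (\<exists>j\<in>T. dep phi m i j) \<and> phi (setb T (odd k) b) ! i = odd k}"
  have bj: "phi (bits t x) = bits t (jext k n phi x)" if "1 \<le> t" "t \<le> k" for t
    using bits_jext[OF phi lx that] by simp
  have "phi (setb T (odd k) b) = setb U (odd k) (phi b)"
  proof (rule nth_equalityI)
    show "length (phi (setb T (odd k) b)) = length (setb U (odd k) (phi b))"
      using boxhom_length[OF phi] b by simp
    fix i assume "i < length (phi (setb T (odd k) b))"
    then have i: "i < n" "i < length (phi b)" using boxhom_length[OF phi] b by auto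
    show "phi (setb T (odd k) b) ! i = setb U (odd k) (phi b) ! i"
    proof (cases "i \<in> U")
      case True
      then show ?thesis using i by (simp add: U_def)
    next
      case False
      have "phi (setb T (odd k) b) ! i = phi b ! i"
      proof (cases "\<exists>j\<in>T. dep phi m i j")
        case True
        then have "phi (setb T (odd k) b) ! i \<noteq> odd k" using False i by (simp add: U_def)
        then show ?thesis by (rule boxhom_setb_good[OF phi b i(1)])
      next
        case False
        then show ?thesis using b by (intro boxhom_cong[OF phi]) (auto simp: dep_def)
      qed
      then show ?thesis using False i by simp
    qed
  qed
  then have "jext k n phi (coll k T x) = coll k U (jext k n phi x)"
    using bj bj[OF ck] by (intro jext_collI[OF k phi x jext_jdom]) (auto simp: b_def)
  then show ?thesis by (intro exI[of _ U]) (auto simp: U_def)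
qed

text \<open>Under \<open>sep\<close> an output from \<open>i0\<close> on sees only overwritten
  inputs, all equal to \<open>odd k\<close>, and takes this value because it is not constant; an
  earlier output sees no overwritten input.\<close>

lemma jext_coll_tail:
  assumes k: "2 \<le> k" and phi: "boxhom m n phi" "nconst phi m n" and x: "x \<in> jdom k m"
    and sep: "\<And>i j. i < n \<Longrightarrow> dep phi m i j \<Longrightarrow> i0 \<le> i \<longleftrightarrow> a0 \<le> j"
  shows "jext k n phi (coll k {a0..} x) = coll k {i0..} (jext k n phi x)"
proof (rule jext_collI[OF k phi(1) x jext_jdom])
  have lx: "length x = m" using x by (simp add: jdom_iff)
  show bj: "phi (bits t x) = bits t (jext k n phi x)" if "1 \<le> t" "t \<le> k" for t
    using bits_jext[OF phi(1) lx that] by simp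
  define b where "b = bits (cbit k) x"
  have b: "length b = m" using lx by (simp add: b_def)
  have ck: "1 \<le> cbit k" "cbit k \<le> k" using k by (auto simp: cbit_def)
  have "phi (setb {a0..} (odd k) b) = setb {i0..} (odd k) (phi b)"
  proof (rule nth_equalityI)
    show "length (phi (setb {a0..} (odd k) b)) = length (setb {i0..} (odd k) (phi b))"
      using boxhom_length[OF phi(1)] b by simp
    fix i assume "i < length (phi (setb {a0..} (odd k) b))"
    then have i: "i < n" "i < length (phi b)" using boxhom_length[OF phi(1)] b by auto
    show "phi (setb {a0..} (odd k) b) ! i = setb {i0..} (odd k) (phi b) ! i"
    proof (cases "i0 \<le> i")
      case True
      have "phi (setb {a0..} (odd k) b) ! i = phi (replicate m (odd k)) ! i"
      proof (rule boxhom_cong[OF phi(1)])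
        fix j assume j: "dep phi m i j"
        then have "a0 \<le> j" "j < m" using sep[OF i(1) j] True by (auto simp: dep_def)
        then show "setb {a0..} (odd k) b ! j = replicate m (odd k) ! j" using b by simp
      qed (use b in auto)
      then show ?thesis using nconst_replicate[OF phi i(1)] True i by simp
    next
      case False
      have "phi (setb {a0..} (odd k) b) ! i = phi b ! i"
      proof (rule boxhom_cong[OF phi(1)])
        fix j assume j: "dep phi m i j"
        then have "\<not> a0 \<le> j" "j < m" using sep[OF i(1) j] False by (auto simp: dep_def)
        then show "setb {a0..} (odd k) b ! j = b ! j" using b by simp
      qed (use b in auto)
      then show ?thesis using False i by simp
    qed
  qed
  then show "phi (setb {a0..} (odd k) (bits (cbit k) x)) = setb {i0..} (odd k) (bits (cbit k) (jext k n phi x))"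
    using bj[OF ck] by (simp add: b_def)
qed

text \<open>Lifts points of the target together with their collapses, in order to compare
  \<open>g\<close> with its pullback along \<open>phi\<close>. In the last clause \<open>j\<close>
  is the last input of output \<open>i\<close>: the earlier inputs of \<open>i\<close> stay frozen,
  so the output still follows input \<open>j\<close>.\<close>

lemma section_coll:
  assumes k: "2 \<le> k" and phi: "boxhom m n phi" "nconst phi m n" and i: "i < n" "dep phi m i j"
  obtains s q where "boxhom n m s" "q i = j" "\<And>r. r < n \<Longrightarrow> dep phi m r (q r)"
    "\<And>z. z \<in> jdom k n \<Longrightarrow> jext k n phi (jext k m s z) = z"
    "\<And>z T. z \<in> jdom k n \<Longrightarrow> T \<subseteq> {..<n} \<Longrightarrow> jext k m s (coll k T z) = coll k (q ` T) (jext k m s z)"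
    "\<And>z. z \<in> jdom k n \<Longrightarrow> (\<And>p. dep phi m i p \<Longrightarrow> p \<le> j) \<Longrightarrow>
        jext k n phi (coll k {j..} (jext k m s z)) = coll k {i..} z"
proof -
  obtain w where w: "j < m" "length w = m" "phi w ! i \<noteq> phi (w[j := \<not> w ! j]) ! i"
    using i(2) unfolding dep_def by blast
  obtain s q where s: "boxhom n m s" "restrict (phi \<circ> s) (bdom n) = restrict id (bdom n)"
    "\<And>i. i < n \<Longrightarrow> dep phi m i (q i)" "q i = j"
    "\<And>e r. length e = n \<Longrightarrow> r < n \<Longrightarrow> s e ! q r = e ! r"
    "\<And>e p. length e = n \<Longrightarrow> dep phi m i p \<Longrightarrow> p \<noteq> j \<Longrightarrow> s e ! p = w ! p"
    "\<And>e e' p. length e = n \<Longrightarrow> length e' = n \<Longrightarrow> p < m \<Longrightarrow> p \<notin> q ` {..<n} \<Longrightarrow> s e ! p = s e' ! p"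
    by (rule boxhom_section[OF phi i(1) w(1,2,3)]) blast
  have ls: "length (s e) = m" if "length e = n" for e using boxhom_length[OF s(1) that] .
  have ps: "phi (s e) = e" if "length e = n" for e using fun_cong[OF s(2), of e] that by simp
  have qinj: "r = r'" if "r < n" "r' < n" "q r = q r'" for r r'
    using boxhom_dep_less[OF phi(1), of r r' "q r" "q r"] boxhom_dep_less[OF phi(1), of r' r "q r" "q r"]
      s(3)[OF that(1)] s(3)[OF that(2)] that by (metis less_irrefl nat_neq_iff)
  have ck: "1 \<le> cbit k" "cbit k \<le> k" using k by (auto simp: cbit_def)
  show ?thesis
  proof (rule that[OF s(1,4,3)])
    fix z assume z: "z \<in> jdom k n"
    show "jext k n phi (jext k m s z) = z"
      using jext_comp[OF s(1) phi(1) z] jext_id[OF z] s(2) by simp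
  next
    fix z T assume z: "z \<in> jdom k n" and T: "T \<subseteq> {..<n}"
    show "jext k m s (coll k T z) = coll k (q ` T) (jext k m s z)"
    proof (rule jext_collI[OF k s(1) z jext_jdom])
      have lz: "length z = n" using z by (simp add: jdom_iff)
      show bj: "s (bits t z) = bits t (jext k m s z)" if "1 \<le> t" "t \<le> k" for t
        using bits_jext[OF s(1) lz that] by simp
      define b where "b = bits (cbit k) z"
      have b: "length b = n" using lz by (simp add: b_def)
      have "s (setb T (odd k) b) = setb (q ` T) (odd k) (s b)"
      proof (rule nth_equalityI)
        fix p assume "p < length (s (setb T (odd k) b))"
        then have p: "p < m" using ls b by simp
        show "s (setb T (odd k) b) ! p = setb (q ` T) (odd k) (s b) ! p"
        proof (cases "p \<in> q ` {..<n}")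
          case True
          then obtain r where r: "r < n" "p = q r" by auto
          have "q r \<in> q ` T \<longleftrightarrow> r \<in> T" using qinj r T by blast
          then show ?thesis using r p b ls[of b] s(5)[of b r] s(5)[of "setb T (odd k) b" r] by simp
        next
          case False
          then have "p \<notin> q ` T" using T by auto
          then show ?thesis using p b ls[of b] s(7)[OF _ _ p False, of "setb T (odd k) b" b] by simp
        qed
      qed (use b ls in simp)
      then show "s (setb T (odd k) (bits (cbit k) z)) = setb (q ` T) (odd k) (bits (cbit k) (jext k m s z))"
        using bj[OF ck] by (simp add: b_def)
    qed
  next
    fix z assume z: "z \<in> jdom k n" and max: "\<And>p. dep phi m i p \<Longrightarrow> p \<le> j"
    show "jext k n phi (coll k {j..} (jext k m s z)) = coll k {i..} z"
    proof (rule jext_collI[OF k phi(1) jext_jdom z])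
      have lz: "length z = n" using z by (simp add: jdom_iff)
      have sj: "s (bits t z) = bits t (jext k m s z)" if "1 \<le> t" "t \<le> k" for t
        using bits_jext[OF s(1) lz that] by simp
      show "phi (bits t (jext k m s z)) = bits t z" if "1 \<le> t" "t \<le> k" for t
        using sj[OF that] ps[of "bits t z"] lz by simp
      define b where "b = bits (cbit k) z"
      have b: "length b = n" using lz by (simp add: b_def)
      have "phi (setb {j..} (odd k) (s b)) = setb {i..} (odd k) b"
      proof (rule nth_equalityI)
        show "length (phi (setb {j..} (odd k) (s b))) = length (setb {i..} (odd k) b)"
          using boxhom_length[OF phi(1)] b ls by simp
        fix r assume "r < length (phi (setb {j..} (odd k) (s b)))"
        then have r: "r < n" using boxhom_length[OF phi(1)] b ls by simp
        have l: "length (setb {j..} (odd k) (s b)) = m" using ls b by simp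
        consider "r < i" | "r = i" | "i < r" by linarith
        then show "phi (setb {j..} (odd k) (s b)) ! r = setb {i..} (odd k) b ! r"
        proof cases
          case 1
          have "phi (setb {j..} (odd k) (s b)) ! r = phi (s b) ! r"
          proof (rule boxhom_cong[OF phi(1) l ls[OF b]])
            fix p assume p: "dep phi m r p"
            have "p < j" using boxhom_dep_less[OF phi(1) i(1) p i(2) 1] .
            then show "setb {j..} (odd k) (s b) ! p = s b ! p" using ls[OF b] w(1) by simp
          qed
          then show ?thesis using 1 r b ps[OF b] by simp
        next
          case 2
          let ?b = "b[i := odd k]"
          have lb: "length ?b = n" using b by simp
          have "phi (setb {j..} (odd k) (s b)) ! i = phi (s ?b) ! i"
          proof (rule boxhom_cong[OF phi(1) l ls[OF lb]])
            fix p assume p: "dep phi m i p"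
            show "setb {j..} (odd k) (s b) ! p = s ?b ! p"
            proof (cases "p = j")
              case True
              then show ?thesis using s(5)[OF lb i(1)] s(4) ls[OF b] w(1) b i(1) by simp
            next
              case False
              then have "p < j" using max[OF p] by simp
              then show ?thesis using s(6)[OF b p False] s(6)[OF lb p False] ls[OF b] w(1) by simp
            qed
          qed
          then show ?thesis using 2 ps[OF lb] b i(1) by simp
        next
          case 3
          have "phi (setb {j..} (odd k) (s b)) ! r = phi (replicate m (odd k)) ! r"
          proof (rule boxhom_cong[OF phi(1) l])
            fix p assume p: "dep phi m r p"
            have "j < p" using boxhom_dep_less[OF phi(1) r i(2) p 3] .
            moreover have "p < m" using p by (simp add: dep_def)
            ultimately show "setb {j..} (odd k) (s b) ! p = replicate m (odd k) ! p" using ls[OF b] by simp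
          qed simp
          then show ?thesis using 3 r b nconst_replicate[OF phi r] by simp
        qed
      qed
      then show "phi (setb {j..} (odd k) (bits (cbit k) (jext k m s z))) = setb {i..} (odd k) (bits (cbit k) z)"
        using sj[OF ck] by (simp add: b_def)
    qed
  qed
qed

text \<open>The start of \<open>f\<close> may differ from the position \<open>a0\<close> that
  corresponds to the start of \<open>g\<close>, but no bad coordinate of \<open>f\<close> lies
  between them, so both segments have the same effect.\<close>

lemma coll_start_degen:
  assumes k: "2 \<le> k" and phi: "boxhom m n phi" "nconst phi m n"
    and f: "\<And>x. x \<in> jdom k m \<Longrightarrow> f x = g (jext k n phi x)" and x: "x \<in> jdom k m"
  shows "f (coll k {start k m f..} x) = g (coll k {start k n g..} (jext k n phi x))"
proof -
  define i0 where "i0 = start k n g"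
  \<comment> \<open>The least such \<open>a\<close> lies just behind all inputs of the outputs
    before \<open>i0\<close>. Inputs increase with outputs, so it also bounds the inputs of the
    later outputs from below.\<close>
  define Q where "Q a \<longleftrightarrow> (\<forall>i j. i < n \<longrightarrow> dep phi m i j \<longrightarrow> i < i0 \<longrightarrow> j < a)" for a
  define a0 where "a0 = (LEAST a. Q a)"
  have "Q m" by (auto simp: Q_def dep_def)
  then have "Q a0" unfolding a0_def by (rule LeastI)
  have sep: "i0 \<le> i \<longleftrightarrow> a0 \<le> j" if "i < n" "dep phi m i j" for i j
  proof
    assume "i0 \<le> i"
    then have "Q j" unfolding Q_def using boxhom_dep_less[OF phi(1) that(1) _ that(2)] by fastforce
    then show "a0 \<le> j" unfolding a0_def by (rule Least_le)
  next
    assume "a0 \<le> j"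
    then show "i0 \<le> i" using \<open>Q a0\<close> that unfolding Q_def by (metis leD leI)
  qed
  have tail: "f (coll k {a0..} x) = g (coll k {i0..} (jext k n phi x))" if "x \<in> jdom k m" for x
    using jext_coll_tail[OF k phi that sep] f[OF coll_jdom[OF k that]] by simp
  have "single k m a0 f"
    unfolding single_def
  proof (intro ballI allI impI)
    fix x T assume x: "x \<in> jdom k m" and T: "T \<subseteq> {a0..}"
    obtain U where U: "jext k n phi (coll k T x) = coll k U (jext k n phi x)"
      "\<And>i. i \<in> U \<Longrightarrow> i < n \<and> (\<exists>j\<in>T. dep phi m i j)" using jext_coll[OF k phi(1) x, of T] by blast
    have "U \<subseteq> {i0..}" using U(2) T sep by fastforce
    from singleD[OF single_start jext_jdom this[unfolded i0_def]]
    show "f (coll k T x) = f x \<or> f (coll k T x) = f (coll k {a0..} x)"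
      using U(1) f[OF coll_jdom[OF k x]] f[OF x] tail[OF x] unfolding i0_def by metis
  qed
  then have le: "start k m f \<le> a0" by (rule start_le)
  have "bad k m f \<inter> {start k m f..<a0} = {}"
  proof (rule ccontr)
    assume "bad k m f \<inter> {start k m f..<a0} \<noteq> {}"
    then obtain j0 where j0: "j0 \<in> bad k m f" "start k m f \<le> j0" "j0 < a0" by auto
    \<comment> \<open>This coordinate is an input of some output \<open>i < i0\<close> that is bad
      for \<open>g\<close>. All inputs of such an output are bad for \<open>f\<close>, so
      \<open>j\<close> is the last of them. A section through \<open>j\<close> carries
      \<open>single\<close> from \<open>f\<close> at \<open>j\<close> to \<open>g\<close> at
      \<open>i\<close>, against the minimality of \<open>i0\<close>.\<close>
    define j where "j = Max (bad k m f \<inter> {..<a0})"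
    have "bad k m f \<inter> {..<a0} \<noteq> {}" using j0 by blast
    then have "j \<in> bad k m f \<inter> {..<a0}" unfolding j_def by (intro Max_in) auto
    then have j: "j \<in> bad k m f" "j < a0" by auto
    have jmax: "j' \<le> j" if "j' \<in> bad k m f" "j' < a0" for j' using that unfolding j_def by auto
    have sj: "single k m j f" using single_mono[OF k single_start] jmax[OF j0(1,3)] j0(2) by (meson order_trans)
    obtain y where y: "y \<in> jdom k m" "f (coll k {j} y) \<noteq> f y" using j(1) by (auto simp: bad_def)
    obtain U where U: "jext k n phi (coll k {j} y) = coll k U (jext k n phi y)"
      "\<And>i. i \<in> U \<Longrightarrow> i < n \<and> dep phi m i j" using jext_coll[OF k phi(1) y(1), of "{j}"] by blast
    have "g (coll k U (jext k n phi y)) \<noteq> g (jext k n phi y)"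
      using y U(1) f[OF y(1)] f[OF coll_jdom[OF k y(1)]] by metis
    then have "U \<inter> bad k n g \<noteq> {}" using coll_good[OF k jext_jdom] by metis
    then obtain i where i: "i \<in> bad k n g" "i < n" "dep phi m i j" using U(2) by auto
    have ii: "i < i0" using sep[OF i(2,3)] j(2) by simp
    have depbad: "j' \<in> bad k m f" if j': "dep phi m i j'" for j'
    proof -
      obtain s q where s: "boxhom n m s" "q i = j'" "\<And>r. r < n \<Longrightarrow> dep phi m r (q r)"
        "\<And>z. z \<in> jdom k n \<Longrightarrow> jext k n phi (jext k m s z) = z"
        "\<And>z T. z \<in> jdom k n \<Longrightarrow> T \<subseteq> {..<n} \<Longrightarrow> jext k m s (coll k T z) = coll k (q ` T) (jext k m s z)"
        by (rule section_coll[OF k phi i(2) j']) blast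
      obtain z where z: "z \<in> jdom k n" "g (coll k {i} z) \<noteq> g z" using i(1) by (auto simp: bad_def)
      have fs: "f (jext k m s w) = g w" if "w \<in> jdom k n" for w using f[OF jext_jdom] s(4)[OF that] by simp
      have "coll k {j'} (jext k m s z) = jext k m s (coll k {i} z)"
        using s(5)[OF z(1), of "{i}"] s(2) i(2) by simp
      then have "f (coll k {j'} (jext k m s z)) \<noteq> f (jext k m s z)"
        using z fs[OF z(1)] fs[OF coll_jdom[OF k z(1)]] by simp
      moreover have "j' < m" using j' by (simp add: dep_def)
      ultimately show ?thesis unfolding bad_def by auto
    qed
    have top: "p \<le> j" if p: "dep phi m i p" for p
      using jmax[OF depbad[OF p]] sep[OF i(2) p] ii by simp
    obtain s q where s: "boxhom n m s" "q i = j" "\<And>r. r < n \<Longrightarrow> dep phi m r (q r)"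
        "\<And>z. z \<in> jdom k n \<Longrightarrow> jext k n phi (jext k m s z) = z"
        "\<And>z T. z \<in> jdom k n \<Longrightarrow> T \<subseteq> {..<n} \<Longrightarrow> jext k m s (coll k T z) = coll k (q ` T) (jext k m s z)"
        "\<And>z. z \<in> jdom k n \<Longrightarrow> (\<And>p. dep phi m i p \<Longrightarrow> p \<le> j) \<Longrightarrow>
          jext k n phi (coll k {j..} (jext k m s z)) = coll k {i..} z"
      by (rule section_coll[OF k phi i(2,3)]) blast
    have fs: "f (jext k m s w) = g w" if "w \<in> jdom k n" for w using f[OF jext_jdom] s(4)[OF that] by simp
    have "single k n i g"
      unfolding single_def
    proof (intro ballI allI impI)
      fix z T assume z: "z \<in> jdom k n" and T: "T \<subseteq> {i..}"
      have cT: "coll k T z = coll k (T \<inter> {..<n}) z" using z by (intro coll_cong) (auto simp: jdom_iff)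
      have "q ` (T \<inter> {..<n}) \<subseteq> {j..}"
      proof
        fix p assume "p \<in> q ` (T \<inter> {..<n})"
        then obtain r where r: "r \<in> T" "r < n" "p = q r" by auto
        then have "i \<le> r" using T by auto
        then show "p \<in> {j..}" using boxhom_dep_less[OF phi(1) r(2) i(3) s(3)[OF r(2)]] r s(2)
          by (cases "i = r") auto
      qed
      from singleD[OF sj jext_jdom this, of s z]
      have "f (jext k m s (coll k T z)) = f (jext k m s z) \<or> f (jext k m s (coll k T z)) = f (coll k {j..} (jext k m s z))"
        using s(5)[OF z, of "T \<inter> {..<n}"] cT by simp
      moreover have "f (coll k {j..} (jext k m s z)) = g (coll k {i..} z)"
        using f[OF coll_jdom[OF k jext_jdom]] s(6)[OF z top] by simp
      ultimately show "g (coll k T z) = g z \<or> g (coll k T z) = g (coll k {i..} z)"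
        using fs[OF z] fs[OF coll_jdom[OF k z]] by simp
    qed
    then show False using start_le ii unfolding i0_def by (metis leD)
  qed
  then have "f (coll k {start k m f..} x) = f (coll k {a0..} x)"
    using le by (intro coll_good_diff[OF k x]) auto
  then show ?thesis using tail[OF x] by (simp add: i0_def)
qed

lemma NJ_act_extensional: "act (NJ k e G) m n phi f \<in> extensional (jdom k m)"
  unfolding NJ_act by (rule restrict_extensional)

section \<open>The filling operation on a nerve\<close>

lemma filling_NJ:
  fixes G :: "('v \<times> 'v) set"
  assumes k: "2 \<le> k" and G: "refl G"
  shows "filling (NJ k e G) (\<lambda>n. {f \<in> cells (NJ k e G) n. bad k n f = {}}) (fill k) (cmeas k) lex3"
proof
  let ?X = "NJ k e G"
  show "cubical_set ?X" by (rule cubical_set_NJ)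
  show "wf lex3" by (intro wf_lex_prod wf_less_than)
  show cell: "fill k n x \<in> cells ?X (Suc n)" if "x \<in> cells ?X n" for x n
    unfolding fill_def by (rule mix_cell[OF k G that single_start])
  have face_last: "act ?X n (Suc n) (bface n n eps) (fill k n f) x
      = (if eps then f (coll k {start k n f..} x) else f x)" if "x \<in> jdom k n" for n eps f x
  proof -
    have "ins n (if eps then k else 0) x = x @ [if eps then k else 0]" using that by (simp add: ins_def jdom_iff)
    then show ?thesis using that hbit_bounds[OF k] by (simp add: NJ_face fill_def mix_snoc)
  qed
  show face0: "act ?X n (Suc n) (bface n n False) (fill k n x) = x" if x: "x \<in> cells ?X n" for x n
    using x unfolding NJ_cells
    by (intro extensionalityI[OF NJ_act_extensional]) (auto simp: face_last)
  show "fill k m (act ?X m n phi x) = act ?X (Suc m) (Suc n) (xid m phi) (fill k n x)"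
    if phi: "boxhom m n phi" "nconst phi m n" and x: "x \<in> cells ?X n" for m n phi x
  proof (rule ext_snocI)
    fix w y assume w: "w \<in> jdom k m" and y: "y \<le> k"
    let ?f = "act ?X m n phi x"
    have f: "?f u = x (jext k n phi u)" if "u \<in> jdom k m" for u using that by (simp add: NJ_act)
    have wy: "w @ [y] \<in> jdom k (Suc m)" using w y by (simp add: snoc_jdom)
    have "act ?X (Suc m) (Suc n) (xid m phi) (fill k n x) (w @ [y]) = fill k n x (jext k n phi w @ [y])"
      using wy jext_xid[OF phi(1) wy] by (simp add: NJ_act)
    then show "fill k m ?f (w @ [y]) = act ?X (Suc m) (Suc n) (xid m phi) (fill k n x) (w @ [y])"
      using coll_start_degen[where f = ?f and g = x, OF k phi f w] w y f[OF w] by (simp add: fill_def mix_snoc)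
  qed (simp_all add: fill_def NJ_act_extensional)
  show "fill k (Suc n) (fill k n x) = act ?X (Suc (Suc n)) (Suc n) (bconn (Suc n) n) (fill k n x)"
    if x: "x \<in> cells ?X n" for x n
  proof (rule ext_snocI)
    fix w y assume w: "w \<in> jdom k (Suc n)" and y: "y \<le> k"
    obtain w' y' where w': "w = w' @ [y']" "w' \<in> jdom k n" "y' \<le> k" using jdom_SucE[OF w] by blast
    have l: "length w' = n" using w' by (simp add: jdom_iff)
    have wy: "w @ [y] \<in> jdom k (Suc (Suc n))" using w y by (simp add: snoc_jdom)
    have "jext k (Suc n) (bconn (Suc n) n) (w @ [y]) = w' @ [max y' y]"
      using jext_conn_last[OF wy] w' l by (simp add: nth_append)
    then have r: "act ?X (Suc (Suc n)) (Suc n) (bconn (Suc n) n) (fill k n x) (w @ [y]) = fill k n x (w' @ [max y' y])"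
      using wy by (simp add: NJ_act)
    have "fill k (Suc n) (fill k n x) (w @ [y]) =
       (if hbit k \<le> y then fill k n x (coll k {start k n x..} w) else fill k n x w)"
      using w y unfolding fill_def[of k "Suc n"] start_fill[OF k] by (simp add: mix_snoc)
    also have "fill k n x (coll k {start k n x..} w) = x (coll k {start k n x..} w')"
      unfolding fill_def w'(1) by (simp add: mix_coll_snoc[OF k w'(2,3)])
    finally show "fill k (Suc n) (fill k n x) (w @ [y]) =
        act ?X (Suc (Suc n)) (Suc n) (bconn (Suc n) n) (fill k n x) (w @ [y])"
      unfolding r using w' y by (simp add: fill_def mix_snoc le_max_iff_disj)
  qed (simp_all add: fill_def NJ_act_extensional)
  have face_eq: "act ?X n (Suc n) (bface n i eps) f x = f (ins i (if eps then k else 0) x)"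
    if "i \<le> n" "x \<in> jdom k n" for n i eps f x
    using that by (simp add: NJ_face)
  show "(cmeas k n (act ?X n (Suc n) (bface n i eps) x), cmeas k (Suc n) x) \<in> lex3"
    if "i \<le> n" for x n i eps
    by (rule cmeas_face[OF k that _ face_eq[OF that]]) simp_all
  show "act ?X (Suc n) (Suc (Suc n)) (bface (Suc n) i eps) (fill k (Suc n) x) = fill k n (act ?X n (Suc n) (bface n i eps) x)
      \<or> (cmeas k (Suc n) (act ?X (Suc n) (Suc (Suc n)) (bface (Suc n) i eps) (fill k (Suc n) x)), cmeas k (Suc n) x) \<in> lex3"
    if "i \<le> n" for x n i eps
    using that by (intro fill_face[OF k that _ face_eq[OF that] NJ_act_extensional face_eq]) simp_all
  have less: "card (bad k n (act ?X n (Suc n) (bface n n True) (fill k n x))) < card (bad k n x)"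
    if x: "x \<in> cells ?X n" "x \<notin> {f \<in> cells ?X n. bad k n f = {}}" for x n
  proof -
    have "bad k n (act ?X n (Suc n) (bface n n True) (fill k n x)) \<subseteq> bad k n x \<inter> {..<start k n x}"
      by (rule bad_collapsed[OF k]) (simp add: face_last)
    moreover obtain c where "c \<in> bad k n x" "start k n x \<le> c" using bad_ge_start[OF k] x by blast
    ultimately show ?thesis by (intro psubset_card_mono finite_bad) fastforce
  qed
  show "(cmeas k n (act ?X n (Suc n) (bface n n True) (fill k n x)), cmeas k n x) \<in> lex3"
    if x: "x \<in> cells ?X n" "x \<notin> {f \<in> cells ?X n. bad k n f = {}}" for x n
    using less[OF x] by (simp add: cmeas_def)
  \<comment> \<open>For a degenerate filler the face opposite to \<open>x\<close> would be
    \<open>x\<close> again, but that face has fewer bad coordinates.\<close>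
  show "fill k n x \<noteq> act ?X (Suc n) n (bdegen n n) x"
    if x: "x \<in> cells ?X n" "x \<notin> {f \<in> cells ?X n. bad k n f = {}}" for x n
  proof
    assume eq: "fill k n x = act ?X (Suc n) n (bdegen n n) x"
    have "restrict (bdegen n n \<circ> bface n n True) (bdom n) = restrict id (bdom n)"
      by (intro restrict_ext) simp
    then have "act ?X n (Suc n) (bface n n True) (fill k n x) = x"
      unfolding eq by (intro cubical_set_section[OF cubical_set_NJ bh_face bh_degen x(1)]) auto
    then show False using less[OF x] by simp
  qed
qed

section \<open>One stage\<close>

text \<open>A section of \<open>tmap s\<close> whose composite with \<open>tmap s\<close> in the
  other order is the collapse \<open>rho (Suc s)\<close>. It identifies the image of the transition
  with the cubes that have no bad coordinate.\<close>

definition isec :: "nat \<Rightarrow> nat \<Rightarrow> nat" where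
  "isec s z = (if odd s then z else Suc z)"

lemma tmap_isec: "z \<le> s \<Longrightarrow> tmap s (isec s z) = z"
  by (auto simp: tmap_def isec_def)

lemma isec_tmap: "isec s (tmap s z) = rho (Suc s) z"
  by (auto simp: tmap_def isec_def rho_def)

lemma tmap_rho: "tmap s (rho (Suc s) z) = tmap s z"
  by (auto simp: tmap_def rho_def)

lemma stage_eps_Suc: "stage_eps (Suc s) = (if odd s then stage_eps s else \<not> stage_eps s)"
proof -
  have *: "s mod 4 = 0 \<or> s mod 4 = 1 \<or> s mod 4 = 2 \<or> s mod 4 = 3" by linarith
  have "odd s \<longleftrightarrow> s mod 4 = 1 \<or> s mod 4 = 3" by presburger
  then show ?thesis using * unfolding stage_eps_def mod_Suc by auto
qed

lemma tmap_jdom: "x \<in> jdom (Suc s) n \<Longrightarrow> map (tmap s) x \<in> jdom s n"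
  by (auto simp: jdom_iff tmap_def)

lemma isec_jdom: "x \<in> jdom s n \<Longrightarrow> map (isec s) x \<in> jdom (Suc s) n"
  by (auto simp: jdom_iff isec_def le_SucI)

lemma iarr_tmap: "iarr (stage_eps (Suc s)) (Suc s) a b \<Longrightarrow> iarr (stage_eps s) s (tmap s a) (tmap s b)"
  unfolding stage_eps_Suc iarr_def tmap_def by (auto simp: min_def split: if_splits)

lemma iarr_isec: "iarr (stage_eps s) s a b \<Longrightarrow> iarr (stage_eps (Suc s)) (Suc s) (isec s a) (isec s b)"
  unfolding stage_eps_Suc iarr_def isec_def by (auto split: if_splits)

lemma jarr_map:
  assumes "\<And>a b. iarr e k a b \<Longrightarrow> iarr e' k' (h a) (h b)" "jarr e k x y"
  shows "jarr e' k' (map h x) (map h y)"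
  using assms(2)
proof (cases rule: jarr_cases)
  case 1 then show ?thesis by (simp add: jarr_def)
next
  case (2 j)
  have "x ! i = y ! i" if "i \<noteq> j" for i using 2(2) that by (metis nth_list_update_neq)
  then show ?thesis using assms 2 unfolding jarr_def by (auto intro!: exI[of _ j])
qed

lemma Nst_cells: "f \<in> cells (Nst G s) n \<longleftrightarrow> f \<in> extensional (jdom s n) \<and>
    (\<forall>x\<in>jdom s n. \<forall>y\<in>jdom s n. jarr (stage_eps s) s x y \<longrightarrow> (f x, f y) \<in> G)"
  unfolding Nst_def by (rule NJ_cells)

lemma Nst_act: "act (Nst G s) m n phi f = restrict (\<lambda>x. f (jext s n phi x)) (jdom s m)"
  unfolding Nst_def by (rule NJ_act)

lemma cubical_set_Nst: "cubical_set (Nst G s)"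
  unfolding Nst_def by (rule cubical_set_NJ)

lemma trans_st_cell: "f \<in> cells (Nst G s) n \<Longrightarrow> trans_st s n f \<in> cells (Nst G (Suc s)) n"
  unfolding Nst_cells trans_st_def
  using tmap_jdom jarr_map[OF iarr_tmap] by (simp del: restrict_apply add: restrict_apply')

lemma trans_st_inj:
  assumes "f \<in> cells (Nst G s) n" "g \<in> cells (Nst G s) n" "trans_st s n f = trans_st s n g"
  shows "f = g"
proof (rule extensionalityI[of _ "jdom s n"])
  show "f \<in> extensional (jdom s n)" "g \<in> extensional (jdom s n)" using assms by (auto simp: Nst_cells)
  fix x assume x: "x \<in> jdom s n"
  have "map (tmap s) (map (isec s) x) = x"
    using x by (intro nth_equalityI) (auto simp: jdom_iff tmap_isec)
  then show "f x = g x"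
    using fun_cong[OF assms(3), of "map (isec s) x"] isec_jdom[OF x] by (simp add: trans_st_def)
qed

text \<open>\<open>tmap s\<close> forgets the threshold \<open>cbit (Suc s)\<close> and renumbers
  the others; this makes it compatible with \<open>jext\<close>.\<close>

lemma bits_tmap:
  assumes "1 \<le> t" "t \<le> s"
  shows "bits t (map (tmap s) x) = bits (if odd s then t else Suc t) x"
  using assms by (intro nth_equalityI) (auto simp: tmap_def)

lemma jext_tmap:
  assumes phi: "boxhom m n phi" and x: "x \<in> jdom (Suc s) m"
  shows "jext s n phi (map (tmap s) x) = map (tmap s) (jext (Suc s) n phi x)"
proof (rule jext_eqI[OF phi tmap_jdom[OF x] tmap_jdom[OF jext_jdom]])
  fix t assume t: "1 \<le> t" "t \<le> s"
  have "length x = m" using x by (simp add: jdom_iff)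
  then show "bits t (map (tmap s) (jext (Suc s) n phi x)) = phi (bits t (map (tmap s) x))"
    unfolding bits_tmap[OF t] using t by (intro bits_jext[OF phi]) auto
qed

lemma trans_st_act:
  assumes phi: "boxhom m n phi"
  shows "trans_st s m (act (Nst G s) m n phi f) = act (Nst G (Suc s)) m n phi (trans_st s n f)"
  unfolding trans_st_def Nst_act
  by (intro restrict_ext) (simp add: tmap_jdom jext_tmap[OF phi])

lemma trans_st_image:
  assumes s: "1 \<le> s"
  shows "{f \<in> cells (Nst G (Suc s)) n. bad (Suc s) n f = {}} = trans_st s n ` cells (Nst G s) n"
proof (intro equalityI subsetI)
  fix f assume "f \<in> {f \<in> cells (Nst G (Suc s)) n. bad (Suc s) n f = {}}"
  then have f: "f \<in> cells (Nst G (Suc s)) n" and b: "bad (Suc s) n f = {}" by auto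
  define g where "g = restrict (\<lambda>x. f (map (isec s) x)) (jdom s n)"
  have "g \<in> cells (Nst G s) n"
    using f isec_jdom jarr_map[OF iarr_isec] unfolding g_def Nst_cells
    by (simp del: restrict_apply add: restrict_apply')
  moreover have "f = trans_st s n g"
  proof (rule extensionalityI[of _ "jdom (Suc s) n"])
    show "f \<in> extensional (jdom (Suc s) n)" using f by (simp add: Nst_cells)
    show "trans_st s n g \<in> extensional (jdom (Suc s) n)" unfolding trans_st_def by (rule restrict_extensional)
    fix x assume x: "x \<in> jdom (Suc s) n"
    have "map (isec s) (map (tmap s) x) = coll (Suc s) UNIV x"
      by (intro nth_equalityI) (auto simp: isec_tmap)
    moreover have "f (coll (Suc s) UNIV x) = f x" using coll_good[OF _ x, of UNIV f] b s by simp
    ultimately show "f x = trans_st s n g x" using x tmap_jdom[OF x] by (simp add: trans_st_def g_def)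
  qed
  ultimately show "f \<in> trans_st s n ` cells (Nst G s) n" by blast
next
  fix h assume "h \<in> trans_st s n ` cells (Nst G s) n"
  then obtain f where f: "f \<in> cells (Nst G s) n" "h = trans_st s n f" by blast
  have "h (coll (Suc s) {j} x) = h x" if x: "x \<in> jdom (Suc s) n" for j x
  proof -
    have "map (tmap s) (coll (Suc s) {j} x) = map (tmap s) x"
      by (intro nth_equalityI) (auto simp: tmap_rho)
    then show ?thesis using x coll_jdom[of "Suc s" x n "{j}"] s f by (simp add: trans_st_def)
  qed
  then show "h \<in> {f \<in> cells (Nst G (Suc s)) n. bad (Suc s) n f = {}}"
    using trans_st_cell[OF f(1)] f(2) by (auto simp: bad_def)
qed

lemma stage_lift:
  fixes G :: "('v \<times> 'v) set" and E :: "'e cset" and B :: "'b cset" and p :: "nat \<Rightarrow> 'e \<Rightarrow> 'b"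
  assumes G: "refl G" and s: "1 \<le> s" and kan: "kan_fibration E B p"
    and u: "cmap (Nst G s) E u" and v: "cmap (Nst G (Suc s)) B v"
    and uv: "\<And>n f. f \<in> cells (Nst G s) n \<Longrightarrow> p n (u n f) = v n (trans_st s n f)"
  shows "\<exists>h. cmap (Nst G (Suc s)) E h \<and>
      (\<forall>n. \<forall>f\<in>cells (Nst G s) n. h n (trans_st s n f) = u n f) \<and>
      (\<forall>n. \<forall>f\<in>cells (Nst G (Suc s)) n. p n (h n f) = v n f)"
proof -
  let ?X = "Nst G (Suc s)"
  define A where "A n = {f \<in> cells ?X n. bad (Suc s) n f = {}}" for n
  have k: "2 \<le> Suc s" using s by simp
  interpret filling ?X A "fill (Suc s)" "cmeas (Suc s)" lex3
    unfolding A_def Nst_def by (rule filling_NJ[OF k G])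
  \<comment> \<open>The transition is injective, so \<open>u\<close> can be read as a map on its
    image \<open>A\<close>.\<close>
  define w where "w n = inv_into (cells (Nst G s) n) (trans_st s n)" for n
  have A_img: "A n = trans_st s n ` cells (Nst G s) n" for n
    unfolding A_def by (rule trans_st_image[OF s])
  have w: "w n (trans_st s n f) = f" if "f \<in> cells (Nst G s) n" for n f
    unfolding w_def using trans_st_inj that by (intro inv_into_f_f inj_onI) blast
  have u_cell: "u n f \<in> cells E n" if "f \<in> cells (Nst G s) n" for n f using u that by (simp add: cmap_def)
  have u_act: "u m (act (Nst G s) m n phi f) = act E m n phi (u n f)"
    if "boxhom m n phi" "f \<in> cells (Nst G s) n" for m n phi f using u that unfolding cmap_def by blast
  have "\<exists>h. cmap ?X E h \<and> (\<forall>n. \<forall>x\<in>A n. h n x = u n (w n x)) \<and> (\<forall>n. \<forall>x\<in>cells ?X n. p n (h n x) = v n x)"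
  proof (rule lift_extends[OF kan v])
    show "x \<in> cells ?X n" if "x \<in> A n" for n x using that by (simp add: A_def)
    show "fill (Suc s) n x \<in> A (Suc n)" if "x \<in> A n" for n x
      using that fil_cell[of x n] bad_mix[OF k, of n _ x] unfolding A_def fill_def by fastforce
    show "act ?X m n phi x \<in> A m" if phi: "boxhom m n phi" and x: "x \<in> A n" for m n phi x
    proof -
      obtain f where f: "f \<in> cells (Nst G s) n" "x = trans_st s n f" using x A_img by blast
      then have "act ?X m n phi x = trans_st s m (act (Nst G s) m n phi f)"
        using trans_st_act[OF phi] by metis
      then show ?thesis using A_img cubical_set_act[OF cubical_set_Nst phi f(1)] by blast
    qed
    show "u n (w n x) \<in> cells E n" if "x \<in> A n" for n x
      using that A_img[of n] w u_cell by auto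
    show "p n (u n (w n x)) = v n x" if "x \<in> A n" for n x
      using that A_img[of n] w uv by auto
    show "u m (w m (act ?X m n phi x)) = act E m n phi (u n (w n x))"
      if phi: "boxhom m n phi" and x: "x \<in> A n" for m n phi x
    proof -
      obtain f where f: "f \<in> cells (Nst G s) n" "x = trans_st s n f" using x A_img by blast
      have c: "act (Nst G s) m n phi f \<in> cells (Nst G s) m" using cubical_set_act[OF cubical_set_Nst phi f(1)] .
      have "act ?X m n phi x = trans_st s m (act (Nst G s) m n phi f)"
        using trans_st_act[OF phi] f(2) by metis
      then show ?thesis using w[OF c] w[OF f(1)] f(2) u_act[OF phi f(1)] by simp
    qed
  qed
  then obtain h where h: "cmap ?X E h" "\<And>n x. x \<in> A n \<Longrightarrow> h n x = u n (w n x)"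
    "\<And>n x. x \<in> cells ?X n \<Longrightarrow> p n (h n x) = v n x" by blast
  have "h n (trans_st s n f) = u n f" if f: "f \<in> cells (Nst G s) n" for n f
  proof -
    have "trans_st s n f \<in> A n" using f A_img by blast
    then show ?thesis using h(2) w[OF f] by simp
  qed
  then show ?thesis using h by blast
qed

section \<open>The colimit\<close>

lemma push_cell: "f \<in> cells (Nst G s) n \<Longrightarrow> push s d n f \<in> cells (Nst G (s + d)) n"
  by (induction d) (auto intro: trans_st_cell)

lemma push_inj:
  assumes "f \<in> cells (Nst G s) n" "g \<in> cells (Nst G s) n" "push s d n f = push s d n g"
  shows "f = g"
  using assms(3)
proof (induction d)
  case (Suc d)
  then show ?case using trans_st_inj[of _ G "s + d" n] push_cell[OF assms(1), of d] push_cell[OF assms(2), of d] by simp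
qed simp

lemma push_add: "push s (d + d') n f = push (s + d) d' n (push s d n f)"
  by (induction d') (auto simp: add.assoc)

lemma push_act:
  assumes "boxhom m n phi"
  shows "push s d m (act (Nst G s) m n phi f) = act (Nst G (s + d)) m n phi (push s d n f)"
  by (induction d) (simp_all add: trans_st_act[OF assms])

definition valid :: "('v \<times> 'v) set \<Rightarrow> nat \<Rightarrow> nat \<times> (nat list \<Rightarrow> 'v) \<Rightarrow> bool" where
  "valid G n a \<longleftrightarrow> 1 \<le> fst a \<and> snd a \<in> cells (Nst G (fst a)) n"

text \<open>As the transitions are injective, an equality at a late stage already holds at every
  common stage.\<close>

lemma colim_rel_at:
  assumes a: "valid G n a" and b: "valid G n b" and r: "colim_rel n a b" and t: "fst a \<le> t" "fst b \<le> t"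
  shows "push (fst a) (t - fst a) n (snd a) = push (fst b) (t - fst b) n (snd b)"
proof -
  obtain t' where t': "fst a \<le> t'" "fst b \<le> t'"
    "push (fst a) (t' - fst a) n (snd a) = push (fst b) (t' - fst b) n (snd b)"
    using r unfolding colim_rel_def by blast
  have step: "push (fst c) (r - fst c) n (snd c) = push q (r - q) n (push (fst c) (q - fst c) n (snd c))"
    if "fst c \<le> q" "q \<le> r" for c :: "nat \<times> (nat list \<Rightarrow> 'a)" and q r
    using push_add[of "fst c" "q - fst c" "r - q" n "snd c"] that by simp
  have cell: "push (fst c) (t - fst c) n (snd c) \<in> cells (Nst G t) n" if "valid G n c" "fst c \<le> t" for c
    using push_cell[of "snd c" G "fst c" n "t - fst c"] that by (simp add: valid_def)
  show ?thesis
  proof (cases "t' \<le> t")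
    case True
    then show ?thesis using step[OF t'(1) True] step[OF t'(2) True] t'(3) by simp
  next
    case False
    then have le: "t \<le> t'" by simp
    have "push t (t' - t) n (push (fst a) (t - fst a) n (snd a)) = push t (t' - t) n (push (fst b) (t - fst b) n (snd b))"
      using step[OF t(1) le] step[OF t(2) le] t'(3) by simp
    then show ?thesis using push_inj[OF cell[OF a t(1)] cell[OF b t(2)]] by blast
  qed
qed

lemma colim_rel_refl: "colim_rel n a a"
  unfolding colim_rel_def by (intro exI[of _ "fst a"]) simp

lemma colim_rel_sym: "colim_rel n a b \<Longrightarrow> colim_rel n b a"
  unfolding colim_rel_def by metis

lemma colim_rel_trans:
  assumes "valid G n a" "valid G n b" "valid G n c" "colim_rel n a b" "colim_rel n b c"
  shows "colim_rel n a c"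
proof -
  define t where "t = max (fst a) (max (fst b) (fst c))"
  have t: "fst a \<le> t" "fst b \<le> t" "fst c \<le> t" by (auto simp: t_def)
  have "push (fst a) (t - fst a) n (snd a) = push (fst c) (t - fst c) n (snd c)"
    using colim_rel_at[OF assms(1,2,4) t(1,2)] colim_rel_at[OF assms(2,3,5) t(2,3)] by simp
  then show ?thesis using t unfolding colim_rel_def by blast
qed

lemma colim_rel_act:
  assumes phi: "boxhom m n phi" and r: "colim_rel n a b"
  shows "colim_rel m (fst a, act (Nst G (fst a)) m n phi (snd a)) (fst b, act (Nst G (fst b)) m n phi (snd b))"
proof -
  obtain t where t: "fst a \<le> t" "fst b \<le> t"
    "push (fst a) (t - fst a) n (snd a) = push (fst b) (t - fst b) n (snd b)"
    using r unfolding colim_rel_def by blast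
  then show ?thesis unfolding colim_rel_def
    by (intro exI[of _ t]) (simp add: push_act[OF phi])
qed

lemma valid_act: "boxhom m n phi \<Longrightarrow> valid G n a \<Longrightarrow> valid G m (fst a, act (Nst G (fst a)) m n phi (snd a))"
  using cubical_set_act[OF cubical_set_Nst] by (auto simp: valid_def)

lemma colim_cls_iff: "b \<in> colim_cls G n a \<longleftrightarrow> valid G n b \<and> colim_rel n a b"
  by (simp add: colim_cls_def valid_def)

lemma colim_cls_eq:
  assumes "valid G n a" "valid G n b" "colim_rel n a b"
  shows "colim_cls G n a = colim_cls G n b"
  using assms colim_rel_trans colim_rel_sym unfolding set_eq_iff colim_cls_iff by metis

lemma colim_cls_self: "valid G n a \<Longrightarrow> a \<in> colim_cls G n a"
  by (simp add: colim_cls_iff colim_rel_refl)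

lemma Ninf_cells: "c \<in> cells (Ninf G) n \<longleftrightarrow> (\<exists>a. valid G n a \<and> c = colim_cls G n a)"
  by (auto simp: Ninf_def valid_def)

lemma Ninf_act_cls:
  assumes phi: "boxhom m n phi" and a: "valid G n a"
  shows "act (Ninf G) m n phi (colim_cls G n a) = colim_cls G m (fst a, act (Nst G (fst a)) m n phi (snd a))"
proof -
  let ?a = "\<lambda>a. (fst a, act (Nst G (fst a)) m n phi (snd a))"
  have "act (Ninf G) m n phi (colim_cls G n a) = {b. valid G m b \<and> (\<exists>c\<in>colim_cls G n a. colim_rel m (?a c) b)}"
    by (auto simp: Ninf_def valid_def)
  also have "\<dots> = colim_cls G m (?a a)"
  proof (intro equalityI subsetI)
    fix b assume "b \<in> {b. valid G m b \<and> (\<exists>c\<in>colim_cls G n a. colim_rel m (?a c) b)}"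
    then obtain c where b: "valid G m b" and c: "valid G n c" "colim_rel n a c" "colim_rel m (?a c) b"
      by (auto simp: colim_cls_iff)
    have "colim_rel m (?a a) (?a c)" by (rule colim_rel_act[OF phi c(2)])
    then have "colim_rel m (?a a) b"
      using colim_rel_trans[OF valid_act[OF phi a] valid_act[OF phi c(1)] b] c(3) by blast
    then show "b \<in> colim_cls G m (?a a)" using b by (simp add: colim_cls_iff)
  next
    fix b assume "b \<in> colim_cls G m (?a a)"
    then show "b \<in> {b. valid G m b \<and> (\<exists>c\<in>colim_cls G n a. colim_rel m (?a c) b)}"
      using colim_cls_self[OF a] by (auto simp: colim_cls_iff)
  qed
  finally show ?thesis .
qed

lemma cubical_set_Ninf: "cubical_set (Ninf G)"
  unfolding cubical_set_def
proof (intro conjI allI impI; (elim conjE)?)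
  fix m n phi c assume phi: "boxhom m n phi" and "c \<in> cells (Ninf G) n"
  then obtain a where a: "valid G n a" "c = colim_cls G n a" by (auto simp: Ninf_cells)
  then show "act (Ninf G) m n phi c \<in> cells (Ninf G) m"
    using Ninf_act_cls[OF phi a(1)] valid_act[OF phi a(1)] unfolding Ninf_cells by blast
next
  fix n c assume "c \<in> cells (Ninf G) n"
  then obtain a where a: "valid G n a" "c = colim_cls G n a" by (auto simp: Ninf_cells)
  have "act (Nst G (fst a)) n n (restrict id (bdom n)) (snd a) = snd a"
    using a(1) by (intro cubical_set_id[OF cubical_set_Nst]) (simp add: valid_def)
  then show "act (Ninf G) n n (restrict id (bdom n)) c = c"
    using Ninf_act_cls[OF bh_id a(1)] a(2) by (metis prod.collapse)
next
  fix l m n g f c assume g: "boxhom l m g" and f: "boxhom m n f" and "c \<in> cells (Ninf G) n"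
  then obtain a where a: "valid G n a" "c = colim_cls G n a" by (auto simp: Ninf_cells)
  have "act (Nst G (fst a)) l m g (act (Nst G (fst a)) m n f (snd a))
      = act (Nst G (fst a)) l n (restrict (f \<circ> g) (bdom l)) (snd a)"
    using a cubical_set_comp[OF cubical_set_Nst g f] unfolding valid_def by blast
  then show "act (Ninf G) l m g (act (Ninf G) m n f c) = act (Ninf G) l n (restrict (f \<circ> g) (bdom l)) c"
    using Ninf_act_cls[OF f a(1)] Ninf_act_cls[OF g valid_act[OF f a(1)]] Ninf_act_cls[OF bh_comp[OF g f] a(1)] a(2)
    by (metis fst_conv snd_conv)
qed

section \<open>The maps from the stages into the colimit\<close>

lemma cmap_stage_Ninf:
  assumes "1 \<le> s"
  shows "cmap (Nst G s) (Ninf G) (\<lambda>n f. colim_cls G n (s, f))"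
  unfolding cmap_def
proof (intro conjI allI impI; (elim conjE)?)
  fix n f assume "f \<in> cells (Nst G s) n"
  then have "valid G n (s, f)" using assms by (simp add: valid_def)
  then show "colim_cls G n (s, f) \<in> cells (Ninf G) n" unfolding Ninf_cells by blast
next
  fix m n phi f assume phi: "boxhom m n phi" and "f \<in> cells (Nst G s) n"
  then have "valid G n (s, f)" using assms by (simp add: valid_def)
  from Ninf_act_cls[OF phi this]
  show "colim_cls G m (s, act (Nst G s) m n phi f) = act (Ninf G) m n phi (colim_cls G n (s, f))" by simp
qed

lemma cmono_canon: "cmono (Nst G 1) (Ninf G) (canon G)"
  unfolding cmono_def
proof (intro conjI allI)
  have "canon G = (\<lambda>n f. colim_cls G n (1, f))" by (intro ext) (simp add: canon_def)
  then show "cmap (Nst G 1) (Ninf G) (canon G)" using cmap_stage_Ninf[of 1 G] by simp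
  fix n
  show "inj_on (canon G n) (cells (Nst G 1) n)"
  proof (rule inj_onI)
    fix f g assume f: "f \<in> cells (Nst G 1) n" and g: "g \<in> cells (Nst G 1) n" and eq: "canon G n f = canon G n g"
    have vf: "valid G n (1, f)" and vg: "valid G n (1, g)" using f g by (auto simp: valid_def)
    have "(1, g) \<in> colim_cls G n (1, f)" using eq colim_cls_self[OF vg] by (simp add: canon_def)
    then have "colim_rel n (1, f) (1, g)" by (simp add: colim_cls_iff)
    from colim_rel_at[OF vf vg this, of 1] show "f = g" by simp
  qed
qed

lemma cmap_comp: "cmap X Y F \<Longrightarrow> cmap Y Z H \<Longrightarrow> cmap X Z (\<lambda>n x. H n (F n x))"
  unfolding cmap_def by simp

lemma colim_cls_trans_st:
  assumes s: "1 \<le> s" and f: "f \<in> cells (Nst G s) n"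
  shows "colim_cls G n (Suc s, trans_st s n f) = colim_cls G n (s, f)"
proof (rule colim_cls_eq)
  show "valid G n (Suc s, trans_st s n f)" "valid G n (s, f)"
    using assms trans_st_cell[OF f] by (auto simp: valid_def)
  show "colim_rel n (Suc s, trans_st s n f) (s, f)"
    unfolding colim_rel_def by (intro exI[of _ "Suc s"]) simp
qed

text \<open>Dependent choice gives a sequence of lifts on the stages, each extending the previous
  one; on a class of the colimit any representative may be evaluated.\<close>

lemma llp_canon:
  fixes G :: "('v \<times> 'v) set" and E :: "'e cset" and B :: "'b cset" and p :: "nat \<Rightarrow> 'e \<Rightarrow> 'b"
  assumes G: "refl G" and kan: "kan_fibration E B p"
  shows "llp (Nst G 1) (Ninf G) (canon G) E B p"
  unfolding llp_def
proof (intro allI impI; elim conjE)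
  fix u v assume u: "cmap (Nst G 1) E u" and v: "cmap (Ninf G) B v"
    and uv: "\<forall>n x. x \<in> cells (Nst G 1) n \<longrightarrow> p n (u n x) = v n (canon G n x)"
  \<comment> \<open>Index \<open>s\<close> refers to stage \<open>s + 1\<close>, because the colimit
    starts at stage \<open>1\<close>.\<close>
  define P where "P s h \<longleftrightarrow> cmap (Nst G (Suc s)) E h \<and>
     (\<forall>n. \<forall>f\<in>cells (Nst G (Suc s)) n. p n (h n f) = v n (colim_cls G n (Suc s, f))) \<and> (s = 0 \<longrightarrow> h = u)"
    for s and h :: "nat \<Rightarrow> (nat list \<Rightarrow> 'v) \<Rightarrow> 'e"
  define Q where "Q s h h' \<longleftrightarrow> (\<forall>n. \<forall>f\<in>cells (Nst G (Suc s)) n. h' n (trans_st (Suc s) n f) = h n f)"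
    for s and h h' :: "nat \<Rightarrow> (nat list \<Rightarrow> 'v) \<Rightarrow> 'e"
  have "\<exists>hs. \<forall>s. P s (hs s) \<and> Q s (hs s) (hs (Suc s))"
  proof (rule dependent_nat_choice)
    show "\<exists>h. P 0 h" using u uv by (auto simp: P_def canon_def)
    fix h s assume h: "P s h"
    have "cmap (Nst G (Suc (Suc s))) B (\<lambda>n f. v n (colim_cls G n (Suc (Suc s), f)))"
      by (rule cmap_comp[OF cmap_stage_Ninf v]) simp
    moreover have "p n (h n f) = v n (colim_cls G n (Suc (Suc s), trans_st (Suc s) n f))"
      if "f \<in> cells (Nst G (Suc s)) n" for n f
      using h that colim_cls_trans_st[OF _ that] by (simp add: P_def)
    ultimately show "\<exists>h'. P (Suc s) h' \<and> Q s h h'"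
      using stage_lift[OF G _ kan, of "Suc s" h "\<lambda>n f. v n (colim_cls G n (Suc (Suc s), f))"] h
      unfolding P_def Q_def by auto
  qed
  then obtain hs where hs: "\<And>s. P s (hs s)" "\<And>s. Q s (hs s) (hs (Suc s))" by blast
  have push: "hs (s + d) n (push (Suc s) d n f) = hs s n f" if f: "f \<in> cells (Nst G (Suc s)) n" for s d n f
  proof (induction d)
    case (Suc d)
    have "push (Suc s) d n f \<in> cells (Nst G (Suc (s + d))) n" using push_cell[OF f, of d] by simp
    then have "hs (Suc (s + d)) n (trans_st (Suc (s + d)) n (push (Suc s) d n f)) = hs (s + d) n (push (Suc s) d n f)"
      using hs(2)[of "s + d"] unfolding Q_def by blast
    then show ?case using Suc by simp
  qed simp
  define k where "k n a = hs (fst a - 1) n (snd a)" for n and a :: "nat \<times> (nat list \<Rightarrow> 'v)"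
  have k_push: "k n a = hs (t - 1) n (push (fst a) (t - fst a) n (snd a))"
    if "valid G n a" "fst a \<le> t" for n a t
    using push[of "snd a" "fst a - 1" n "t - fst a"] that by (simp add: valid_def k_def)
  have k_rel: "k n a = k n b" if "valid G n a" "valid G n b" "colim_rel n a b" for n a b
  proof -
    define t where "t = max (fst a) (fst b)"
    have t: "fst a \<le> t" "fst b \<le> t" by (auto simp: t_def)
    show ?thesis using colim_rel_at[OF that t] k_push[OF that(1) t(1)] k_push[OF that(2) t(2)] by simp
  qed
  define h where "h n c = k n (SOME a. a \<in> c)" for n c
  have h: "h n (colim_cls G n a) = k n a" if a: "valid G n a" for n a
  proof -
    have "(SOME b. b \<in> colim_cls G n a) \<in> colim_cls G n a" using colim_cls_self[OF a] by (rule someI)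
    then show ?thesis unfolding h_def colim_cls_iff using k_rel[OF a] by metis
  qed
  have k_stage: "P (fst a - 1) (hs (fst a - 1))" "Suc (fst a - 1) = fst a" if "valid G n a" for n a
    using hs that by (auto simp: valid_def)
  have "cmap (Ninf G) E h"
    unfolding cmap_def
  proof (intro conjI allI impI; (elim conjE)?)
    fix n c assume "c \<in> cells (Ninf G) n"
    then obtain a where a: "valid G n a" "c = colim_cls G n a" by (auto simp: Ninf_cells)
    show "h n c \<in> cells E n" unfolding a(2) h[OF a(1)]
      using k_stage[OF a(1)] a(1) unfolding P_def cmap_def k_def valid_def by metis
  next
    fix m n phi c assume phi: "boxhom m n phi" and "c \<in> cells (Ninf G) n"
    then obtain a where a: "valid G n a" "c = colim_cls G n a" by (auto simp: Ninf_cells)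
    have "k m (fst a, act (Nst G (fst a)) m n phi (snd a)) = act E m n phi (k n a)"
      using k_stage[OF a(1)] a(1) phi unfolding P_def cmap_def k_def valid_def by simp
    then show "h m (act (Ninf G) m n phi c) = act E m n phi (h n c)"
      unfolding a(2) Ninf_act_cls[OF phi a(1)] h[OF a(1)] h[OF valid_act[OF phi a(1)]] .
  qed
  moreover have "h n (canon G n f) = u n f" if f: "f \<in> cells (Nst G 1) n" for n f
  proof -
    have "valid G n (1, f)" using f by (simp add: valid_def)
    moreover have "hs 0 = u" using hs(1)[of 0] by (simp add: P_def)
    ultimately show ?thesis using h[of n "(1, f)"] by (simp add: canon_def k_def)
  qed
  moreover have "p n (h n c) = v n c" if "c \<in> cells (Ninf G) n" for n c
  proof -
    obtain a where a: "valid G n a" "c = colim_cls G n a" using \<open>c \<in> _\<close> unfolding Ninf_cells by blast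
    show ?thesis unfolding a(2) h[OF a(1)]
      using k_stage[OF a(1)] a(1) unfolding P_def k_def valid_def by (metis prod.collapse)
  qed
  ultimately show "\<exists>h. cmap (Ninf G) E h \<and> (\<forall>n x. x \<in> cells (Nst G 1) n \<longrightarrow> h n (canon G n x) = u n x) \<and>
      (\<forall>n y. y \<in> cells (Ninf G) n \<longrightarrow> p n (h n y) = v n y)" by blast
qed

text \<open>Kan fibrations are defined by right lifting against open boxes, and \<open>E\<close>,
  \<open>B\<close>, \<open>p\<close> are arbitrary. The left lifting property against all of them is
  what it means to be anodyne; the clause \<open>cmono\<close> records that the map is a
  cofibration.\<close>

theorem mainTheorem4:
  fixes G :: "('v \<times> 'v) set"
    and E :: "'e cset" and B :: "'b cset" and p :: "nat \<Rightarrow> 'e \<Rightarrow> 'b"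
  assumes "refl G"
    and "kan_fibration E B p"
  shows "cubical_set (Nst G 1) \<and> cubical_set (Ninf G) \<and>
         cmono (Nst G 1) (Ninf G) (canon G) \<and>
         llp (Nst G 1) (Ninf G) (canon G) E B p"
  using cubical_set_Nst cubical_set_Ninf cmono_canon llp_canon[OF assms] by blast

end
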